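(* Let $0<\alpha<2$, let $\mu$ be a full, proper and symmetric tempered $\alpha$-stable distribution on $\mathbb{R}^d$ with Lévy measure $\phi$ and Rosinski measure $\mathcal{R}$, let $(S,\Sigma,\nu)$ be a $\sigma$-finite measure space, and let $\mathbb{M}$ be the $\mathbb{R}^d$-valued independently scattered random measure on $\{A\in\Sigma:\nu(A)<\infty\}$ generated by $\mu$. For $D\in L(\mathbb{R}^d)$, measurable $f:S\to L(\mathbb{R}^d)$ and $\delta>0$ put $$h(D)=\int_{\mathbb{R}^d}\left(\|Dx\|^{\alpha}\wedge\|Dx\|^2\right)\mathcal{R}(dx),\qquad H(f,\delta)=\int_S h(\delta^{-1}f(s))\,\nu(ds)\in[0,\infty].$$ Then: (a) $\mathcal{I}(\mathbb{M})=\{f:S\to L(\mathbb{R}^d)\mid f \text{ measurable and } H(f,\delta)<\infty \text{ for all } \delta>0\}=\{f:S\to L(\mathbb{R}^d)\mid f \text{ measurable and } H(f,\delta)<\infty \text{ for some } \delta>0\}$. (b) $\|f\|_{\mathbb{M}}:=\inf\{\delta>0: H(f,\delta)\le 1\}$ defines a quasi-norm on $\mathcal{I}(\mathbb{M})$. Moreover, for every $f\in\mathcal{I}(\mathbb{M})$ and $\delta>0$, $$\left(\frac{\|f\|_{\mathbb{M}}}{\delta}\right)^{\alpha}\wedge\left(\frac{\|f\|_{\mathbb{M}}}{\delta}\right)^{2}\le H(f,\delta)\le\left(\frac{\|f\|_{\mathbb{M}}}{\delta}\right)^{\alpha}\vee\left(\frac{\|f\|_{\mathbb{M}}}{\delta}\right)^{2}.$$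 (c) There exists $L_1\ge 1$ such that, for every $f\in\mathcal{I}(\mathbb{M})$ and $\delta>0$, $\mathbb{P}(\|I(f)\|\ge\delta)\le L_1 H(f,\delta)$. Additionally, if $0<p<\alpha$, there exists a constant $L_2=L_2(p)>0$ such that $\mathbb{E}(\|I(f)\|^p)\le L_2\|f\|_{\mathbb{M}}^p$ for every $f\in\mathcal{I}(\mathbb{M})$. (d) The vector space $\mathcal{I}(\mathbb{M})$ is complete with respect to $\|\cdot\|_{\mathbb{M}}$ and, for $f,f_1,f_2,\ldots\in\mathcal{I}(\mathbb{M})$, we have, as $n\to\infty$, $I(f_n)\to I(f)$ in probability if and only if $\|f_n-f\|_{\mathbb{M}}\to 0$.
   Context: Notation: $a\wedge b=\min(a,b)$, $a\vee b=\max(a,b)$; $\|\cdot\|$ is the Euclidean norm on $\mathbb{R}^d$ and also the induced operator norm on $L(\mathbb{R}^d)$, the space of real $d\times d$ matrices; $S^{d-1}$ is the Euclidean unit sphere; $D^*$ is the adjoint (transpose) of $D$. Infinitely divisible laws: $\mu\sim[a,0,\phi]$ means that $\mu$ has characteristic function $\exp(\psi(u))$ with log-characteristic function (LCF) $\psi(u)=\mathrm{i}\langle a,u\rangle+\int_{\mathbb{R}^d}\big(e^{\mathrm{i}\langle u,x\rangle}-1-\frac{\mathrm{i}\langle u,x\rangle}{1+\|x\|^2}\big)\phi(dx)$, where $\phi$ is a Lévy measure ($\phi(\{0\})=0$, $\int(1\wedge\|x\|^2)\phi(dx)<\infty$). Tempered $\alpha$-stable ($T\alpha S$) distribution on $\mathbb{R}^d$: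 an infinitely divisible law without Gaussian part whose Lévy measure in polar coordinates is $\phi(dr,d\theta)=r^{-\alpha-1}q(r,\theta)\,dr\,\sigma(d\theta)$, with $\sigma$ a finite measure on $S^{d-1}$ and $q:(0,\infty)\times S^{d-1}\to(0,\infty)$ Borel such that for every $\theta$: $(-1)^n\frac{\partial^n}{\partial r^n}q(r,\theta)>0$ for all $r>0$, $n\in\mathbb{N}$, and $\lim_{r\to\infty}q(r,\theta)=0$. It is proper if moreover $\lim_{r\downarrow0}q(r,\theta)=1$ for every $\theta$. Its Rosinski measure is the unique measure $\mathcal{R}$ on $\mathbb{R}^d$ with $\mathcal{R}(\{0\})=0$, $\int(\|x\|^2\wedge\|x\|^\alpha)\mathcal{R}(dx)<\infty$ and $\phi(A)=\int_{\mathbb{R}^d}\int_0^\infty \mathbf{1}_A(rx)r^{-\alpha-1}e^{-r}\,dr\,\mathcal{R}(dx)$ for all Borel $A$. (Known: $\mu$ is proper iff $\int\|x\|^\alpha\mathcal{R}(dx)<\infty$.) $\mu$ is full if it is not concentrated on any hyperplane of $\mathbb{R}^d$; equivalently, $\mathcal{R}$ is not concentrated on any $(d-1)$-dimensional subspace. If $\mu$ is symmetric, then $a=0$, $\phi$ is symmetric and $\psi(u)=\int(\cos\langle u,x\rangle-1)\phi(dx)$. Random measure: with $\mathcal{S}=\{A\in\Sigma:\nu(A)<\infty\}$, an $\mathbb{R}^d$-valued independently scattered random measure (ISRM) on $\mathcal{S}$ assigns to each $A\in\mathcal{S}$ an $\mathbb{R}^d$-valued random vector $\mathbb{M}(A)$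 such that $\mathbb{M}(A_1),\dots,\mathbb{M}(A_k)$ are independent for disjoint $A_1,\dots,A_k\in\mathcal{S}$, and $\mathbb{M}(\bigcup_n A_n)=\sum_n\mathbb{M}(A_n)$ a.s. for disjoint $A_n\in\mathcal{S}$ with $\bigcup_nA_n\in\mathcal{S}$. It is generated by $\mu\sim[a,0,\phi]$ if $\mathbb{M}(A)\sim[\nu(A)a,0,\nu(A)\phi]$ for all $A\in\mathcal{S}$ (such $\mathbb{M}$ exists). Stochastic integral: for simple $f=\sum_jD_j\mathbf{1}_{A_j}$ (finite sum, $D_j\in L(\mathbb{R}^d)$, $A_j\in\mathcal{S}$ disjoint) put $I(f)=\int_S f\,d\mathbb{M}=\sum_jD_j\mathbb{M}(A_j)$. A measurable $f:S\to L(\mathbb{R}^d)$ belongs to $\mathcal{I}(\mathbb{M})$ if there are simple $f_n\to f$ $\nu$-a.e. such that $I(f_n\mathbf{1}_A)$ converges in probability for every $A\in\Sigma$; then $I(f)=\lim I(f_n)$ in probability. Known facts: $\mathcal{I}(\mathbb{M})$ is a real vector space and $I$ is linear; for symmetric $\mu$, $f\in\mathcal{I}(\mathbb{M})$ iff $\int_S\int_{\mathbb{R}^d}(1\wedge\|f(s)x\|^2)\phi(dx)\nu(ds)<\infty$ (this may be taken as the definition of $\mathcal{I}(\mathbb{M})$); the LCF of $I(f)$ is $u\mapsto\int_S\psi(f(s)^*u)\nu(ds)$. Elements of $\mathcal{I}(\mathbb{M})$ that agree $\nu$-a.e. are identified. Quasi-norm on $\mathcal{I}(\mathbb{M})$: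 a map $\mathcal{I}(\mathbb{M})\to[0,\infty)$ with the usual properties of a norm, except that the triangle inequality is weakened to: there is $A\ge1$ with $\|f_1+f_2\|_{\mathbb{M}}\le A(\|f_1\|_{\mathbb{M}}+\|f_2\|_{\mathbb{M}})$ for all $f_1,f_2\in\mathcal{I}(\mathbb{M})$. *)

theory Defs
  imports "HOL-Probability.Probability"
begin

section \<open>Infinitely divisible and tempered stable laws\<close>

definition levy_measure :: "(real^'n) measure \<Rightarrow> bool" where
  "levy_measure \<phi> \<longleftrightarrow> sets \<phi> = sets borel \<and> emeasure \<phi> {0} = 0 \<and>
     (\<integral>\<^sup>+x. ennreal (min 1 ((norm x)\<^sup>2)) \<partial>\<phi>) < \<infinity>"

definition lcf :: "real^'n \<Rightarrow> (real^'n) measure \<Rightarrow> real^'n \<Rightarrow> complex" where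
  "lcf a \<phi> u = \<i> * complex_of_real (a \<bullet> u) +
     (CLINT x|\<phi>. iexp (u \<bullet> x) - 1 - \<i> * complex_of_real ((u \<bullet> x) / (1 + (norm x)\<^sup>2)))"

text \<open>\<open>id_law \<mu> a \<phi>\<close> stands for $\mu \sim [a,0,\phi]$: there is no Gaussian part.\<close>

definition id_law :: "(real^'n) measure \<Rightarrow> real^'n \<Rightarrow> (real^'n) measure \<Rightarrow> bool" where
  "id_law \<mu> a \<phi> \<longleftrightarrow> prob_space \<mu> \<and> sets \<mu> = sets borel \<and> levy_measure \<phi> \<and>
     (\<forall>u. (CLINT x|\<mu>. iexp (u \<bullet> x)) = exp (lcf a \<phi> u))"

text \<open>Differentiability is required explicitly because \<^const>\<open>deriv\<close> is total.\<close>

definition tempering_function :: "(real \<Rightarrow> real^'n \<Rightarrow> real) \<Rightarrow> bool" where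
  "tempering_function q \<longleftrightarrow>
     (\<lambda>(r, \<theta>). q r \<theta>) \<in> borel_measurable (restrict_space borel ({0<..} \<times> sphere 0 1)) \<and>
     (\<forall>\<theta>\<in>sphere 0 1.
        (\<forall>r>0. q r \<theta> > 0) \<and>
        (\<forall>n. \<forall>r>0. (deriv ^^ n) (\<lambda>r. q r \<theta>) differentiable at r \<and>
                   (- 1) ^ n * (deriv ^^ n) (\<lambda>r. q r \<theta>) r > 0) \<and>
        ((\<lambda>r. q r \<theta>) \<longlongrightarrow> 0) at_top)"

definition tempered_polar_form ::
  "real \<Rightarrow> (real^'n) measure \<Rightarrow> (real \<Rightarrow> real^'n \<Rightarrow> real) \<Rightarrow> (real^'n) measure \<Rightarrow> bool" where
  "tempered_polar_form \<alpha> \<sigma> q \<phi> \<longleftrightarrow>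
     finite_measure \<sigma> \<and> sets \<sigma> = sets (restrict_space borel (sphere 0 1)) \<and>
     tempering_function q \<and>
     (\<forall>A\<in>sets borel. emeasure \<phi> A =
        (\<integral>\<^sup>+\<theta>. (\<integral>\<^sup>+r\<in>{0<..}. ennreal (r powr (- \<alpha> - 1) * q r \<theta>) * indicator A (r *\<^sub>R \<theta>) \<partial>lborel) \<partial>\<sigma>))"

definition tempered_stable ::
  "real \<Rightarrow> (real^'n) measure \<Rightarrow> real^'n \<Rightarrow> (real^'n) measure \<Rightarrow> bool" where
  "tempered_stable \<alpha> \<mu> a \<phi> \<longleftrightarrow> id_law \<mu> a \<phi> \<and> (\<exists>\<sigma> q. tempered_polar_form \<alpha> \<sigma> q \<phi>)"

text \<open>The pair \<open>(\<sigma>, q)\<close> is only determined up to a rescaling depending on \<open>\<theta>\<close>; properness asks for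
  one representation that is normalised at the origin.\<close>

definition proper_tempered_stable ::
  "real \<Rightarrow> (real^'n) measure \<Rightarrow> real^'n \<Rightarrow> (real^'n) measure \<Rightarrow> bool" where
  "proper_tempered_stable \<alpha> \<mu> a \<phi> \<longleftrightarrow> tempered_stable \<alpha> \<mu> a \<phi> \<and>
     (\<exists>\<sigma> q. tempered_polar_form \<alpha> \<sigma> q \<phi> \<and>
        (\<forall>\<theta>\<in>sphere 0 1. ((\<lambda>r. q r \<theta>) \<longlongrightarrow> 1) (at_right 0)))"

definition rosinski_measure :: "real \<Rightarrow> (real^'n) measure \<Rightarrow> (real^'n) measure \<Rightarrow> bool" where
  "rosinski_measure \<alpha> \<phi> R \<longleftrightarrow> sets R = sets borel \<and> emeasure R {0} = 0 \<and>
     (\<integral>\<^sup>+x. ennreal (min ((norm x)\<^sup>2) (norm x powr \<alpha>)) \<partial>R) < \<infinity> \<and>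
     (\<forall>A\<in>sets borel. emeasure \<phi> A =
        (\<integral>\<^sup>+x. (\<integral>\<^sup>+r\<in>{0<..}. ennreal (r powr (- \<alpha> - 1) * exp (- r)) * indicator A (r *\<^sub>R x) \<partial>lborel) \<partial>R))"

text \<open>Hyperplanes are affine here.\<close>

definition full_law :: "(real^'n) measure \<Rightarrow> bool" where
  "full_law \<mu> \<longleftrightarrow> (\<forall>c b. c \<noteq> 0 \<longrightarrow> \<not> (AE x in \<mu>. c \<bullet> x = b))"

definition symmetric_law :: "(real^'n) measure \<Rightarrow> bool" where
  "symmetric_law \<mu> \<longleftrightarrow> distr \<mu> borel uminus = \<mu>"


section \<open>Random measures and stochastic integrals\<close>

definition finite_sets :: "'s measure \<Rightarrow> 's set set" where
  "finite_sets \<nu> = {A \<in> sets \<nu>. emeasure \<nu> A < \<infinity>}"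

definition ISRM :: "'w measure \<Rightarrow> 's measure \<Rightarrow> ('s set \<Rightarrow> 'w \<Rightarrow> real^'n) \<Rightarrow> bool" where
  "ISRM P \<nu> M \<longleftrightarrow> prob_space P \<and>
     (\<forall>A\<in>finite_sets \<nu>. M A \<in> borel_measurable P) \<and>
     (\<forall>(A :: nat \<Rightarrow> 's set) k. (\<forall>i<k. A i \<in> finite_sets \<nu>) \<and> disjoint_family_on A {..<k} \<longrightarrow>
        prob_space.indep_vars P (\<lambda>_. borel) (\<lambda>i. M (A i)) {..<k}) \<and>
     (\<forall>A :: nat \<Rightarrow> 's set. range A \<subseteq> finite_sets \<nu> \<and> disjoint_family A \<and> (\<Union>n. A n) \<in> finite_sets \<nu> \<longrightarrow>
        (AE \<omega> in P. (\<lambda>n. M (A n) \<omega>) sums M (\<Union>n. A n) \<omega>))"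

definition ISRM_generated_by ::
  "'w measure \<Rightarrow> 's measure \<Rightarrow> ('s set \<Rightarrow> 'w \<Rightarrow> real^'n) \<Rightarrow> real^'n \<Rightarrow> (real^'n) measure \<Rightarrow> bool" where
  "ISRM_generated_by P \<nu> M a \<phi> \<longleftrightarrow> ISRM P \<nu> M \<and>
     (\<forall>A\<in>finite_sets \<nu>.
        id_law (distr P borel (M A)) (measure \<nu> A *\<^sub>R a) (scale_measure (emeasure \<nu> A) \<phi>))"

definition tendsto_in_prob ::
  "'w measure \<Rightarrow> (nat \<Rightarrow> 'w \<Rightarrow> 'b::real_normed_vector) \<Rightarrow> ('w \<Rightarrow> 'b) \<Rightarrow> bool" where
  "tendsto_in_prob P X Y \<longleftrightarrow>
     (\<forall>\<epsilon>>0. (\<lambda>n. measure P {\<omega> \<in> space P. norm (X n \<omega> - Y \<omega>) > \<epsilon>}) \<longlonglongrightarrow> 0)"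

text \<open>A simple function is one satisfying \<^const>\<open>Bochner_Integration.simple_bochner_integrable\<close>: measurable, with finitely
  many values, and nonzero only on a set of finite measure. Its integral is computed from the
  partition into level sets; by additivity of \<open>M\<close> every other representation $\sum_j D_j 1_{A_j}$
  gives the same random vector almost surely. The level set of the value \<open>0\<close> may have infinite
  measure, but its summand vanishes.\<close>

definition simple_ISRM_integral ::
  "'s measure \<Rightarrow> ('s set \<Rightarrow> 'w \<Rightarrow> real^'n) \<Rightarrow> ('s \<Rightarrow> real^'n^'n) \<Rightarrow> 'w \<Rightarrow> real^'n" where
  "simple_ISRM_integral \<nu> M f \<omega> = (\<Sum>D\<in>f ` space \<nu>. D *v M {s \<in> space \<nu>. f s = D} \<omega>)"

definition has_ISRM_integral ::
  "'w measure \<Rightarrow> 's measure \<Rightarrow> ('s set \<Rightarrow> 'w \<Rightarrow> real^'n) \<Rightarrow> ('s \<Rightarrow> real^'n^'n) \<Rightarrow> ('w \<Rightarrow> real^'n) \<Rightarrow> bool" where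
  "has_ISRM_integral P \<nu> M f X \<longleftrightarrow> f \<in> borel_measurable \<nu> \<and> X \<in> borel_measurable P \<and>
     (\<exists>F :: nat \<Rightarrow> 's \<Rightarrow> real^'n^'n.
        (\<forall>n. Bochner_Integration.simple_bochner_integrable \<nu> (F n)) \<and>
        (AE s in \<nu>. (\<lambda>n. F n s) \<longlonglongrightarrow> f s) \<and>
        (\<forall>A\<in>sets \<nu>. \<exists>Y\<in>borel_measurable P.
           tendsto_in_prob P (\<lambda>n. simple_ISRM_integral \<nu> M (\<lambda>s. indicator A s *\<^sub>R F n s)) Y) \<and>
        tendsto_in_prob P (\<lambda>n. simple_ISRM_integral \<nu> M (F n)) X)"

definition ISRM_integrable ::
  "'w measure \<Rightarrow> 's measure \<Rightarrow> ('s set \<Rightarrow> 'w \<Rightarrow> real^'n) \<Rightarrow> ('s \<Rightarrow> real^'n^'n) set" where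
  "ISRM_integrable P \<nu> M = {f. \<exists>X. has_ISRM_integral P \<nu> M f X}"

text \<open>The integral is determined up to almost sure equality only; a version is chosen.\<close>

definition ISRM_integral ::
  "'w measure \<Rightarrow> 's measure \<Rightarrow> ('s set \<Rightarrow> 'w \<Rightarrow> real^'n) \<Rightarrow> ('s \<Rightarrow> real^'n^'n) \<Rightarrow> 'w \<Rightarrow> real^'n" where
  "ISRM_integral P \<nu> M f = (SOME X. has_ISRM_integral P \<nu> M f X)"


section \<open>The quasi-norm\<close>

definition h_fun :: "real \<Rightarrow> (real^'n) measure \<Rightarrow> real^'n^'n \<Rightarrow> ennreal" where
  "h_fun \<alpha> R D = (\<integral>\<^sup>+x. ennreal (min (norm (D *v x) powr \<alpha>) ((norm (D *v x))\<^sup>2)) \<partial>R)"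

definition H_fun ::
  "real \<Rightarrow> (real^'n) measure \<Rightarrow> 's measure \<Rightarrow> ('s \<Rightarrow> real^'n^'n) \<Rightarrow> real \<Rightarrow> ennreal" where
  "H_fun \<alpha> R \<nu> f \<delta> = (\<integral>\<^sup>+s. h_fun \<alpha> R ((1 / \<delta>) *\<^sub>R f s) \<partial>\<nu>)"

definition M_norm :: "real \<Rightarrow> (real^'n) measure \<Rightarrow> 's measure \<Rightarrow> ('s \<Rightarrow> real^'n^'n) \<Rightarrow> real" where
  "M_norm \<alpha> R \<nu> f = Inf {\<delta>. \<delta> > 0 \<and> H_fun \<alpha> R \<nu> f \<delta> \<le> 1}"

text \<open>A quasi-norm on a space \<open>V\<close> of measurable functions whose elements are identified when they
  agree almost everywhere: \<open>V\<close> is a vector space, \<open>V\<close> and \<open>N\<close> respect the identification, and the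
  zero vector is the class of functions vanishing almost everywhere.\<close>

definition quasi_norm_AE ::
  "'s measure \<Rightarrow> ('s \<Rightarrow> 'b::real_normed_vector) set \<Rightarrow> (('s \<Rightarrow> 'b) \<Rightarrow> real) \<Rightarrow> bool" where
  "quasi_norm_AE \<nu> V N \<longleftrightarrow>
     V \<subseteq> borel_measurable \<nu> \<and>
     (\<lambda>_. 0) \<in> V \<and>
     (\<forall>f\<in>V. \<forall>g\<in>V. (\<lambda>s. f s + g s) \<in> V) \<and>
     (\<forall>c. \<forall>f\<in>V. (\<lambda>s. c *\<^sub>R f s) \<in> V) \<and>
     (\<forall>f\<in>V. \<forall>g\<in>borel_measurable \<nu>. (AE s in \<nu>. f s = g s) \<longrightarrow> g \<in> V \<and> N g = N f) \<and>
     (\<forall>f\<in>V. 0 \<le> N f) \<and>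
     (\<forall>f\<in>V. N f = 0 \<longleftrightarrow> (AE s in \<nu>. f s = 0)) \<and>
     (\<forall>c. \<forall>f\<in>V. N (\<lambda>s. c *\<^sub>R f s) = \<bar>c\<bar> * N f) \<and>
     (\<exists>A\<ge>1. \<forall>f\<in>V. \<forall>g\<in>V. N (\<lambda>s. f s + g s) \<le> A * (N f + N g))"

definition complete_wrt ::
  "('s \<Rightarrow> 'b::real_normed_vector) set \<Rightarrow> (('s \<Rightarrow> 'b) \<Rightarrow> real) \<Rightarrow> bool" where
  "complete_wrt V N \<longleftrightarrow>
     (\<forall>F :: nat \<Rightarrow> 's \<Rightarrow> 'b. (\<forall>n. F n \<in> V) \<and>
        (\<forall>\<epsilon>>0. \<exists>n0. \<forall>m\<ge>n0. \<forall>n\<ge>n0. N (\<lambda>s. F m s - F n s) < \<epsilon>) \<longrightarrow>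
        (\<exists>f\<in>V. (\<lambda>n. N (\<lambda>s. F n s - f s)) \<longlonglongrightarrow> 0))"

end

theory Submission
  imports Defs
begin

text \<open>Integrating over the radial variable, the log-characteristic function of \<open>\<mu>\<close> becomes
  \<open>- \<integral> g (u \<bullet> x) R(dx)\<close>, where \<open>g t\<close> is the integral of \<open>(1 - cos (r t)) r\<^sup>-\<^sup>\<alpha>\<^sup>-\<^sup>1 e\<^sup>-\<^sup>r\<close> over \<open>r > 0\<close> and is comparable to
  \<open>m t = min (\<bar>t\<bar>\<^sup>\<alpha>) (t\<^sup>2)\<close>. For simple integrands independence therefore gives two estimates: \<open>H\<close> bounds the tails of
  the integral, and the integrals of \<open>G\<^sub>n\<close> can tend to \<open>0\<close> in probability only if \<open>H G\<^sub>n 1\<close> tends to \<open>0\<close>. As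
  \<open>m (s + t) \<le> 4 (m s + m t)\<close>, \<open>H\<close> is quasi-subadditive, so convergence in probability of integrals of simple
  functions is the same as being Cauchy for \<open>H\<close>, and every assertion passes to the limit by Fatou's lemma. Fullness
  enters through \<open>h D \<ge> c m (norm D)\<close>, by compactness of the unit sphere: it turns smallness of \<open>H\<close> into convergence
  in measure. The bounds relating \<open>H\<close> and the quasi-norm only use \<open>m (l t) \<le> max (l\<^sup>\<alpha>) (l\<^sup>2) m t\<close>.\<close>

section \<open>The comparison function and the radial kernel\<close>

text \<open>The laws involved are accessible only through characteristic functions, so both
  estimates are read off exponents. Symmetry makes these exponents real: the expectation of 1 - cos
  of the integral in direction u is then 1 - exp (- \<open>K F u\<close>), bounded by
  \<open>K F u\<close> in one direction and inverted by a logarithm in the other. For the tails, 1 -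
  cos is averaged over a segment of directions u; keeping \<open>H\<close> at the scale \<delta> of
  the level makes the constant free of \<delta>, and dyadic levels in units of the quasi-norm then
  give the moments of order p < \<alpha>. For the converse, finitely many directions suffice, since
  the largest coordinate of a vector controls its norm. The integral is an arbitrarily chosen
  version of a limit, and its definition also demands almost everywhere convergence and control of
  all restrictions to sets A. Estimates are therefore proved for every X that is a limit of simple
  integrals along an approximation in \<open>H\<close>; almost everywhere convergence is recovered
  along a subsequence, and restriction to A does not increase \<open>H\<close>.\<close>

definition pmin :: "real \<Rightarrow> real \<Rightarrow> real" where
  "pmin \<alpha> t = min (t powr \<alpha>) (t\<^sup>2)"

definition pmax :: "real \<Rightarrow> real \<Rightarrow> real" where
  "pmax \<alpha> t = max (t powr \<alpha>) (t\<^sup>2)"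

lemma pmin_nonneg [simp]: "0 \<le> pmin \<alpha> t"
  by (simp add: pmin_def)

lemma pmax_nonneg [simp]: "0 \<le> pmax \<alpha> t"
  by (simp add: pmax_def le_max_iff_disj)

lemma pmin_0 [simp]: "pmin \<alpha> 0 = 0"
  by (simp add: pmin_def)

lemma pmax_1 [simp]: "pmax \<alpha> 1 = 1"
  by (simp add: pmax_def)

lemma pmin_pos: "0 < t \<Longrightarrow> 0 < pmin \<alpha> t"
  by (simp add: pmin_def)

lemma pmin_measurable [measurable]: "pmin \<alpha> \<in> borel_measurable borel"
  unfolding pmin_def by measurable

lemma pmin_mono:
  assumes "0 < \<alpha>" "0 \<le> s" "s \<le> t" shows "pmin \<alpha> s \<le> pmin \<alpha> t"
  unfolding pmin_def using assms by (intro min.mono powr_mono2 power_mono) auto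

text \<open>A common factor comes out of the minimum once it dominates both
  \<open>l powr \<alpha>\<close> and \<open>l\<^sup>2\<close>, hence the maximum. Every change of
  the scale \<delta> rests on this inequality.\<close>

lemma pmin_mult_le:
  assumes "0 \<le> l" "0 \<le> t" shows "pmin \<alpha> (l * t) \<le> pmax \<alpha> l * pmin \<alpha> t"
proof -
  have "pmin \<alpha> (l * t) = min (l powr \<alpha> * t powr \<alpha>) (l\<^sup>2 * t\<^sup>2)"
    using assms by (simp add: pmin_def powr_mult power_mult_distrib)
  also have "\<dots> \<le> min (pmax \<alpha> l * t powr \<alpha>) (pmax \<alpha> l * t\<^sup>2)"
    by (intro min.mono mult_right_mono) (auto simp: pmax_def)
  also have "\<dots> = pmax \<alpha> l * pmin \<alpha> t"
    using pmax_nonneg[of \<alpha> l] by (simp add: pmin_def min_mult_distrib_left not_le)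
  finally show ?thesis .
qed

text \<open>Inversion exchanges minimum and maximum. The scaling inequality, read backwards,
  therefore gives lower bounds without a further constant.\<close>

lemma pmin_inverse:
  assumes "0 < l" shows "pmax \<alpha> (1 / l) * pmin \<alpha> l = 1"
proof -
  have "pmax \<alpha> (1/l) = 1 / pmin \<alpha> l"
    using assms unfolding pmax_def pmin_def
    by (auto simp: powr_divide power_divide max_def min_def frac_le field_simps)
  with pmin_pos[OF assms, of \<alpha>] show ?thesis by simp
qed

lemma pmax_2: "\<alpha> < 2 \<Longrightarrow> pmax \<alpha> 2 = 4"
  using powr_mono[of \<alpha> 2 2] by (simp add: pmax_def max_def)

text \<open>The sum is at most twice the larger term, and scaling by 2 costs
  \<open>pmax \<alpha> 2\<close>, which is 4 because \<alpha> < 2. This is the origin of the factor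
  4 in all quasi-triangle inequalities below.\<close>

lemma pmin_add_le:
  assumes "0 < \<alpha>" "\<alpha> < 2" "0 \<le> s" "0 \<le> t"
  shows "pmin \<alpha> (s + t) \<le> 4 * (pmin \<alpha> s + pmin \<alpha> t)"
proof -
  have "pmin \<alpha> (s + t) \<le> pmin \<alpha> (2 * max s t)"
    using assms by (intro pmin_mono) auto
  also have "\<dots> \<le> 4 * pmin \<alpha> (max s t)"
    using pmin_mult_le[of 2 "max s t" \<alpha>] assms by (simp add: pmax_2)
  also have "\<dots> \<le> 4 * (pmin \<alpha> s + pmin \<alpha> t)"
    using pmin_nonneg[of \<alpha> s] pmin_nonneg[of \<alpha> t] unfolding max_def by (auto simp del: pmin_nonneg)
  finally show ?thesis .
qed

lemma tendsto_pmin: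
  assumes "0 < \<alpha>" "(f \<longlongrightarrow> l) F" "eventually (\<lambda>x. 0 \<le> f x) F"
  shows "((\<lambda>x. pmin \<alpha> (f x)) \<longlongrightarrow> pmin \<alpha> l) F"
  unfolding pmin_def
  by (intro tendsto_min tendsto_powr' tendsto_power assms tendsto_const) (use assms in auto)

lemma tendsto_pmax:
  assumes "0 < \<alpha>" "(f \<longlongrightarrow> l) F" "eventually (\<lambda>x. 0 \<le> f x) F"
  shows "((\<lambda>x. pmax \<alpha> (f x)) \<longlongrightarrow> pmax \<alpha> l) F"
  unfolding pmax_def
  by (intro tendsto_max tendsto_powr' tendsto_power assms tendsto_const) (use assms in auto)

lemma pmax_0 [simp]: "pmax \<alpha> 0 = 0"
  by (simp add: pmax_def)

lemma pmax_mono: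
  assumes "0 < \<alpha>" "0 \<le> s" "s \<le> t" shows "pmax \<alpha> s \<le> pmax \<alpha> t"
  unfolding pmax_def using assms by (intro max.mono powr_mono2 power_mono) auto

lemma pmax_small:
  assumes "0 < \<alpha>" "0 < e" obtains d where "0 < d" "pmax \<alpha> d < e"
proof -
  have "(\<lambda>n. pmax \<alpha> (inverse (real (Suc n)))) \<longlonglongrightarrow> pmax \<alpha> 0"
    by (intro tendsto_pmax LIMSEQ_inverse_real_of_nat assms) auto
  then have "eventually (\<lambda>n. pmax \<alpha> (inverse (real (Suc n))) < e) sequentially"
    using assms by (intro order_tendstoD) auto
  then obtain n where "pmax \<alpha> (inverse (real (Suc n))) < e" by (auto simp: eventually_sequentially)
  then show thesis by (intro that[of "inverse (real (Suc n))"]) auto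
qed

text \<open>On the unit interval the smaller exponent gives the larger power. The moment estimate
  needs this pure power to see the decay rate \<alpha> of the tails.\<close>

lemma pmax_le_1: "\<alpha> < 2 \<Longrightarrow> 0 \<le> s \<Longrightarrow> s \<le> 1 \<Longrightarrow> pmax \<alpha> s = s powr \<alpha>"
  using powr_mono'[of \<alpha> 2 s] by (cases "s = 0") (auto simp: pmax_def max_def)

section \<open>Bounds for the cosine and for the radial integral\<close>

lemma one_minus_cos_le_square: "1 - cos y \<le> y\<^sup>2 / 2" for y :: real
proof -
  have "1 - cos y = 2 * (sin (y/2))\<^sup>2" using cos_double_sin[of "y/2"] by simp
  also have "(sin (y/2))\<^sup>2 \<le> (y/2)\<^sup>2"
    using abs_sin_x_le_abs_x[of "y/2"] by (simp only: abs_le_square_iff)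
  finally show ?thesis by (simp add: power_divide)
qed

text \<open>Halving the angle reduces the claim to a lower bound for the sine: by the mean value
  theorem sin x = x cos z with 0 < z < x \<le> 1/2, where the cosine is at least 7/8. The resulting
  constant 49/128 is rounded down to 1/4.\<close>

lemma one_minus_cos_ge_square:
  fixes y :: real assumes "\<bar>y\<bar> \<le> 1" shows "y\<^sup>2 / 4 \<le> 1 - cos y"
proof (cases "y = 0")
  case False
  define x where "x = \<bar>y\<bar> / 2"
  have x: "0 < x" "x \<le> 1/2" using assms False by (auto simp: x_def)
  obtain z where z: "0 < z" "z < x" "sin x - sin 0 = (x - 0) * cos z"
    using MVT2[of 0 x sin cos] x DERIV_sin by blast
  have "z\<^sup>2 \<le> (1/2)\<^sup>2" using z x by (intro power_mono) auto
  then have "7/8 \<le> cos z" using one_minus_cos_le_square[of z] by (simp add: power_divide)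
  then have "7/8 * x \<le> sin x" using z x by simp
  then have "(7/8 * x)\<^sup>2 \<le> (sin x)\<^sup>2" using x by (intro power_mono) auto
  moreover have "1 - cos y = 2 * (sin x)\<^sup>2"
    using cos_double_sin[of x] by (simp add: x_def)
  moreover have "(7/8 * x)\<^sup>2 = 49/256 * y\<^sup>2"
    by (simp add: x_def power_mult_distrib power_divide)
  moreover have "0 \<le> y\<^sup>2" by simp
  ultimately show ?thesis by linarith
qed simp

definition tail_bound :: "real \<Rightarrow> ennreal" where
  "tail_bound \<alpha> = (\<integral>\<^sup>+r\<in>{0<..}. ennreal (min 2 (r\<^sup>2 / 2) * r powr (- \<alpha> - 1)) \<partial>lborel)"

text \<open>Near 0 the integrand is of order \<open>r powr (1 - \<alpha>)\<close>, integrable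
  because \<alpha> < 2; at infinity it is of order \<open>r powr (- \<alpha> - 1)\<close>,
  integrable because \<alpha> > 0.\<close>

lemma tail_bound_finite:
  assumes "0 < \<alpha>" "\<alpha> < 2" shows "tail_bound \<alpha> < \<infinity>"
proof -
  have 1: "(\<integral>\<^sup>+r. ennreal (r powr (1 - \<alpha>)) * indicator {0..1} r \<partial>lborel) = ennreal (1 powr (1-\<alpha>+1) / (1-\<alpha>+1))"
    by (rule nn_integral_has_integral_lebesgue', simp, rule has_integral_powr_from_0) (use assms in auto)
  have 2: "(\<integral>\<^sup>+r. ennreal (r powr (-\<alpha>-1)) * indicator {1..} r \<partial>lborel) = ennreal (- (1 powr (-\<alpha>-1+1)) / (-\<alpha>-1+1))"
    by (rule nn_integral_has_integral_lebesgue', simp, rule has_integral_powr_to_inf) (use assms in auto)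
  have 3: "ennreal (min 2 (r\<^sup>2 / 2) * r powr (- \<alpha> - 1)) * indicator {0<..} r \<le>
      ennreal (r powr (1 - \<alpha>)) * indicator {0..1} r + 2 * (ennreal (r powr (-\<alpha>-1)) * indicator {1..} r)" for r
  proof (cases "0 < r")
    case True
    show ?thesis
    proof (cases "r \<le> 1")
      case r: True
      have "min 2 (r\<^sup>2 / 2) * r powr (- \<alpha> - 1) \<le> r\<^sup>2 * r powr (-\<alpha> - 1)"
        using True by (intro mult_right_mono) (auto simp: min_le_iff_disj)
      also have "\<dots> = r powr 2 * r powr (-\<alpha> - 1)"
        using True by simp
      also have "\<dots> = r powr (1 - \<alpha>)"
        by (simp only: powr_add[symmetric]) simp
      finally show ?thesis using True r
        by (intro add_increasing2) (auto simp: indicator_def intro!: ennreal_leI)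
    next
      case r: False
      have "min 2 (r\<^sup>2 / 2) * r powr (- \<alpha> - 1) \<le> 2 * r powr (-\<alpha> - 1)"
        by (intro mult_right_mono) auto
      then have "ennreal (min 2 (r\<^sup>2 / 2) * r powr (- \<alpha> - 1)) \<le> 2 * ennreal (r powr (-\<alpha> - 1))"
        by (simp add: ennreal_leI ennreal_mult'[symmetric] flip: ennreal_numeral)
      then show ?thesis using r True by (auto simp: indicator_def)
    qed
  qed (simp add: indicator_def)
  have "tail_bound \<alpha> \<le> (\<integral>\<^sup>+r. (ennreal (r powr (1 - \<alpha>)) * indicator {0..1} r + 2 * (ennreal (r powr (-\<alpha>-1)) * indicator {1..} r)) \<partial>lborel)"
    unfolding tail_bound_def by (intro nn_integral_mono 3)
  also have "\<dots> < \<infinity>"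
    by (subst nn_integral_add, measurable, subst nn_integral_cmult, measurable, subst 1, subst 2)
       (simp add: ennreal_mult_less_top)
  finally show ?thesis .
qed

definition stable_kernel :: "real \<Rightarrow> real \<Rightarrow> ennreal" where
  "stable_kernel \<alpha> t =
     (\<integral>\<^sup>+r\<in>{0<..}. ennreal ((1 - cos (r * t)) * (r powr (- \<alpha> - 1) * exp (- r))) \<partial>lborel)"

lemma stable_kernel_measurable [measurable]: "stable_kernel \<alpha> \<in> borel_measurable borel"
  unfolding stable_kernel_def[abs_def] by measurable

lemma stable_kernel_minus [simp]: "stable_kernel \<alpha> (- t) = stable_kernel \<alpha> t"
  by (simp add: stable_kernel_def)

text \<open>Two bounds hold for every t, and their minimum is the claim. For the quadratic one the
  exponential tames large r; for the one of order \<alpha> the exponential is dropped and the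
  variable is rescaled by the modulus of t.\<close>

lemma stable_kernel_le:
  assumes "0 < \<alpha>" "\<alpha> < 2"
  shows "stable_kernel \<alpha> t \<le> ennreal (enn2real (tail_bound \<alpha>) * pmin \<alpha> \<bar>t\<bar>)"
proof (cases "t = 0")
  case True
  then show ?thesis by (simp add: stable_kernel_def)
next
  case False
  define s where "s = \<bar>t\<bar>"
  have s: "0 < s" using False by (simp add: s_def)
  have eq: "stable_kernel \<alpha> t = stable_kernel \<alpha> s"
    unfolding s_def by (cases "0 \<le> t") auto
  have "stable_kernel \<alpha> s \<le> (\<integral>\<^sup>+r. ennreal (s\<^sup>2) * (ennreal (min 2 (r\<^sup>2 / 2) * r powr (- \<alpha> - 1)) * indicator {0<..} r) \<partial>lborel)"
    unfolding stable_kernel_def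
  proof (intro nn_integral_mono)
    fix r :: real
    have "(1 - cos (r * s)) * (r powr (- \<alpha> - 1) * exp (- r)) \<le> s\<^sup>2 * (min 2 (r\<^sup>2 / 2) * r powr (- \<alpha> - 1))" if "0 < r"
    proof -
      have "(1 - cos (r * s)) * exp (- r) \<le> (s\<^sup>2 * r\<^sup>2 / 2) * exp (- r)"
        using one_minus_cos_le_square[of "r * s"] by (intro mult_right_mono) (auto simp: power_mult_distrib mult.commute)
      also have "\<dots> = s\<^sup>2 * (r\<^sup>2 / 2 * exp (- r))" by simp
      also have "\<dots> \<le> s\<^sup>2 * min 2 (r\<^sup>2 / 2)"
      proof (intro mult_left_mono min.boundedI)
        \<comment> \<open>The weight \<open>exp (- r)\<close> must bring
          \<open>r\<^sup>2 / 2\<close> below 2, so that the integrand of \<open>tail_bound\<close>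
          reappears; the Taylor bound even gives 1.\<close>
        have "r\<^sup>2 / 2 \<le> exp r" using exp_lower_Taylor_quadratic[of r] that by simp
        then have "r\<^sup>2 / 2 * exp (- r) \<le> 1" by (simp add: exp_minus field_simps)
        then show "r\<^sup>2 / 2 * exp (- r) \<le> 2" by simp
        show "r\<^sup>2 / 2 * exp (- r) \<le> r\<^sup>2 / 2"
          using that by (intro mult_right_le_one_le) auto
      qed simp
      finally have "(1 - cos (r * s)) * exp (- r) * r powr (- \<alpha> - 1) \<le> s\<^sup>2 * min 2 (r\<^sup>2 / 2) * r powr (- \<alpha> - 1)"
        by (intro mult_right_mono) auto
      then show ?thesis by (simp add: mult_ac)
    qed
    then show "ennreal ((1 - cos (r * s)) * (r powr (- \<alpha> - 1) * exp (- r))) * indicator {0<..} r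
      \<le> ennreal (s\<^sup>2) * (ennreal (min 2 (r\<^sup>2 / 2) * r powr (- \<alpha> - 1)) * indicator {0<..} r)"
      by (auto simp: indicator_def ennreal_mult'[symmetric] intro!: ennreal_leI)
  qed
  also have "\<dots> = ennreal (s\<^sup>2) * tail_bound \<alpha>"
    unfolding tail_bound_def by (intro nn_integral_cmult) measurable
  finally have b1: "stable_kernel \<alpha> s \<le> ennreal (s\<^sup>2) * tail_bound \<alpha>" .
  \<comment> \<open>The integrand is written in the variable s r. Of the factor
    \<open>s powr (\<alpha>+1)\<close>, one power of s is the Jacobian of the substitution and
    \<open>s powr \<alpha>\<close> remains.\<close>
  have "stable_kernel \<alpha> s \<le> (\<integral>\<^sup>+r. ennreal (s powr (\<alpha>+1)) * (ennreal (min 2 ((s * r)\<^sup>2 / 2) * (s * r) powr (- \<alpha> - 1)) * indicator {0<..} (s * r)) \<partial>lborel)"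
    unfolding stable_kernel_def
  proof (intro nn_integral_mono)
    fix r :: real
    have "(1 - cos (r * s)) * (r powr (- \<alpha> - 1) * exp (- r)) \<le> s powr (\<alpha>+1) * (min 2 ((s*r)\<^sup>2 / 2) * (s*r) powr (- \<alpha> - 1))" if "0 < r"
    proof -
      have "(s*r) powr (- \<alpha> - 1) = s powr (- \<alpha> - 1) * r powr (- \<alpha> - 1)"
        using s that by (simp add: powr_mult)
      then have "s powr (\<alpha>+1) * (s*r) powr (- \<alpha> - 1) = (s powr (\<alpha>+1) * s powr (- \<alpha> - 1)) * r powr (- \<alpha> - 1)" by simp
      also have "s powr (\<alpha>+1) * s powr (- \<alpha> - 1) = 1"
        using s by (simp only: powr_add[symmetric]) simp
      finally have *: "s powr (\<alpha>+1) * (s*r) powr (- \<alpha> - 1) = r powr (- \<alpha> - 1)" by simp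
      have "1 - cos (r * s) \<le> 2" using cos_ge_minus_one[of "r * s"] by linarith
      then have "(1 - cos (r * s)) * (r powr (- \<alpha> - 1) * exp (- r)) \<le> min 2 ((s*r)\<^sup>2 / 2) * (r powr (- \<alpha> - 1) * 1)"
        using one_minus_cos_le_square[of "r * s"] that by (intro mult_mono) (auto simp: mult.commute)
      also have "\<dots> = s powr (\<alpha>+1) * (min 2 ((s*r)\<^sup>2 / 2) * (s*r) powr (- \<alpha> - 1))"
        unfolding *[symmetric] by (simp only: mult_1_right mult_ac)
      finally show ?thesis .
    qed
    then show "ennreal ((1 - cos (r * s)) * (r powr (- \<alpha> - 1) * exp (- r))) * indicator {0<..} r
      \<le> ennreal (s powr (\<alpha>+1)) * (ennreal (min 2 ((s*r)\<^sup>2 / 2) * (s*r) powr (- \<alpha> - 1)) * indicator {0<..} (s*r))"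
      using s by (auto simp: indicator_def ennreal_mult'[symmetric] zero_less_mult_iff intro!: ennreal_leI)
  qed
  also have "\<dots> = ennreal (s powr (\<alpha>+1)) * (\<integral>\<^sup>+r. (ennreal (min 2 ((s * r)\<^sup>2 / 2) * (s * r) powr (- \<alpha> - 1)) * indicator {0<..} (s * r)) \<partial>lborel)"
    by (intro nn_integral_cmult) measurable
  also have "\<dots> = ennreal (s powr \<alpha>) * (ennreal s * (\<integral>\<^sup>+r. (ennreal (min 2 ((s * r)\<^sup>2 / 2) * (s * r) powr (- \<alpha> - 1)) * indicator {0<..} (s * r)) \<partial>lborel))"
    using s by (simp add: powr_add ennreal_mult' mult.assoc)
  also have "ennreal s * (\<integral>\<^sup>+r. (ennreal (min 2 ((s * r)\<^sup>2 / 2) * (s * r) powr (- \<alpha> - 1)) * indicator {0<..} (s * r)) \<partial>lborel) = tail_bound \<alpha>"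
    unfolding tail_bound_def
    using s by (subst (2) nn_integral_real_affine[where c = s and t = 0]) auto
  finally have b2: "stable_kernel \<alpha> s \<le> ennreal (s powr \<alpha>) * tail_bound \<alpha>" .
  obtain C where C: "tail_bound \<alpha> = ennreal C" "0 \<le> C"
    using tail_bound_finite[OF assms] by (cases "tail_bound \<alpha>") auto
  show ?thesis
    using b1 b2 unfolding eq s_def[symmetric] pmin_def C(1)
    by (auto simp: min_def ennreal_mult'[symmetric] mult.commute C(2))
qed

text \<open>It is enough to integrate from a/2 to a. The choice a = min 1 (1/s) keeps r s in the
  range of the quadratic lower bound for 1 - cos and \<open>exp (- r)\<close> above
  \<open>exp (- 1)\<close>. The divisor 32 is 4 from the squared lower endpoint, 4 from the cosine
  bound and 2 from the length of the interval.\<close>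

lemma stable_kernel_ge:
  assumes "0 < \<alpha>" "\<alpha> < 2"
  shows "ennreal (exp (-1) / 32 * pmin \<alpha> \<bar>t\<bar>) \<le> stable_kernel \<alpha> t"
proof (cases "t = 0")
  case False
  define s where "s = \<bar>t\<bar>"
  have s: "0 < s" using False by (simp add: s_def)
  define a where "a = min 1 (1 / s)"
  have a: "0 < a" "a \<le> 1" "a * s \<le> 1" using s by (auto simp: a_def min_def field_simps)
  have eq: "stable_kernel \<alpha> t = stable_kernel \<alpha> s"
    unfolding s_def by (cases "0 \<le> t") auto
  define c where "c = (a/2)\<^sup>2 * s\<^sup>2 / 4 * (a powr (-\<alpha>-1) * exp (-1))"
  have "ennreal (c * (a / 2)) = (\<integral>\<^sup>+r. ennreal c * indicator {a/2..a} r \<partial>lborel)"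
    using a by (subst nn_integral_cmult_indicator) (auto simp: ennreal_mult'[symmetric] c_def ennreal_mult'')
  also have "\<dots> \<le> stable_kernel \<alpha> s"
    unfolding stable_kernel_def
  proof (intro nn_integral_mono)
    fix r :: real
    have "c \<le> (1 - cos (r * s)) * (r powr (- \<alpha> - 1) * exp (- r))" if r: "a/2 \<le> r" "r \<le> a"
    proof -
      have "r * s \<le> a * s" using s r by (intro mult_right_mono) auto
      moreover have "0 \<le> r * s" using a s r by simp
      ultimately have "\<bar>r * s\<bar> \<le> 1" using a(3) by linarith
      then have "(r * s)\<^sup>2 / 4 \<le> 1 - cos (r * s)" by (rule one_minus_cos_ge_square)
      moreover have "(a/2)\<^sup>2 * s\<^sup>2 \<le> (r * s)\<^sup>2"
        unfolding power_mult_distrib using a r by (intro mult_right_mono power_mono) auto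
      ultimately have 1: "(a/2)\<^sup>2 * s\<^sup>2 / 4 \<le> 1 - cos (r * s)" by linarith
      have "a powr (-\<alpha>-1) \<le> r powr (-\<alpha>-1)"
        using a r assms by (intro powr_mono2') auto
      then show ?thesis unfolding c_def using 1 r a
        by (intro mult_mono) auto
    qed
    then show "ennreal c * indicator {a/2..a} r \<le> ennreal ((1 - cos (r * s)) * (r powr (- \<alpha> - 1) * exp (- r))) * indicator {0<..} r"
      using a by (auto simp: indicator_def intro!: ennreal_leI)
  qed
  finally have "ennreal (c * (a / 2)) \<le> stable_kernel \<alpha> s" .
  moreover have "exp (-1) / 32 * pmin \<alpha> s \<le> c * (a / 2)"
  proof -
    have "a\<^sup>2 * a powr (-\<alpha>-1) * a = a powr 2 * a powr (-\<alpha>-1) * a powr 1" using a by simp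
    also have "\<dots> = a powr (2 - \<alpha>)" by (simp only: powr_add[symmetric]) simp
    finally have "c * (a / 2) = exp (-1) / 32 * (s\<^sup>2 * a powr (2 - \<alpha>))"
      unfolding c_def by (simp add: power_divide field_simps)
    \<comment> \<open>With a = 1 the right-hand side is the square, with a = 1/s it is
      \<open>s powr \<alpha>\<close>; one expression reproduces both branches of the
      minimum.\<close>
    moreover have "pmin \<alpha> s \<le> s\<^sup>2 * a powr (2 - \<alpha>)"
    proof (cases "s \<le> 1")
      case True
      then have "a = 1" using s by (simp add: a_def min_def field_simps)
      then show ?thesis by (simp add: pmin_def)
    next
      case False
      then have "a = 1 / s" using s by (simp add: a_def min_def field_simps)
      then have "s\<^sup>2 * a powr (2 - \<alpha>) = s powr 2 * s powr (- (2 - \<alpha>))"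
        using s by (simp only: powr_divide powr_minus_divide) simp
      also have "\<dots> = s powr \<alpha>" by (simp only: powr_add[symmetric]) simp
      finally show ?thesis by (simp add: pmin_def)
    qed
    ultimately show ?thesis by (simp only:) (intro mult_left_mono, auto)
  qed
  ultimately show ?thesis
    unfolding eq s_def[symmetric] by (meson ennreal_leI order_trans)
qed simp

section \<open>The function \<open>h\<close>\<close>

text \<open>On this matrix type \<open>norm\<close> is the Euclidean norm of all entries, not the
  operator norm; Cauchy-Schwarz in each row shows that it dominates the operator norm.\<close>

lemma norm_matrix_vector_mult_le:
  fixes D :: "real^'n^'m" shows "norm (D *v x) \<le> norm D * norm x"
proof -
  have "norm (D *v x) \<le> L2_set (\<lambda>i. norm (D $ i) * norm x) UNIV"
    unfolding norm_vec_def[of "D *v x"]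
    by (intro L2_set_mono) (auto simp: matrix_vector_mul_component Cauchy_Schwarz_ineq2)
  also have "\<dots> = norm D * norm x"
    by (simp add: norm_vec_def[of D] L2_set_left_distrib)
  finally show ?thesis .
qed

lemma bounded_bilinear_matrix_vector_mult:
  "bounded_bilinear ((*v) :: real^'n^'m \<Rightarrow> real^'n \<Rightarrow> real^'m)"
  by unfold_locales
    (auto simp: matrix_vector_mult_add_rdistrib matrix_vector_right_distrib scaleR_matrix_vector_assoc
      matrix_vector_mult_scaleR intro!: exI[of _ 1] norm_matrix_vector_mult_le)

lemma matrix_vector_mult_measurable [measurable (raw)]:
  fixes f :: "'a \<Rightarrow> real^'n^'m"
  assumes [measurable]: "f \<in> borel_measurable M" "g \<in> borel_measurable M"
  shows "(\<lambda>x. f x *v g x) \<in> borel_measurable M"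
  by (intro borel_measurable_continuous_Pair[OF assms] bounded_bilinear.continuous_on[OF bounded_bilinear_matrix_vector_mult]
      continuous_intros)

locale rosinski_kernel =
  fixes \<alpha> :: real and \<phi> R :: "(real^'n) measure"
  assumes alpha: "0 < \<alpha>" "\<alpha> < 2"
    and levy: "levy_measure \<phi>"
    and rosinski: "rosinski_measure \<alpha> \<phi> R"
begin

lemma sets_R [measurable_cong, simp]: "sets R = sets borel"
  and R_zero: "emeasure R {0} = 0"
  using rosinski by (auto simp: rosinski_measure_def)

lemma space_R [simp]: "space R = UNIV"
  using sets_eq_imp_space_eq[OF sets_R] by simp

lemma sets_phi [measurable_cong, simp]: "sets \<phi> = sets borel"
  using levy by (auto simp: levy_measure_def)

lemma R_pmin_finite: "(\<integral>\<^sup>+x. ennreal (pmin \<alpha> (norm x)) \<partial>R) < \<infinity>"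
  using rosinski by (simp add: rosinski_measure_def pmin_def min.commute)

text \<open>By Markov's inequality the sets where \<open>pmin \<alpha> (norm x)\<close> is at least
  1/(n+1) have finite mass, and the only point they miss is the null set {0}. Sigma-finiteness makes
  parameter integrals over \<open>R\<close>, such as \<open>h\<close>, measurable.\<close>

lemma sigma_finite_R: "sigma_finite_measure R"
proof
  let ?A = "\<lambda>n::nat. {x::real^'n. pmin \<alpha> (norm x) \<ge> 1 / Suc n}"
  have fin: "emeasure R (?A n) < \<infinity>" for n
  proof -
    have "emeasure R (?A n) = (\<integral>\<^sup>+x. indicator (?A n) x \<partial>R)" by simp
    also have "\<dots> \<le> (\<integral>\<^sup>+x. ennreal (Suc n) * ennreal (pmin \<alpha> (norm x)) \<partial>R)"
    proof (intro nn_integral_mono)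
      fix x :: "real^'n"
      have "1 \<le> real (Suc n) * pmin \<alpha> (norm x)" if "x \<in> ?A n"
        using that by (simp add: field_simps)
      then have "ennreal 1 \<le> ennreal (real (Suc n) * pmin \<alpha> (norm x))" if "x \<in> ?A n"
        using that by (intro ennreal_leI) auto
      then show "indicator (?A n) x \<le> ennreal (Suc n) * ennreal (pmin \<alpha> (norm x))"
        by (cases "x \<in> ?A n") (simp_all only: ennreal_mult'[symmetric] pmin_nonneg indicator_simps ennreal_1 zero_le of_nat_0_le_iff simp_thms)
    qed
    also have "\<dots> = ennreal (Suc n) * (\<integral>\<^sup>+x. ennreal (pmin \<alpha> (norm x)) \<partial>R)"
      by (rule nn_integral_cmult) measurable
    also have "\<dots> < \<infinity>" using R_pmin_finite by (simp add: ennreal_mult_less_top)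
    finally show ?thesis .
  qed
  have "\<exists>n. x \<in> ?A n" if "x \<noteq> 0" for x
  proof -
    have "0 < pmin \<alpha> (norm x)" using that by (intro pmin_pos) auto
    from nat_approx_posE[OF this] obtain n where "1 / real (Suc n) < pmin \<alpha> (norm x)" by blast
    then show ?thesis by (auto intro: less_imp_le)
  qed
  then have "\<Union> (insert {0} (range ?A)) = space R" by auto
  then show "\<exists>A. countable A \<and> A \<subseteq> sets R \<and> \<Union> A = space R \<and> (\<forall>a\<in>A. emeasure R a \<noteq> \<infinity>)"
    using fin R_zero by (intro exI[of _ "insert {0} (range ?A)"]) (auto simp: less_top[symmetric])
qed

sublocale R: sigma_finite_measure R by (rule sigma_finite_R)

text \<open>The defining property of the Rosinski measure says that \<phi> is the image, under (x,
  r) \<mapsto> r x, of a measure on pairs with density \<open>w\<close>. Once this is an equality of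
  measures, the formula for indicators extends to nonnegative Borel functions by change of
  variables.\<close>

lemma nn_integral_phi:
  assumes [measurable]: "f \<in> borel_measurable borel"
  shows "(\<integral>\<^sup>+x. f x \<partial>\<phi>) =
    (\<integral>\<^sup>+x. (\<integral>\<^sup>+r\<in>{0<..}. ennreal (r powr (- \<alpha> - 1) * exp (- r)) * f (r *\<^sub>R x) \<partial>lborel) \<partial>R)"
proof -
  define w :: "(real^'n) \<times> real \<Rightarrow> ennreal" where
    "w = (\<lambda>(x, r). ennreal (r powr (- \<alpha> - 1) * exp (- r)) * indicator {0<..} r)"
  have w [measurable]: "w \<in> borel_measurable (R \<Otimes>\<^sub>M lborel)"
    unfolding w_def by measurable
  have [measurable]: "(\<lambda>(x, r). r *\<^sub>R x) \<in> R \<Otimes>\<^sub>M lborel \<rightarrow>\<^sub>M borel" by measurable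
  have nn: "(\<integral>\<^sup>+x. g x \<partial>distr (density (R \<Otimes>\<^sub>M lborel) w) borel (\<lambda>(x, r). r *\<^sub>R x)) =
    (\<integral>\<^sup>+x. (\<integral>\<^sup>+r\<in>{0<..}. ennreal (r powr (- \<alpha> - 1) * exp (- r)) * g (r *\<^sub>R x) \<partial>lborel) \<partial>R)"
    if [measurable]: "g \<in> borel_measurable borel" for g
  proof -
    have "(\<integral>\<^sup>+x. g x \<partial>distr (density (R \<Otimes>\<^sub>M lborel) w) borel (\<lambda>(x, r). r *\<^sub>R x)) =
      (\<integral>\<^sup>+z. w z * g (case z of (x, r) \<Rightarrow> r *\<^sub>R x) \<partial>(R \<Otimes>\<^sub>M lborel))"
      by (subst nn_integral_distr, measurable, subst nn_integral_density) auto
    also have "\<dots> = (\<integral>\<^sup>+x. \<integral>\<^sup>+r. w (x, r) * g (r *\<^sub>R x) \<partial>lborel \<partial>R)"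
      by (subst lborel.nn_integral_fst[symmetric]) auto
    finally show ?thesis by (simp add: w_def mult_ac)
  qed
  have "\<phi> = distr (density (R \<Otimes>\<^sub>M lborel) w) borel (\<lambda>(x, r). r *\<^sub>R x)"
  proof (rule measure_eqI)
    fix A assume "A \<in> sets \<phi>"
    then have [measurable]: "A \<in> sets borel" by simp
    have "emeasure (distr (density (R \<Otimes>\<^sub>M lborel) w) borel (\<lambda>(x, r). r *\<^sub>R x)) A =
       (\<integral>\<^sup>+x. indicator A x \<partial>distr (density (R \<Otimes>\<^sub>M lborel) w) borel (\<lambda>(x, r). r *\<^sub>R x))"
      by (subst nn_integral_indicator) auto
    also have "\<dots> = emeasure \<phi> A"
      using rosinski by (subst nn) (auto simp: rosinski_measure_def mult_ac)
    finally show "emeasure \<phi> A = emeasure (distr (density (R \<Otimes>\<^sub>M lborel) w) borel (\<lambda>(x, r). r *\<^sub>R x)) A" ..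
  qed simp
  with nn[OF assms] show ?thesis by simp
qed

abbreviation h :: "real^'n^'n \<Rightarrow> ennreal" where "h \<equiv> h_fun \<alpha> R"

lemma h_def: "h D = (\<integral>\<^sup>+x. ennreal (pmin \<alpha> (norm (D *v x))) \<partial>R)"
  by (simp add: h_fun_def pmin_def)

lemma h_measurable [measurable]: "h \<in> borel_measurable borel"
  unfolding h_def[abs_def] by measurable

lemma h_0 [simp]: "h 0 = 0"
  by (simp add: h_def)

text \<open>A pointwise comparison of two matrices covers both uses: scalar multiples of one matrix,
  and the comparison of any D with the identity through \<open>norm D\<close>.\<close>

lemma h_le_mult:
  assumes "\<And>x. norm (D *v x) \<le> l * norm (E *v x)" "0 \<le> l"
  shows "h D \<le> ennreal (pmax \<alpha> l) * h E"
proof -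
  have "pmin \<alpha> (norm (D *v x)) \<le> pmax \<alpha> l * pmin \<alpha> (norm (E *v x))" for x
    using pmin_mono[OF alpha(1) norm_ge_zero assms(1)[of x]] pmin_mult_le[OF assms(2) norm_ge_zero, of \<alpha> "E *v x"]
    by simp
  then have "h D \<le> (\<integral>\<^sup>+x. ennreal (pmax \<alpha> l) * ennreal (pmin \<alpha> (norm (E *v x))) \<partial>R)"
    unfolding h_def by (intro nn_integral_mono) (auto simp: ennreal_mult'[symmetric] intro!: ennreal_leI)
  then show ?thesis
    unfolding h_def by (subst (asm) nn_integral_cmult) auto
qed

lemma h_scaleR_le: "h (l *\<^sub>R D) \<le> ennreal (pmax \<alpha> \<bar>l\<bar>) * h D"
  by (rule h_le_mult) (auto simp: scaleR_matrix_vector_assoc[symmetric])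

lemma h_uminus [simp]: "h (- D) = h D"
  using matrix_vector_mult_diff_rdistrib[of 0 D] by (simp add: h_def)

lemma h_add_le: "h (D + E) \<le> 4 * (h D + h E)"
proof -
  have "pmin \<alpha> (norm ((D + E) *v x)) \<le> 4 * (pmin \<alpha> (norm (D *v x)) + pmin \<alpha> (norm (E *v x)))" for x
  proof -
    have "pmin \<alpha> (norm ((D + E) *v x)) \<le> pmin \<alpha> (norm (D *v x) + norm (E *v x))"
      using alpha by (intro pmin_mono) (auto simp: matrix_vector_mult_add_rdistrib norm_triangle_ineq)
    also have "\<dots> \<le> 4 * (pmin \<alpha> (norm (D *v x)) + pmin \<alpha> (norm (E *v x)))"
      using alpha by (intro pmin_add_le) auto
    finally show ?thesis .
  qed
  then have "h (D + E) \<le> (\<integral>\<^sup>+x. 4 * (ennreal (pmin \<alpha> (norm (D *v x))) + ennreal (pmin \<alpha> (norm (E *v x)))) \<partial>R)"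
    unfolding h_def
    by (intro nn_integral_mono) (auto simp: ennreal_mult'[symmetric] simp flip: ennreal_plus ennreal_numeral intro!: ennreal_leI)
  also have "\<dots> = 4 * (h D + h E)"
    unfolding h_def by (subst nn_integral_cmult, measurable, subst nn_integral_add) auto
  finally show ?thesis .
qed

lemma h_le_norm: "h D \<le> ennreal (pmax \<alpha> (norm D)) * h (mat 1)"
  by (rule h_le_mult) (auto intro: norm_matrix_vector_mult_le)

lemma h_finite: "h D < \<infinity>"
proof -
  have "h (mat 1) < \<infinity>" using R_pmin_finite by (simp add: h_def)
  then have "ennreal (pmax \<alpha> (norm D)) * h (mat 1) < \<infinity>"
    by (simp add: ennreal_mult_less_top)
  with h_le_norm[of D] show ?thesis by (rule le_less_trans)
qed

text \<open>Fatou's lemma in \<open>R\<close>. This lower semicontinuity drives both the compactness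
  argument for fullness and Fatou's lemma for \<open>H\<close>.\<close>

lemma h_le_liminf:
  assumes "Ds \<longlonglongrightarrow> D" shows "h D \<le> liminf (\<lambda>n. h (Ds n))"
proof -
  have "(\<lambda>n. Ds n *v x) \<longlonglongrightarrow> D *v x" for x
    by (intro bounded_bilinear.tendsto[OF bounded_bilinear_matrix_vector_mult] assms tendsto_const)
  then have "(\<lambda>n. ennreal (pmin \<alpha> (norm (Ds n *v x)))) \<longlonglongrightarrow> ennreal (pmin \<alpha> (norm (D *v x)))" for x
    by (intro tendsto_ennrealI tendsto_pmin tendsto_norm alpha) auto
  then have "h D = (\<integral>\<^sup>+x. liminf (\<lambda>n. ennreal (pmin \<alpha> (norm (Ds n *v x)))) \<partial>R)"
    unfolding h_def by (intro nn_integral_cong) (metis lim_imp_Liminf trivial_limit_sequentially)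
  also have "\<dots> \<le> liminf (\<lambda>n. h (Ds n))"
    unfolding h_def by (intro nn_integral_liminf) measurable
  finally show ?thesis .
qed

section \<open>Comparison of \<open>h\<close> with the real part of the exponent\<close>

definition \<kappa> :: "real^'n \<Rightarrow> ennreal" where
  "\<kappa> u = (\<integral>\<^sup>+x. ennreal (1 - cos (u \<bullet> x)) \<partial>\<phi>)"

lemma \<kappa>_eq: "\<kappa> u = (\<integral>\<^sup>+x. stable_kernel \<alpha> (u \<bullet> x) \<partial>R)"
  unfolding \<kappa>_def stable_kernel_def
  by (subst nn_integral_phi) (auto simp: ennreal_mult'[symmetric] mult_ac intro!: nn_integral_cong)

definition kappa_const :: real where "kappa_const = enn2real (tail_bound \<alpha>)"

lemma kappa_const_nonneg [simp]: "0 \<le> kappa_const"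
  by (simp add: kappa_const_def)

text \<open>\<open>u v* D\<close> is the adjoint of D applied to u, so its inner product with x is
  at most \<open>norm u\<close> times the norm of D x. The factor \<open>norm u\<close> is absorbed
  into the matrix and taken out again by the scaling of \<open>h\<close>.\<close>

lemma \<kappa>_vec_mat_le: "\<kappa> (u v* D) \<le> ennreal kappa_const * (ennreal (pmax \<alpha> (norm u)) * h D)"
proof -
  have "\<kappa> (u v* D) \<le> (\<integral>\<^sup>+x. ennreal kappa_const * ennreal (pmin \<alpha> (norm ((norm u *\<^sub>R D) *v x))) \<partial>R)"
    unfolding \<kappa>_eq
  proof (intro nn_integral_mono)
    fix x
    have "\<bar>(u v* D) \<bullet> x\<bar> \<le> norm ((norm u *\<^sub>R D) *v x)"
      by (simp add: dot_lmul_matrix Cauchy_Schwarz_ineq2 scaleR_matrix_vector_assoc[symmetric])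
    then have "kappa_const * pmin \<alpha> \<bar>(u v* D) \<bullet> x\<bar> \<le> kappa_const * pmin \<alpha> (norm ((norm u *\<^sub>R D) *v x))"
      using alpha by (intro mult_left_mono pmin_mono) auto
    with stable_kernel_le[OF alpha, of "(u v* D) \<bullet> x"]
    show "stable_kernel \<alpha> ((u v* D) \<bullet> x) \<le> ennreal kappa_const * ennreal (pmin \<alpha> (norm ((norm u *\<^sub>R D) *v x)))"
      by (simp add: kappa_const_def ennreal_mult'[symmetric]) (meson ennreal_leI order_trans)
  qed
  also have "\<dots> = ennreal kappa_const * h (norm u *\<^sub>R D)"
    unfolding h_def by (rule nn_integral_cmult) measurable
  also have "\<dots> \<le> ennreal kappa_const * (ennreal (pmax \<alpha> (norm u)) * h D)"
    using h_scaleR_le[of "norm u" D] by (intro mult_left_mono) auto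
  finally show ?thesis .
qed

lemma \<kappa>_finite: "\<kappa> u < \<infinity>"
proof -
  have "\<kappa> u = \<kappa> (u v* mat 1)" by simp
  also have "\<dots> < \<infinity>"
    using h_finite[of "mat 1"]
    by (intro le_less_trans[OF \<kappa>_vec_mat_le]) (simp add: ennreal_mult_less_top)
  finally show ?thesis .
qed

text \<open>The factor \<open>32 * exp 1\<close> inverts the constant of
  \<open>stable_kernel_ge\<close>; the argument of \<open>pmax\<close> is the dimension, which
  bounds the ratio between the norm of a vector and its largest coordinate.\<close>

definition h_const :: real where
  "h_const = 32 * exp 1 * pmax \<alpha> (real CARD('n))"

lemma h_const_nonneg [simp]: "0 \<le> h_const"
  by (simp add: h_const_def)

text \<open>The unit vectors suffice as test directions because the largest coordinate of D x
  controls its norm. Which coordinate is largest depends on x, hence the sum over all of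
  them.\<close>

lemma h_le_sum_\<kappa>: "h D \<le> ennreal h_const * (\<Sum>i\<in>UNIV. \<kappa> (axis i 1 v* D))"
proof -
  let ?N = "real CARD('n)"
  have "h D \<le> (\<integral>\<^sup>+x. ennreal h_const * (\<Sum>i\<in>UNIV. stable_kernel \<alpha> ((axis i 1 v* D) \<bullet> x)) \<partial>R)"
    unfolding h_def
  proof (intro nn_integral_mono)
    fix x
    define y where "y = D *v x"
    have comp: "(axis i 1 v* D) \<bullet> x = y $ i" for i
      by (simp add: dot_lmul_matrix y_def inner_axis')
    obtain j where j: "\<And>i. \<bar>y $ i\<bar> \<le> \<bar>y $ j\<bar>"
    proof -
      have "Max (range (\<lambda>i. \<bar>y $ i\<bar>)) \<in> range (\<lambda>i. \<bar>y $ i\<bar>)" by (intro Max_in) auto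
      then obtain j where "Max (range (\<lambda>i. \<bar>y $ i\<bar>)) = \<bar>y $ j\<bar>" by (rule imageE)
      with that[of j] show thesis by (metis Max_ge finite finite_imageI rangeI)
    qed
    have "norm y \<le> ?N * \<bar>y $ j\<bar>"
      using norm_le_l1_cart[of y] sum_bounded_above[of UNIV "\<lambda>i. \<bar>y $ i\<bar>" "\<bar>y $ j\<bar>"] j by simp
    then have "pmin \<alpha> (norm y) \<le> pmin \<alpha> (?N * \<bar>y $ j\<bar>)"
      using alpha by (intro pmin_mono) auto
    also have "\<dots> \<le> pmax \<alpha> ?N * pmin \<alpha> \<bar>y $ j\<bar>" by (intro pmin_mult_le) auto
    also have "\<dots> = h_const * (exp (-1) / 32 * pmin \<alpha> \<bar>y $ j\<bar>)"
      by (simp add: h_const_def exp_minus field_simps)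
    finally have "ennreal (pmin \<alpha> (norm y)) \<le> ennreal h_const * ennreal (exp (-1) / 32 * pmin \<alpha> \<bar>y $ j\<bar>)"
      by (subst ennreal_mult'[symmetric]) (auto intro!: ennreal_leI)
    also have "\<dots> \<le> ennreal h_const * stable_kernel \<alpha> (y $ j)"
      by (intro mult_left_mono stable_kernel_ge alpha) auto
    also have "\<dots> \<le> ennreal h_const * (\<Sum>i\<in>UNIV. stable_kernel \<alpha> (y $ i))"
      by (intro mult_left_mono member_le_sum) auto
    finally show "ennreal (pmin \<alpha> (norm (D *v x))) \<le> ennreal h_const * (\<Sum>i\<in>UNIV. stable_kernel \<alpha> ((axis i 1 v* D) \<bullet> x))"
      by (simp add: comp y_def)
  qed
  also have "\<dots> = ennreal h_const * (\<Sum>i\<in>UNIV. \<kappa> (axis i 1 v* D))"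
    unfolding \<kappa>_eq by (subst nn_integral_cmult, measurable, subst nn_integral_sum) auto
  finally show ?thesis .
qed

end

section \<open>Characteristic functions and tail bounds\<close>

text \<open>Averaging 1 - cos (t y) over t in [0, 1] gives 1 - sin y / y, which is at least 1/2 once
  the modulus of y is at least 2. Tonelli's theorem exchanges this average with the
  expectation.\<close>

lemma (in prob_space) prob_abs_ge_2_le:
  fixes Y :: "'a \<Rightarrow> real"
  assumes [measurable]: "Y \<in> borel_measurable M"
    and le: "\<And>t. 0 \<le> t \<Longrightarrow> t \<le> 1 \<Longrightarrow> (\<integral>\<^sup>+\<omega>. ennreal (1 - cos (t * Y \<omega>)) \<partial>M) \<le> B"
  shows "emeasure M {\<omega> \<in> space M. 2 \<le> \<bar>Y \<omega>\<bar>} \<le> 2 * B"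
proof -
  have *: "indicator {y. 2 \<le> \<bar>y\<bar>} y \<le> 2 * (\<integral>\<^sup>+t. ennreal (1 - cos (t * y)) * indicator {0..1} t \<partial>lborel)" for y :: real
  proof (cases "2 \<le> \<bar>y\<bar>")
    case True
    then have y: "y \<noteq> 0" by auto
    have "(\<integral>\<^sup>+t. ennreal (1 - cos (t * y)) * indicator {0..1} t \<partial>lborel) =
      ennreal ((1 - sin (1 * y) / y) - (0 - sin (0 * y) / y))"
      using y by (intro nn_integral_FTC_Icc[where F = "\<lambda>t. t - sin (t * y) / y"])
        (auto intro!: derivative_eq_intros)
    also have "\<dots> \<ge> ennreal (1/2)"
    proof (intro ennreal_leI)
      have "sin y / y \<le> \<bar>sin y\<bar> / \<bar>y\<bar>" by (metis abs_divide abs_ge_self)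
      also have "\<dots> \<le> 1 / 2" using True by (intro frac_le) auto
      finally show "1/2 \<le> (1 - sin (1 * y) / y) - (0 - sin (0 * y) / y)" by simp
    qed
    finally have "2 * ennreal (1/2) \<le> 2 * (\<integral>\<^sup>+t. ennreal (1 - cos (t * y)) * indicator {0..1} t \<partial>lborel)"
      by (intro mult_left_mono) auto
    moreover have "2 * ennreal (1/2) = 1"
      using ennreal_mult'[of "1/2" 2] by (simp add: mult.commute)
    ultimately show ?thesis using True by simp
  qed simp
  interpret pair_sigma_finite M lborel ..
  have "emeasure M {\<omega> \<in> space M. 2 \<le> \<bar>Y \<omega>\<bar>} = (\<integral>\<^sup>+\<omega>. indicator {\<omega> \<in> space M. 2 \<le> \<bar>Y \<omega>\<bar>} \<omega> \<partial>M)"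
    by (rule nn_integral_indicator[symmetric]) measurable
  also have "\<dots> = (\<integral>\<^sup>+\<omega>. indicator {y. 2 \<le> \<bar>y\<bar>} (Y \<omega>) \<partial>M)"
    by (intro nn_integral_cong) (auto simp: indicator_def)
  also have "\<dots> \<le> (\<integral>\<^sup>+\<omega>. 2 * (\<integral>\<^sup>+t. ennreal (1 - cos (t * Y \<omega>)) * indicator {0..1} t \<partial>lborel) \<partial>M)"
    by (intro nn_integral_mono *)
  also have "\<dots> = 2 * (\<integral>\<^sup>+\<omega>. \<integral>\<^sup>+t. ennreal (1 - cos (t * Y \<omega>)) * indicator {0..1} t \<partial>lborel \<partial>M)"
    by (rule nn_integral_cmult) measurable
  also have "\<dots> \<le> 2 * B"
  proof (intro mult_left_mono)
    have "(\<integral>\<^sup>+\<omega>. \<integral>\<^sup>+t. ennreal (1 - cos (t * Y \<omega>)) * indicator {0..1} t \<partial>lborel \<partial>M) =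
      (\<integral>\<^sup>+t. \<integral>\<^sup>+\<omega>. ennreal (1 - cos (t * Y \<omega>)) * indicator {0..1} t \<partial>M \<partial>lborel)"
      by (rule Fubini'[symmetric]) measurable
    also have "\<dots> \<le> (\<integral>\<^sup>+t. B * indicator {0..1::real} t \<partial>lborel)"
      by (intro nn_integral_mono) (auto simp: indicator_def le)
    also have "\<dots> = B" by (simp add: nn_integral_cmult_indicator)
    finally show "(\<integral>\<^sup>+\<omega>. \<integral>\<^sup>+t. ennreal (1 - cos (t * Y \<omega>)) * indicator {0..1} t \<partial>lborel \<partial>M) \<le> B" .
  qed simp
  finally show ?thesis .
qed

lemma (in prob_space) expectation_one_minus_cos_tendsto_0:
  fixes X :: "nat \<Rightarrow> 'a \<Rightarrow> 'b::euclidean_space"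
  assumes [measurable]: "\<And>n. X n \<in> borel_measurable M"
    and lim: "tendsto_in_prob M X (\<lambda>_. 0)"
  shows "(\<lambda>n. \<integral>\<omega>. 1 - cos (u \<bullet> X n \<omega>) \<partial>M) \<longlonglongrightarrow> 0"
proof (rule LIMSEQ_I)
  fix e :: real assume e: "0 < e"
  \<comment> \<open>Where the norm of X is at most d, the square of u \<bullet> X is at most e/2 and
    1 - cos at most e/4; the complement contributes at most twice a probability below e/4. Adding 1
    to \<open>norm u\<close> avoids division by zero.\<close>
  define d where "d = sqrt (e / 2) / (norm u + 1)"
  have d: "0 < d" using e by (auto simp: d_def add_nonneg_pos)
  have "(\<lambda>n. prob {\<omega> \<in> space M. norm (X n \<omega> - 0) > d}) \<longlonglongrightarrow> 0"
    using lim d by (auto simp: tendsto_in_prob_def)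
  then have "eventually (\<lambda>n. prob {\<omega> \<in> space M. norm (X n \<omega> - 0) > d} < e / 4) sequentially"
    using e by (intro order_tendstoD) auto
  then obtain N where N: "\<And>n. n \<ge> N \<Longrightarrow> prob {\<omega> \<in> space M. norm (X n \<omega>) > d} < e / 4"
    by (auto simp: eventually_sequentially)
  have int: "integrable M (\<lambda>\<omega>. 1 - cos (u \<bullet> X n \<omega>))" for n
  proof (rule integrable_const_bound[where B = 2], rule AE_I2)
    show "norm (1 - cos (u \<bullet> X n \<omega>)) \<le> 2" for \<omega>
      using cos_ge_minus_one[of "u \<bullet> X n \<omega>"] cos_le_one[of "u \<bullet> X n \<omega>"]
      unfolding real_norm_def by linarith
  qed simp
  have "\<bar>\<integral>\<omega>. 1 - cos (u \<bullet> X n \<omega>) \<partial>M\<bar> < e" if "n \<ge> N" for n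
  proof -
    let ?S = "{\<omega> \<in> space M. norm (X n \<omega>) > d}"
    have "(\<integral>\<omega>. 1 - cos (u \<bullet> X n \<omega>) \<partial>M) \<le> (\<integral>\<omega>. e / 4 + 2 * indicator ?S \<omega> \<partial>M)"
    proof (intro integral_mono int)
      show "integrable M (\<lambda>\<omega>. e / 4 + 2 * indicator ?S \<omega> :: real)" by (auto simp: less_top[symmetric])
      fix \<omega> assume \<omega>: "\<omega> \<in> space M"
      show "1 - cos (u \<bullet> X n \<omega>) \<le> e / 4 + 2 * indicator ?S \<omega>"
      proof (cases "\<omega> \<in> ?S")
        case True
        have "1 - cos (u \<bullet> X n \<omega>) \<le> 2" using cos_ge_minus_one[of "u \<bullet> X n \<omega>"] by linarith
        moreover have "indicator ?S \<omega> = (1::real)" using True by simp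
        ultimately show ?thesis using e by linarith
      next
        case False
        then have "norm (X n \<omega>) \<le> d" using \<omega> by simp
        then have "\<bar>u \<bullet> X n \<omega>\<bar> \<le> (norm u + 1) * d"
          using Cauchy_Schwarz_ineq2[of u "X n \<omega>"] mult_mono[of "norm u" "norm u + 1" "norm (X n \<omega>)" d] by simp
        also have "\<dots> = sqrt (e / 2)"
          using norm_ge_zero[of u] by (simp add: d_def) (smt (verit) norm_ge_zero)
        finally have "\<bar>u \<bullet> X n \<omega>\<bar>\<^sup>2 \<le> (sqrt (e / 2))\<^sup>2" by (intro power_mono) auto
        then show ?thesis using one_minus_cos_le_square[of "u \<bullet> X n \<omega>"] False e by simp
      qed
    qed
    also have "\<dots> = e / 4 + 2 * prob ?S" 
      by (subst Bochner_Integration.integral_add) (auto simp: less_top[symmetric] prob_space)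
    finally have "(\<integral>\<omega>. 1 - cos (u \<bullet> X n \<omega>) \<partial>M) < e" using N[OF that] e by simp
    moreover have "0 \<le> (\<integral>\<omega>. 1 - cos (u \<bullet> X n \<omega>) \<partial>M)" by (intro integral_nonneg_AE) auto
    ultimately show ?thesis by simp
  qed
  then show "\<exists>no. \<forall>n\<ge>no. norm ((\<integral>\<omega>. 1 - cos (u \<bullet> X n \<omega>) \<partial>M) - 0) < e" by auto
qed

text \<open>For norm x \<le> 1 the second-order Taylor remainder is joined by the difference between
  u \<bullet> x and its truncation, which is of third order; for larger x the exponential and the
  truncated term are bounded separately. The result is a dominating function integrable for every
  Levy measure.\<close>

lemma lcf_integrand_bound:
  fixes u x :: "real^'n"
  shows "norm (iexp (u \<bullet> x) - 1 - \<i> * complex_of_real ((u \<bullet> x) / (1 + (norm x)\<^sup>2)))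
    \<le> (2 + norm u + (norm u)\<^sup>2) * min 1 ((norm x)\<^sup>2)"
proof -
  let ?y = "u \<bullet> x" and ?n = "norm x"
  have y: "\<bar>?y\<bar> \<le> norm u * ?n" by (rule Cauchy_Schwarz_ineq2)
  have pos: "0 < 1 + ?n\<^sup>2" by (simp add: add_pos_nonneg)
  show ?thesis
  proof (cases "?n \<le> 1")
    case True
    have "norm (iexp ?y - 1 - \<i> * complex_of_real ?y) \<le> ?y\<^sup>2 / 2"
      using iexp_approx1[of ?y 1] by (simp add: algebra_simps power2_eq_square)
    also have "\<dots> \<le> (norm u)\<^sup>2 * ?n\<^sup>2"
      using power_mono[OF y, of 2] by (simp add: power_mult_distrib) (smt (verit) zero_le_power2)
    finally have 1: "norm (iexp ?y - 1 - \<i> * complex_of_real ?y) \<le> (norm u)\<^sup>2 * ?n\<^sup>2" .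
    have "?y - ?y / (1 + ?n\<^sup>2) = ?y * ?n\<^sup>2 / (1 + ?n\<^sup>2)"
      using pos by (simp add: field_simps)
    then have "\<i> * complex_of_real ?y - \<i> * complex_of_real (?y / (1 + ?n\<^sup>2)) = \<i> * complex_of_real (?y * ?n\<^sup>2 / (1 + ?n\<^sup>2))"
      by (simp only: right_diff_distrib[symmetric] of_real_diff[symmetric])
    then have "norm (\<i> * complex_of_real ?y - \<i> * complex_of_real (?y / (1 + ?n\<^sup>2))) = \<bar>?y * ?n\<^sup>2 / (1 + ?n\<^sup>2)\<bar>"
      by (simp only: norm_mult norm_ii norm_of_real mult_1)
    also have "\<dots> = \<bar>?y\<bar> * ?n\<^sup>2 / (1 + ?n\<^sup>2)" using pos by (simp add: abs_mult)
    also have "\<dots> \<le> \<bar>?y\<bar> * ?n\<^sup>2 / 1" using pos by (intro divide_left_mono) auto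
    also have "\<dots> \<le> norm u * 1 * ?n\<^sup>2"
      using order_trans[OF y mult_left_mono[OF True norm_ge_zero]] by (simp add: mult_right_mono)
    finally have 2: "norm (\<i> * complex_of_real ?y - \<i> * complex_of_real (?y / (1 + ?n\<^sup>2))) \<le> norm u * ?n\<^sup>2" by simp
    have "iexp ?y - 1 - \<i> * complex_of_real (?y / (1 + ?n\<^sup>2)) =
      (iexp ?y - 1 - \<i> * complex_of_real ?y) + (\<i> * complex_of_real ?y - \<i> * complex_of_real (?y / (1 + ?n\<^sup>2)))"
      by (simp only: add_diff_eq diff_add_cancel)
    then have "norm (iexp ?y - 1 - \<i> * complex_of_real (?y / (1 + ?n\<^sup>2))) \<le> (norm u)\<^sup>2 * ?n\<^sup>2 + norm u * ?n\<^sup>2"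
      using norm_triangle_mono[OF 1 2] by (simp only:)
    also have "\<dots> \<le> (2 + norm u + (norm u)\<^sup>2) * ?n\<^sup>2" by (simp add: algebra_simps)
    finally have "norm (iexp ?y - 1 - \<i> * complex_of_real (?y / (1 + ?n\<^sup>2))) \<le> (2 + norm u + (norm u)\<^sup>2) * ?n\<^sup>2" .
    moreover have "min 1 (?n\<^sup>2) = ?n\<^sup>2" using True power_le_one[of ?n 2] by simp
    ultimately show ?thesis by (simp only:)
  next
    case False
    have "norm (iexp ?y - 1) \<le> 2" using norm_triangle_ineq4[of "iexp ?y" 1] by simp
    moreover have "norm (\<i> * complex_of_real (?y / (1 + ?n\<^sup>2))) \<le> norm u"
    proof -
      have "?n \<le> 1 + ?n\<^sup>2" using False by (smt (verit) norm_ge_zero power2_eq_square mult_left_mono mult_cancel_left1)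
      then have "\<bar>?y\<bar> \<le> norm u * (1 + ?n\<^sup>2)"
        using y mult_left_mono[of ?n "1 + ?n\<^sup>2" "norm u"] by simp
      then have "\<bar>?y\<bar> / (1 + ?n\<^sup>2) \<le> norm u" using pos by (simp add: pos_divide_le_eq)
      then have "\<bar>?y / (1 + ?n\<^sup>2)\<bar> \<le> norm u" using pos by (simp add: abs_divide)
      then show ?thesis by (simp only: norm_mult norm_ii norm_of_real mult_1)
    qed
    ultimately have "norm (iexp ?y - 1 - \<i> * complex_of_real (?y / (1 + ?n\<^sup>2))) \<le> 2 + norm u"
      using norm_triangle_ineq4[of "iexp ?y - 1" "\<i> * complex_of_real (?y / (1 + ?n\<^sup>2))"] by linarith
    moreover have "min 1 (?n\<^sup>2) = 1" using False by (simp add: min_def)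
    moreover have "2 + norm u \<le> 2 + norm u + (norm u)\<^sup>2" by simp
    ultimately show ?thesis by (simp only: mult_1_right)
  qed
qed

section \<open>Exponents of the generating law: symmetry and fullness\<close>

locale tempered_isrm = rosinski_kernel \<alpha> \<phi> R
  for \<alpha> :: real and \<phi> R :: "(real^'n) measure" +
  fixes a :: "real^'n" and \<mu> :: "(real^'n) measure"
    and \<nu> :: "'s measure" and P :: "'w measure" and M :: "'s set \<Rightarrow> 'w \<Rightarrow> real^'n"
  assumes law: "id_law \<mu> a \<phi>"
    and full: "full_law \<mu>"
    and symm: "symmetric_law \<mu>"
    and isrm: "ISRM_generated_by P \<nu> M a \<phi>"
begin

lemma prob_mu: "prob_space \<mu>" and sets_mu [measurable_cong, simp]: "sets \<mu> = sets borel"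
  and char_mu: "(CLINT x|\<mu>. iexp (u \<bullet> x)) = exp (lcf a \<phi> u)"
  using law by (auto simp: id_law_def)

sublocale P: prob_space P
  using isrm by (auto simp: ISRM_generated_by_def ISRM_def)

lemma integrable_min_norm: "integrable \<phi> (\<lambda>x. c * min 1 ((norm x)\<^sup>2))"
proof -
  have "integrable \<phi> (\<lambda>x. min 1 ((norm x)\<^sup>2))"
    using levy by (intro integrableI_bounded) (auto simp: levy_measure_def)
  then show ?thesis by simp
qed

lemma lcf_integrand_integrable:
  "integrable \<phi> (\<lambda>x. iexp (u \<bullet> x) - 1 - \<i> * complex_of_real ((u \<bullet> x) / (1 + (norm x)\<^sup>2)))"
proof (rule Bochner_Integration.integrable_bound[OF integrable_min_norm[of "2 + norm u + (norm u)\<^sup>2"]])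
  show "AE x in \<phi>. norm (iexp (u \<bullet> x) - 1 - \<i> * complex_of_real ((u \<bullet> x) / (1 + (norm x)\<^sup>2)))
      \<le> norm ((2 + norm u + (norm u)\<^sup>2) * min 1 ((norm x)\<^sup>2))"
    by (intro AE_I2 order_trans[OF lcf_integrand_bound]) simp
qed measurable

lemma Re_lcf: "Re (lcf a \<phi> u) = - enn2real (\<kappa> u)"
proof -
  have "Re (lcf a \<phi> u) = (\<integral>x. Re (iexp (u \<bullet> x) - 1 - \<i> * complex_of_real ((u \<bullet> x) / (1 + (norm x)\<^sup>2))) \<partial>\<phi>)"
    unfolding lcf_def using integral_bounded_linear[OF bounded_linear_Re lcf_integrand_integrable[of u]] by simp
  also have "\<dots> = (\<integral>x. - (1 - cos (u \<bullet> x)) \<partial>\<phi>)"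
    by (intro Bochner_Integration.integral_cong) (auto simp: Re_exp)
  also have "\<dots> = - (\<integral>x. 1 - cos (u \<bullet> x) \<partial>\<phi>)" by (rule Bochner_Integration.integral_minus)
  also have "(\<integral>x. 1 - cos (u \<bullet> x) \<partial>\<phi>) = enn2real (\<kappa> u)"
    unfolding \<kappa>_def by (rule integral_eq_nn_integral) auto
  finally show ?thesis .
qed

text \<open>Dominated convergence along a ray: the bound of \<open>lcf_integrand_bound\<close> is
  monotone in the norm of the argument, so the endpoint t = 1 dominates the whole segment.\<close>

lemma continuous_lcf: "continuous_on {0..1} (\<lambda>t. lcf a \<phi> (t *\<^sub>R u))"
proof (rule continuous_on_sequentiallyI)
  fix X :: "nat \<Rightarrow> real" and t assume X: "\<forall>n. X n \<in> {0..1}" "t \<in> {0..1}" "X \<longlonglongrightarrow> t"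
  show "(\<lambda>n. lcf a \<phi> (X n *\<^sub>R u)) \<longlonglongrightarrow> lcf a \<phi> (t *\<^sub>R u)"
    unfolding lcf_def
  proof (intro tendsto_add tendsto_mult tendsto_const tendsto_of_real tendsto_inner tendsto_scaleR X)
    let ?J = "\<lambda>t x. iexp ((t *\<^sub>R u) \<bullet> x) - 1 - \<i> * complex_of_real (((t *\<^sub>R u) \<bullet> x) / (1 + (norm x)\<^sup>2))"
    show "(\<lambda>n. CLINT x|\<phi>. ?J (X n) x) \<longlonglongrightarrow> (CLINT x|\<phi>. ?J t x)"
    proof (rule integral_dominated_convergence[OF _ _ integrable_min_norm[of "2 + norm u + (norm u)\<^sup>2"]])
      have "(\<lambda>n. ?J (X n) x) \<longlonglongrightarrow> ?J t x" for x
        by (intro tendsto_intros X) (simp add: add_nonneg_eq_0_iff)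
      then show "AE x in \<phi>. (\<lambda>n. ?J (X n) x) \<longlonglongrightarrow> ?J t x" by simp
      fix n
      have "norm (?J (X n) x) \<le> (2 + norm u + (norm u)\<^sup>2) * min 1 ((norm x)\<^sup>2)" for x
      proof (rule order_trans[OF lcf_integrand_bound], rule mult_right_mono)
        have "norm (X n *\<^sub>R u) \<le> norm u" using X(1) by (simp add: mult_left_le_one_le)
        then show "2 + norm (X n *\<^sub>R u) + (norm (X n *\<^sub>R u))\<^sup>2 \<le> 2 + norm u + (norm u)\<^sup>2"
          by (intro add_mono power_mono) auto
      qed simp
      then show "AE x in \<phi>. norm (?J (X n) x) \<le> (2 + norm u + (norm u)\<^sup>2) * min 1 ((norm x)\<^sup>2)" by simp
    qed auto
  qed
qed

text \<open>Symmetry makes the expectation of sin (u \<bullet> x) equal to its negative. This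
  expectation is the imaginary part of an exponential of nonzero modulus, so the sine of the
  imaginary part of the exponent must vanish.\<close>

lemma sin_Im_lcf: "sin (Im (lcf a \<phi> u)) = 0"
proof -
  interpret mu: prob_space \<mu> by (rule prob_mu)
  have int: "integrable \<mu> (\<lambda>x. iexp (u \<bullet> x))" by (rule mu.integrable_iexp) auto
  have "Im (exp (lcf a \<phi> u)) = (\<integral>x. sin (u \<bullet> x) \<partial>\<mu>)"
    using integral_bounded_linear[OF bounded_linear_Im int] unfolding char_mu[symmetric] by (simp add: Im_exp)
  moreover have "(\<integral>x. sin (u \<bullet> x) \<partial>\<mu>) = - (\<integral>x. sin (u \<bullet> x) \<partial>\<mu>)"
  proof -
    have "(\<integral>x. sin (u \<bullet> x) \<partial>\<mu>) = (\<integral>x. sin (u \<bullet> x) \<partial>distr \<mu> borel uminus)"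
      using symm by (simp add: symmetric_law_def)
    also have "\<dots> = (\<integral>x. sin (u \<bullet> (- x)) \<partial>\<mu>)"
      by (rule integral_distr) auto
    finally show ?thesis by simp
  qed
  ultimately show ?thesis by (simp add: Im_exp)
qed

text \<open>The imaginary part of the log-characteristic function is continuous along rays and takes values
  in $\pi\mathbb{Z}$, hence vanishes; deducing this from symmetry of \<open>\<phi>\<close> would need uniqueness
  of the triplet.\<close>

lemma Im_lcf: "Im (lcf a \<phi> u) = 0"
proof (rule ccontr)
  assume nz: "Im (lcf a \<phi> u) \<noteq> 0"
  let ?f = "\<lambda>t. Im (lcf a \<phi> (t *\<^sub>R u))"
  have cont: "continuous_on {0..1} ?f" by (intro continuous_intros continuous_lcf)
  have 0: "?f 0 = 0" by (simp add: lcf_def)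
  have "\<bar>?f 1\<bar> \<ge> pi"
  proof (rule ccontr)
    assume "\<not> pi \<le> \<bar>?f 1\<bar>"
    then have "sin \<bar>?f 1\<bar> > 0" using nz by (intro sin_gt_zero) auto
    then show False using sin_Im_lcf[of "1 *\<^sub>R u"] by (auto simp: abs_if split: if_splits)
  qed
  moreover have cont': "continuous_on {0..1} (\<lambda>t. \<bar>?f t\<bar>)" by (intro continuous_intros cont)
  ultimately obtain t where "\<bar>?f t\<bar> = pi / 2"
    using IVT'[of "\<lambda>t. \<bar>?f t\<bar>" 0 "pi/2" 1] 0 pi_ge_zero by (smt (verit) field_sum_of_halves)
  then have "sin \<bar>?f t\<bar> = 1" by (simp only: sin_pi_half)
  then show False using sin_Im_lcf[of "t *\<^sub>R u"] by (auto simp: abs_if split: if_splits)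
qed

lemma lcf_eq: "lcf a \<phi> u = complex_of_real (- enn2real (\<kappa> u))"
  using Re_lcf[of u] Im_lcf[of u] by (simp add: complex_eq_iff)

lemma M_measurable [measurable (raw)]: "A \<in> finite_sets \<nu> \<Longrightarrow> M A \<in> borel_measurable P"
  using isrm by (auto simp: ISRM_generated_by_def ISRM_def)

text \<open>Drift and Levy measure are both multiplied by the measure of A, and the exponent is
  linear in the pair. The scaled measure is rewritten as a constant density so that the integral
  rule for densities gives this linearity.\<close>

lemma char_M:
  assumes A: "A \<in> finite_sets \<nu>"
  shows "(CLINT \<omega>|P. iexp (u \<bullet> M A \<omega>)) = exp (complex_of_real (- (measure \<nu> A * enn2real (\<kappa> u))))"
proof -
  let ?r = "measure \<nu> A"
  have r: "emeasure \<nu> A = ennreal ?r"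
    using A by (intro emeasure_eq_ennreal_measure) (auto simp: finite_sets_def)
  have dens: "scale_measure (emeasure \<nu> A) \<phi> = density \<phi> (\<lambda>_. ennreal ?r)"
    by (rule measure_eqI) (auto simp: r emeasure_density nn_integral_cmult_indicator)
  have "id_law (distr P borel (M A)) (?r *\<^sub>R a) (scale_measure (emeasure \<nu> A) \<phi>)"
    using isrm A by (auto simp: ISRM_generated_by_def)
  then have "(CLINT x|distr P borel (M A). iexp (u \<bullet> x)) = exp (lcf (?r *\<^sub>R a) (density \<phi> (\<lambda>_. ennreal ?r)) u)"
    by (auto simp: id_law_def dens)
  also have "lcf (?r *\<^sub>R a) (density \<phi> (\<lambda>_. ennreal ?r)) u = ?r *\<^sub>R lcf a \<phi> u"
  proof -
    let ?J = "\<lambda>x. iexp (u \<bullet> x) - 1 - \<i> * complex_of_real ((u \<bullet> x) / (1 + (norm x)\<^sup>2))"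
    have "(CLINT x|density \<phi> (\<lambda>_. ennreal ?r). ?J x) = (CLINT x|\<phi>. ?r *\<^sub>R ?J x)"
      by (rule integral_density) auto
    also have "\<dots> = ?r *\<^sub>R (CLINT x|\<phi>. ?J x)"
      by (rule integral_scaleR_right)
    finally have "(CLINT x|density \<phi> (\<lambda>_. ennreal ?r). ?J x) = ?r *\<^sub>R (CLINT x|\<phi>. ?J x)" .
    moreover have "\<i> * complex_of_real ((?r *\<^sub>R a) \<bullet> u) = ?r *\<^sub>R (\<i> * complex_of_real (a \<bullet> u))"
      by (simp only: inner_scaleR_left of_real_mult) (simp add: scaleR_conv_of_real)
    ultimately show ?thesis unfolding lcf_def by (simp only: scaleR_add_right)
  qed
  also have "(CLINT x|distr P borel (M A). iexp (u \<bullet> x)) = (CLINT \<omega>|P. iexp (u \<bullet> M A \<omega>))"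
    using A by (intro integral_distr) auto
  finally show ?thesis by (simp add: lcf_eq scaleR_conv_of_real)
qed

text \<open>If \<kappa> vanishes on the ray of u, the characteristic function of \<mu> is 1 there.
  The truncation inequality, applied to every multiple n (u \<bullet> x), forces u \<bullet> x = 0
  almost surely, so \<mu> would live on a hyperplane.\<close>

lemma \<kappa>_ray_eq_0:
  assumes "\<And>t. \<kappa> (t *\<^sub>R u) = 0" shows "u = 0"
proof (rule ccontr)
  assume "u \<noteq> 0"
  interpret mu: prob_space \<mu> by (rule prob_mu)
  have "emeasure \<mu> {x \<in> space \<mu>. 2 \<le> \<bar>real n * (u \<bullet> x)\<bar>} \<le> 2 * 0" for n
  proof (rule mu.prob_abs_ge_2_le)
    fix t :: real
    let ?v = "(t * real n) *\<^sub>R u"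
    have int: "integrable \<mu> (\<lambda>x. iexp (?v \<bullet> x))" by (rule mu.integrable_iexp) auto
    have int2: "integrable \<mu> (\<lambda>x. cos (?v \<bullet> x))"
      by (rule mu.integrable_const_bound[where B = 1]) auto
    have "(\<integral>x. cos (?v \<bullet> x) \<partial>\<mu>) = 1"
      using integral_bounded_linear[OF bounded_linear_Re int] assms[of "t * real n"]
      unfolding char_mu by (simp add: lcf_eq Re_exp)
    then have "(\<integral>x. 1 - cos (?v \<bullet> x) \<partial>\<mu>) = 0"
      using int2 mu.prob_space by (subst Bochner_Integration.integral_diff) auto
    moreover have "(\<integral>\<^sup>+x. ennreal (1 - cos (?v \<bullet> x)) \<partial>\<mu>) = ennreal (\<integral>x. 1 - cos (?v \<bullet> x) \<partial>\<mu>)"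
      using int2 by (intro nn_integral_eq_integral) auto
    ultimately show "(\<integral>\<^sup>+x. ennreal (1 - cos (t * (real n * (u \<bullet> x)))) \<partial>\<mu>) \<le> 0"
      by (simp add: mult.assoc)
  qed auto
  then have "AE x in \<mu>. \<not> 2 \<le> \<bar>real n * (u \<bullet> x)\<bar>" for n
    by (intro AE_I[where N = "{x \<in> space \<mu>. 2 \<le> \<bar>real n * (u \<bullet> x)\<bar>}"]) auto
  then have "AE x in \<mu>. \<forall>n. \<not> 2 \<le> \<bar>real n * (u \<bullet> x)\<bar>" by (simp add: AE_all_countable)
  then have "AE x in \<mu>. u \<bullet> x = 0"
  proof eventually_elim
    case (elim x)
    show ?case
    proof (rule ccontr)
      assume "u \<bullet> x \<noteq> 0"
      then obtain n where "real n * \<bar>u \<bullet> x\<bar> > 2" using reals_Archimedean3[of "\<bar>u \<bullet> x\<bar>"] by auto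
      with elim show False by (auto simp: abs_mult dest: spec[of _ n])
    qed
  qed
  then show False using full \<open>u \<noteq> 0\<close> by (auto simp: full_law_def)
qed

text \<open>If \<open>h D\<close> vanishes, so does \<kappa> on the whole range of the adjoint of D.
  This range is a subspace, so the ray criterion applies to each of its elements.\<close>

lemma h_eq_0_iff: "h D = 0 \<longleftrightarrow> D = 0"
proof
  assume "h D = 0"
  have "u v* D = 0" for u
  proof (rule \<kappa>_ray_eq_0)
    fix t
    have "t *\<^sub>R (u v* D) = (t *\<^sub>R u) v* D"
      by (simp add: vec_eq_iff vector_matrix_mult_def sum_distrib_left mult_ac)
    then show "\<kappa> (t *\<^sub>R (u v* D)) = 0"
      using \<kappa>_vec_mat_le[of "t *\<^sub>R u" D] \<open>h D = 0\<close> by simp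
  qed
  then have "D *v x = 0" for x
    by (metis dot_lmul_matrix inner_eq_zero_iff inner_zero_left)
  then show "D = 0" by (metis matrix_eq matrix_vector_mult_0)
qed simp

text \<open>Unit matrices with \<open>h\<close> tending to 0 would have a limit point D with
  \<open>h D = 0\<close>, by lower semicontinuity, which is impossible on the sphere. As
  \<open>h\<close> is not homogeneous, the bound is carried to all D by the scaling inequality and
  \<open>pmin_inverse\<close>.\<close>

lemma h_ge_norm:
  obtains c where "0 < c" "\<And>D. ennreal (c * pmin \<alpha> (norm D)) \<le> h D"
proof -
  have "\<exists>c>0. \<forall>D. norm D = 1 \<longrightarrow> ennreal c \<le> h D"
  proof (rule ccontr)
    assume "\<not> (\<exists>c>0. \<forall>D. norm D = 1 \<longrightarrow> ennreal c \<le> h D)"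
    then have "\<forall>n. \<exists>D. norm D = 1 \<and> h D < ennreal (1 / Suc n)"
      by (auto simp: not_le)
    then obtain Ds where Ds: "\<And>n. norm (Ds n) = 1" "\<And>n. h (Ds n) < ennreal (1 / Suc n)" by metis
    have "compact (sphere (0::real^'n^'n) 1)" by simp
    then obtain D r where D: "D \<in> sphere 0 1" "strict_mono r" "(Ds \<circ> r) \<longlonglongrightarrow> D"
      using Ds(1) unfolding compact_def by (metis dist_0_norm mem_sphere)
    have lim0: "(\<lambda>n. ennreal (1 / Suc n)) \<longlonglongrightarrow> 0"
      using tendsto_ennrealI[OF LIMSEQ_inverse_real_of_nat] by (simp add: inverse_eq_divide)
    have "(\<lambda>n. h (Ds n)) \<longlonglongrightarrow> 0"
      using less_imp_le[OF Ds(2)]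
      by (intro tendsto_sandwich[OF always_eventually always_eventually tendsto_const lim0]) auto
    then have "(\<lambda>n. h (Ds (r n))) \<longlonglongrightarrow> 0"
      using LIMSEQ_subseq_LIMSEQ[OF _ D(2)] by (auto simp: o_def)
    then have "liminf (\<lambda>n. h (Ds (r n))) = 0" by (intro lim_imp_Liminf) auto
    then have "h D = 0" using h_le_liminf[OF D(3)] by (simp add: o_def)
    then show False using D(1) by (simp add: h_eq_0_iff)
  qed
  then obtain c where c: "0 < c" "\<And>D. norm D = 1 \<Longrightarrow> ennreal c \<le> h D" by blast
  have "ennreal (c * pmin \<alpha> (norm D)) \<le> h D" for D
  proof (cases "D = 0")
    case False
    let ?l = "norm D"
    have l: "0 < ?l" using False by simp
    have "ennreal c \<le> h ((1 / ?l) *\<^sub>R D)" using l by (intro c) simp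
    also have "\<dots> \<le> ennreal (pmax \<alpha> (1 / ?l)) * h D"
      using h_scaleR_le[of "1 / ?l" D] by simp
    finally have "ennreal (pmin \<alpha> ?l) * ennreal c \<le> ennreal (pmin \<alpha> ?l) * (ennreal (pmax \<alpha> (1 / ?l)) * h D)"
      by (intro mult_left_mono) auto
    also have "\<dots> = h D"
      using pmin_inverse[OF l, of \<alpha>] by (simp add: ennreal_mult'[symmetric] mult.assoc[symmetric] mult.commute[of "pmin \<alpha> ?l"])
    finally show ?thesis using c(1) by (simp add: ennreal_mult'[symmetric] mult.commute)
  qed simp
  with c(1) that show thesis by blast
qed

end

section \<open>Integrals of simple functions\<close>

lemma finite_sets_empty [simp]: "{} \<in> finite_sets \<nu>"
  by (simp add: finite_sets_def)

lemma finite_sets_Un: "A \<in> finite_sets \<nu> \<Longrightarrow> B \<in> finite_sets \<nu> \<Longrightarrow> A \<union> B \<in> finite_sets \<nu>"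
  by (auto simp: finite_sets_def intro!: le_less_trans[OF emeasure_subadditive])

lemma finite_sets_UN:
  assumes "finite I" "\<And>i. i \<in> I \<Longrightarrow> A i \<in> finite_sets \<nu>" shows "(\<Union>i\<in>I. A i) \<in> finite_sets \<nu>"
  using assms by (induction I) (auto intro: finite_sets_Un)

lemma simple_bochner_integrable_level_set:
  assumes "Bochner_Integration.simple_bochner_integrable \<nu> F" "D \<noteq> 0"
  shows "{s \<in> space \<nu>. F s = D} \<in> finite_sets \<nu>"
proof -
  have F: "simple_function \<nu> F" "emeasure \<nu> {s \<in> space \<nu>. F s \<noteq> 0} \<noteq> \<infinity>"
    using assms(1) by (auto elim: Bochner_Integration.simple_bochner_integrable.cases)
  have m: "F -` X \<inter> space \<nu> \<in> sets \<nu>" for X by (rule simple_functionD(2)[OF F(1)])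
  have "{s \<in> space \<nu>. F s = D} = F -` {D} \<inter> space \<nu>" "{s \<in> space \<nu>. F s \<noteq> 0} = F -` (-{0}) \<inter> space \<nu>"
    by auto
  then have sets: "{s \<in> space \<nu>. F s = D} \<in> sets \<nu>" "{s \<in> space \<nu>. F s \<noteq> 0} \<in> sets \<nu>"
    using m by auto
  have "emeasure \<nu> {s \<in> space \<nu>. F s = D} \<le> emeasure \<nu> {s \<in> space \<nu>. F s \<noteq> 0}"
    using assms(2) by (intro emeasure_mono sets) auto
  with F(2) sets show ?thesis by (auto simp: finite_sets_def less_top[symmetric] top_unique)
qed

section \<open>Additivity of the random measure and of simple integrals\<close>

context tempered_isrm
begin

abbreviation H :: "('s \<Rightarrow> real^'n^'n) \<Rightarrow> real \<Rightarrow> ennreal" where "H \<equiv> H_fun \<alpha> R \<nu>"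
abbreviation sbi :: "('s \<Rightarrow> real^'n^'n) \<Rightarrow> bool" where "sbi \<equiv> Bochner_Integration.simple_bochner_integrable \<nu>"
abbreviation SI :: "('s \<Rightarrow> real^'n^'n) \<Rightarrow> 'w \<Rightarrow> real^'n" where "SI \<equiv> simple_ISRM_integral \<nu> M"

lemma M_sums:
  assumes "range A \<subseteq> finite_sets \<nu>" "disjoint_family A" "(\<Union>n::nat. A n) \<in> finite_sets \<nu>"
  shows "AE \<omega> in P. (\<lambda>n. M (A n) \<omega>) sums M (\<Union>n. A n) \<omega>"
  using isrm assms unfolding ISRM_generated_by_def ISRM_def by blast

lemma M_indep:
  assumes "\<And>i. i < k \<Longrightarrow> A i \<in> finite_sets \<nu>" "disjoint_family_on A {..<k::nat}"
  shows "P.indep_vars (\<lambda>_. borel) (\<lambda>i. M (A i)) {..<k}"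
proof -
  have "\<forall>(A :: nat \<Rightarrow> 's set) k. (\<forall>i<k. A i \<in> finite_sets \<nu>) \<and> disjoint_family_on A {..<k} \<longrightarrow>
      P.indep_vars (\<lambda>_. borel) (\<lambda>i. M (A i)) {..<k}"
    using isrm by (simp add: ISRM_generated_by_def ISRM_def)
  with assms show ?thesis by simp
qed

text \<open>Countable additivity along a sequence of empty sets makes a constant series converge,
  which forces its terms to be 0.\<close>

lemma M_empty: "AE \<omega> in P. M {} \<omega> = 0"
proof -
  have "AE \<omega> in P. (\<lambda>n::nat. M {} \<omega>) sums M {} \<omega>"
    using M_sums[of "\<lambda>_. {}"] by (simp add: disjoint_family_on_def)
  then show ?thesis by eventually_elim (auto dest!: sums_summable simp: summable_const_iff)
qed

text \<open>Finite additivity comes from countable additivity by padding with empty sets; the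
  padding terms vanish only almost surely.\<close>

lemma M_Un:
  assumes "A \<in> finite_sets \<nu>" "B \<in> finite_sets \<nu>" "A \<inter> B = {}"
  shows "AE \<omega> in P. M (A \<union> B) \<omega> = M A \<omega> + M B \<omega>"
proof -
  define C where "C = (\<lambda>n::nat. if n = 0 then A else if n = 1 then B else {})"
  have UN: "(\<Union>n. C n) = A \<union> B" by (auto simp: C_def split: if_splits intro: exI[of _ 0] exI[of _ 1])
  have "AE \<omega> in P. (\<lambda>n. M (C n) \<omega>) sums M (\<Union>n. C n) \<omega>"
    using assms by (intro M_sums) (auto simp: UN finite_sets_Un C_def disjoint_family_on_def)
  with M_empty show ?thesis
  proof eventually_elim
    case (elim \<omega>)
    have "(\<lambda>n. M (C n) \<omega>) sums (\<Sum>n\<in>{0,1}. M (C n) \<omega>)"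
      using elim(1) by (intro sums_finite) (auto simp: C_def)
    from sums_unique2[OF elim(2) this] have "M (\<Union>n. C n) \<omega> = M A \<omega> + M B \<omega>" by (simp add: C_def)
    then show ?case by (simp only: UN)
  qed
qed

lemma M_UN:
  assumes "finite I" "\<And>i. i \<in> I \<Longrightarrow> A i \<in> finite_sets \<nu>" "disjoint_family_on A I"
  shows "AE \<omega> in P. M (\<Union>i\<in>I. A i) \<omega> = (\<Sum>i\<in>I. M (A i) \<omega>)"
  using assms
proof (induction I)
  case empty
  then show ?case using M_empty by simp
next
  case (insert i I)
  have "AE \<omega> in P. M (A i \<union> (\<Union>i\<in>I. A i)) \<omega> = M (A i) \<omega> + M (\<Union>i\<in>I. A i) \<omega>"
    using insert by (intro M_Un finite_sets_UN) (auto simp: disjoint_family_on_def)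
  moreover have "AE \<omega> in P. M (\<Union>i\<in>I. A i) \<omega> = (\<Sum>i\<in>I. M (A i) \<omega>)"
    using insert by (intro insert.IH) (auto simp: disjoint_family_on_def)
  ultimately show ?case
  proof eventually_elim
    case (elim \<omega>)
    then show ?case using insert.hyps by simp
  qed
qed

lemma SI_eq:
  assumes "sbi F" shows "SI F \<omega> = (\<Sum>D\<in>F ` space \<nu> - {0}. D *v M {s \<in> space \<nu>. F s = D} \<omega>)"
proof -
  have "finite (F ` space \<nu>)"
    using assms by (auto elim!: Bochner_Integration.simple_bochner_integrable.cases dest: simple_functionD)
  then show ?thesis
    unfolding simple_ISRM_integral_def by (intro sum.mono_neutral_right) auto
qed

lemma SI_measurable [measurable (raw)]:
  assumes "sbi F" shows "SI F \<in> borel_measurable P"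
proof -
  have "(\<lambda>\<omega>. \<Sum>D\<in>F ` space \<nu> - {0}. D *v M {s \<in> space \<nu>. F s = D} \<omega>) \<in> borel_measurable P"
    using simple_bochner_integrable_level_set[OF assms]
    by (intro borel_measurable_sum matrix_vector_mult_measurable M_measurable) auto
  then show ?thesis using SI_eq[OF assms] by presburger
qed

text \<open>The level set of a nonzero value D splits into level sets of p of finite measure, over
  which \<open>M\<close> is additive. Where T c = 0 nothing is known about \<open>M\<close>, but the
  coefficient is zero. With p a pair of functions this is a common refinement for
  differences.\<close>

lemma SI_refine:
  assumes p: "simple_function \<nu> p" and T: "sbi (\<lambda>s. T (p s))"
  shows "AE \<omega> in P. SI (\<lambda>s. T (p s)) \<omega> = (\<Sum>c\<in>p ` space \<nu>. T c *v M {s \<in> space \<nu>. p s = c} \<omega>)"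
proof -
  let ?C = "p ` space \<nu>"
  have fin: "finite ?C" using p by (rule simple_functionD)
  have "AE \<omega> in P. M {s \<in> space \<nu>. T (p s) = D} \<omega> = (\<Sum>c\<in>{c \<in> ?C. T c = D}. M {s \<in> space \<nu>. p s = c} \<omega>)"
    if D: "D \<noteq> 0" for D
  proof -
    have eq: "{s \<in> space \<nu>. T (p s) = D} = (\<Union>c\<in>{c \<in> ?C. T c = D}. {s \<in> space \<nu>. p s = c})" by auto
    have "{s \<in> space \<nu>. p s = c} \<in> finite_sets \<nu>" if "T c = D" for c
    proof -
      have m: "{s \<in> space \<nu>. p s = c} \<in> sets \<nu>"
        using simple_functionD(2)[OF p, of "{c}"] by (simp add: vimage_def Int_def conj_commute)
      have "emeasure \<nu> {s \<in> space \<nu>. p s = c} \<le> emeasure \<nu> {s \<in> space \<nu>. T (p s) = D}"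
        using simple_bochner_integrable_level_set[OF T D] that by (intro emeasure_mono) (auto simp: finite_sets_def)
      then show ?thesis
        using simple_bochner_integrable_level_set[OF T D] m by (auto simp: finite_sets_def intro: le_less_trans)
    qed
    then show ?thesis unfolding eq using fin by (intro M_UN) (auto simp: disjoint_family_on_def)
  qed
  then have "AE \<omega> in P. \<forall>D\<in>T ` ?C - {0}. M {s \<in> space \<nu>. T (p s) = D} \<omega> = (\<Sum>c\<in>{c \<in> ?C. T c = D}. M {s \<in> space \<nu>. p s = c} \<omega>)"
    using fin by (intro AE_finite_allI) auto
  then show ?thesis
  proof eventually_elim
    case (elim \<omega>)
    have "SI (\<lambda>s. T (p s)) \<omega> = (\<Sum>D\<in>T ` ?C. D *v M {s \<in> space \<nu>. T (p s) = D} \<omega>)"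
      by (simp add: simple_ISRM_integral_def image_image)
    also have "\<dots> = (\<Sum>D\<in>T ` ?C. \<Sum>c\<in>{c \<in> ?C. T c = D}. T c *v M {s \<in> space \<nu>. p s = c} \<omega>)"
    proof (rule sum.cong[OF refl])
      fix D assume D: "D \<in> T ` ?C"
      show "D *v M {s \<in> space \<nu>. T (p s) = D} \<omega> = (\<Sum>c\<in>{c \<in> ?C. T c = D}. T c *v M {s \<in> space \<nu>. p s = c} \<omega>)"
      proof (cases "D = 0")
        case False
        with D elim have "M {s \<in> space \<nu>. T (p s) = D} \<omega> = (\<Sum>c\<in>{c \<in> ?C. T c = D}. M {s \<in> space \<nu>. p s = c} \<omega>)" by auto
        then show ?thesis
          by (simp add: linear_sum[OF matrix_vector_mul_linear])
      qed simp
    qed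
    also have "\<dots> = (\<Sum>c\<in>?C. T c *v M {s \<in> space \<nu>. p s = c} \<omega>)"
      by (rule sum.image_gen[OF fin, symmetric])
    finally show ?case .
  qed
qed

lemma sbi_simple: "sbi F \<Longrightarrow> simple_function \<nu> F"
  by (auto elim: Bochner_Integration.simple_bochner_integrable.cases)

lemma sbi_measurable [measurable_dest]: "sbi F \<Longrightarrow> F \<in> borel_measurable \<nu>"
  by (intro borel_measurable_simple_function sbi_simple)

lemma sbi_diff: "sbi F \<Longrightarrow> sbi G \<Longrightarrow> sbi (\<lambda>s. F s - G s)"
  by (rule Bochner_Integration.simple_bochner_integrable_compose2) auto

lemma SI_diff:
  assumes F: "sbi F" and G: "sbi G"
  shows "AE \<omega> in P. SI (\<lambda>s. F s - G s) \<omega> = SI F \<omega> - SI G \<omega>"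
proof -
  let ?p = "\<lambda>s. (F s, G s)"
  have p: "simple_function \<nu> ?p" using F G by (intro simple_function_Pair sbi_simple)
  have "AE \<omega> in P. SI F \<omega> = (\<Sum>c\<in>?p ` space \<nu>. fst c *v M {s \<in> space \<nu>. ?p s = c} \<omega>)"
    using SI_refine[OF p, of fst] F by simp
  moreover have "AE \<omega> in P. SI G \<omega> = (\<Sum>c\<in>?p ` space \<nu>. snd c *v M {s \<in> space \<nu>. ?p s = c} \<omega>)"
    using SI_refine[OF p, of snd] G by simp
  moreover have "AE \<omega> in P. SI (\<lambda>s. F s - G s) \<omega> = (\<Sum>c\<in>?p ` space \<nu>. (fst c - snd c) *v M {s \<in> space \<nu>. ?p s = c} \<omega>)"
    using SI_refine[OF p, of "\<lambda>c. fst c - snd c"] sbi_diff[OF F G] by simp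
  ultimately show ?thesis
    by eventually_elim (simp add: matrix_vector_mult_diff_rdistrib sum_subtractf)
qed

section \<open>Characteristic function of a simple integral\<close>

definition K :: "('s \<Rightarrow> real^'n^'n) \<Rightarrow> real^'n \<Rightarrow> ennreal" where
  "K F u = (\<integral>\<^sup>+s. \<kappa> (u v* F s) \<partial>\<nu>)"

lemma K_eq:
  assumes F: "sbi F"
  shows "K F u = ennreal (\<Sum>D\<in>F ` space \<nu> - {0}. measure \<nu> {s \<in> space \<nu>. F s = D} * enn2real (\<kappa> (u v* D)))"
proof -
  let ?J = "F ` space \<nu> - {0}"
  have fin: "finite ?J" using simple_functionD(1)[OF sbi_simple[OF F]] by simp
  have lev: "{s \<in> space \<nu>. F s = D} \<in> sets \<nu>" "emeasure \<nu> {s \<in> space \<nu>. F s = D} = ennreal (measure \<nu> {s \<in> space \<nu>. F s = D})"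
    if "D \<in> ?J" for D
    using simple_bochner_integrable_level_set[OF F, of D] that
    by (auto simp: finite_sets_def intro!: emeasure_eq_ennreal_measure)
  have "K F u = (\<integral>\<^sup>+s. (\<Sum>D\<in>?J. \<kappa> (u v* D) * indicator {s \<in> space \<nu>. F s = D} s) \<partial>\<nu>)"
    unfolding K_def
  proof (rule nn_integral_cong)
    fix s assume s: "s \<in> space \<nu>"
    show "\<kappa> (u v* F s) = (\<Sum>D\<in>?J. \<kappa> (u v* D) * indicator {s \<in> space \<nu>. F s = D} s)"
    proof (cases "F s = 0")
      case True
      then show ?thesis by (auto simp: \<kappa>_def indicator_def intro!: sum.neutral)
    next
      case False
      have "(\<Sum>D\<in>?J. \<kappa> (u v* D) * indicator {s \<in> space \<nu>. F s = D} s) = (\<Sum>D\<in>?J. if D = F s then \<kappa> (u v* D) else 0)"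
        using s by (intro sum.cong) (auto simp: indicator_def)
      then show ?thesis using False s fin by simp
    qed
  qed
  also have "\<dots> = (\<Sum>D\<in>?J. \<kappa> (u v* D) * emeasure \<nu> {s \<in> space \<nu>. F s = D})"
    using lev(1) by (subst nn_integral_sum) (auto intro!: sum.cong nn_integral_cmult_indicator simp del: Diff_iff)
  also have "\<dots> = (\<Sum>D\<in>?J. ennreal (measure \<nu> {s \<in> space \<nu>. F s = D} * enn2real (\<kappa> (u v* D))))"
    using lev \<kappa>_finite by (intro sum.cong) (auto simp: ennreal_mult mult.commute)
  finally show ?thesis by (simp add: sum_nonneg)
qed

text \<open>Independence is available for finite sequences of disjoint sets, so the nonzero values
  are enumerated by e. The scalar variables \<open>X i\<close> are then independent, and their
  characteristic functions multiply.\<close>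

lemma char_SI:
  assumes F: "sbi F"
  shows "(CLINT \<omega>|P. iexp (u \<bullet> SI F \<omega>)) = complex_of_real (exp (- enn2real (K F u)))"
proof -
  let ?J = "F ` space \<nu> - {0}" and ?A = "\<lambda>D. {s \<in> space \<nu>. F s = D}"
  have fin: "finite ?J" using simple_functionD(1)[OF sbi_simple[OF F]] by simp
  from ex_bij_betw_nat_finite[OF this] obtain e where "bij_betw e {0..<card ?J} ?J" ..
  then obtain k where e: "bij_betw e {..<k} ?J" by (auto simp: atLeast0LessThan)
  have eJ: "e i \<noteq> 0" if "i < k" for i using e that by (auto simp: bij_betw_def)
  have lev: "?A (e i) \<in> finite_sets \<nu>" if "i < k" for i
    using simple_bochner_integrable_level_set[OF F eJ[OF that]] .
  define X where "X = (\<lambda>i \<omega>. (u v* e i) \<bullet> M (?A (e i)) \<omega>)"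
  have "disjoint_family_on (\<lambda>i. ?A (e i)) {..<k}"
    using e by (auto simp: disjoint_family_on_def bij_betw_def inj_on_def)
  then have ind: "P.indep_vars (\<lambda>_. borel) (\<lambda>i. M (?A (e i))) {..<k}"
    using lev by (intro M_indep)
  have indX: "P.indep_vars (\<lambda>_. borel) X {..<k}"
    unfolding X_def by (rule P.indep_vars_compose2[OF ind]) auto
  have Xm: "X i \<in> borel_measurable P" if "i < k" for i
    unfolding X_def using M_measurable[OF lev[OF that]] by measurable
  have uSI: "u \<bullet> SI F \<omega> = (\<Sum>i<k. X i \<omega>)" for \<omega>
    unfolding SI_eq[OF F] X_def sum.reindex_bij_betw[OF e, symmetric]
    by (simp add: inner_sum_right dot_lmul_matrix)
  have "(CLINT \<omega>|P. iexp (u \<bullet> SI F \<omega>)) = char (distr P borel (\<lambda>\<omega>. \<Sum>i<k. X i \<omega>)) 1"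
    unfolding char_def uSI using Xm by (subst integral_distr) auto
  also have "\<dots> = (\<Prod>i<k. char (distr P borel (X i)) 1)"
    by (rule P.char_distr_sum[OF indX])
  also have "\<dots> = (\<Prod>i<k. exp (complex_of_real (- (measure \<nu> (?A (e i)) * enn2real (\<kappa> (u v* e i))))))"
  proof (rule prod.cong[OF refl])
    fix i assume "i \<in> {..<k}"
    then have i: "i < k" by simp
    have "char (distr P borel (X i)) 1 = (CLINT \<omega>|P. iexp ((u v* e i) \<bullet> M (?A (e i)) \<omega>))"
      unfolding char_def using Xm[OF i] by (subst integral_distr) (auto simp: X_def)
    then show "char (distr P borel (X i)) 1 = exp (complex_of_real (- (measure \<nu> (?A (e i)) * enn2real (\<kappa> (u v* e i)))))"
      using char_M[OF lev[OF i]] by simp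
  qed
  also have "\<dots> = exp (\<Sum>i<k. complex_of_real (- (measure \<nu> (?A (e i)) * enn2real (\<kappa> (u v* e i)))))"
    by (simp only: exp_sum finite_lessThan)
  also have "(\<Sum>i<k. complex_of_real (- (measure \<nu> (?A (e i)) * enn2real (\<kappa> (u v* e i))))) =
      complex_of_real (- (\<Sum>i<k. measure \<nu> (?A (e i)) * enn2real (\<kappa> (u v* e i))))"
    by (simp only: of_real_sum sum_negf[symmetric])
  also have "(\<Sum>i<k. measure \<nu> (?A (e i)) * enn2real (\<kappa> (u v* e i))) = enn2real (K F u)"
    unfolding K_eq[OF F] sum.reindex_bij_betw[OF e, of "\<lambda>D. measure \<nu> (?A D) * enn2real (\<kappa> (u v* D))"]
    by (simp add: sum_nonneg)
  finally show ?thesis by (simp only: exp_of_real)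
qed

lemma integral_cos_SI:
  assumes F: "sbi F"
  shows "(\<integral>\<omega>. 1 - cos (u \<bullet> SI F \<omega>) \<partial>P) = 1 - exp (- enn2real (K F u))"
    and "(\<integral>\<^sup>+\<omega>. ennreal (1 - cos (u \<bullet> SI F \<omega>)) \<partial>P) = ennreal (1 - exp (- enn2real (K F u)))"
proof -
  note [measurable] = SI_measurable[OF F]
  have int: "integrable P (\<lambda>\<omega>. iexp (u \<bullet> SI F \<omega>))" by (rule P.integrable_iexp) auto
  have int2: "integrable P (\<lambda>\<omega>. cos (u \<bullet> SI F \<omega>))"
    by (rule P.integrable_const_bound[where B = 1]) auto
  have "(\<integral>\<omega>. cos (u \<bullet> SI F \<omega>) \<partial>P) = exp (- enn2real (K F u))"
    using integral_bounded_linear[OF bounded_linear_Re int] unfolding char_SI[OF F] by (simp add: Re_exp)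
  then show 1: "(\<integral>\<omega>. 1 - cos (u \<bullet> SI F \<omega>) \<partial>P) = 1 - exp (- enn2real (K F u))"
    using int2 P.prob_space by (subst Bochner_Integration.integral_diff) auto
  show "(\<integral>\<^sup>+\<omega>. ennreal (1 - cos (u \<bullet> SI F \<omega>)) \<partial>P) = ennreal (1 - exp (- enn2real (K F u)))"
    unfolding 1[symmetric] using int2 by (intro nn_integral_eq_integral) auto
qed

lemma nn_integral_cos_SI_le:
  assumes F: "sbi F"
  shows "(\<integral>\<^sup>+\<omega>. ennreal (1 - cos (u \<bullet> SI F \<omega>)) \<partial>P) \<le> K F u"
proof -
  have "1 - exp (- enn2real (K F u)) \<le> enn2real (K F u)"
    using exp_ge_add_one_self[of "- enn2real (K F u)"] by linarith
  moreover have "K F u < \<infinity>" by (simp add: K_eq[OF F])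
  ultimately show ?thesis
    unfolding integral_cos_SI(2)[OF F] by (metis ennreal_enn2real ennreal_leI infinity_ennreal_def)
qed

text \<open>The factor \<delta> is moved from the matrix to the vector, which keeps \<open>H\<close>
  at the scale \<delta>. For a vector of length proportional to 1/\<delta> the prefactor is then
  independent of \<delta>.\<close>

lemma K_le_H:
  assumes [measurable]: "F \<in> borel_measurable \<nu>" and "0 < \<delta>"
  shows "K F u \<le> ennreal (kappa_const * pmax \<alpha> (\<delta> * norm u)) * H F \<delta>"
proof -
  have "K F u \<le> (\<integral>\<^sup>+s. ennreal (kappa_const * pmax \<alpha> (\<delta> * norm u)) * h ((1 / \<delta>) *\<^sub>R F s) \<partial>\<nu>)"
    unfolding K_def
  proof (rule nn_integral_mono)
    fix s
    have "u v* F s = (\<delta> *\<^sub>R u) v* ((1 / \<delta>) *\<^sub>R F s)"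
      using assms(2) by (simp add: vec_eq_iff vector_matrix_mult_def)
    then have "\<kappa> (u v* F s) \<le> ennreal kappa_const * (ennreal (pmax \<alpha> (norm (\<delta> *\<^sub>R u))) * h ((1 / \<delta>) *\<^sub>R F s))"
      by (simp only: \<kappa>_vec_mat_le)
    then show "\<kappa> (u v* F s) \<le> ennreal (kappa_const * pmax \<alpha> (\<delta> * norm u)) * h ((1 / \<delta>) *\<^sub>R F s)"
      using assms(2) by (simp add: ennreal_mult' mult.assoc)
  qed
  also have "\<dots> = ennreal (kappa_const * pmax \<alpha> (\<delta> * norm u)) * H F \<delta>"
    unfolding H_fun_def by (rule nn_integral_cmult) measurable
  finally show ?thesis .
qed

lemma H_le_sum_K:
  assumes "sbi F"
  shows "H F 1 \<le> ennreal h_const * (\<Sum>i\<in>UNIV. K F (axis i 1))"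
proof -
  have m: "(\<lambda>s. \<kappa> (u v* F s)) \<in> borel_measurable \<nu>" for u
    by (intro borel_measurable_simple_function simple_function_compose1[where g = "\<lambda>D. \<kappa> (u v* D)"] sbi_simple assms)
  have "H F 1 \<le> (\<integral>\<^sup>+s. ennreal h_const * (\<Sum>i\<in>UNIV. \<kappa> (axis i 1 v* F s)) \<partial>\<nu>)"
    unfolding H_fun_def by (intro nn_integral_mono) (simp add: h_le_sum_\<kappa>)
  also have "\<dots> = ennreal h_const * (\<Sum>i\<in>UNIV. K F (axis i 1))"
    unfolding K_def using m by (subst nn_integral_cmult) (auto simp: nn_integral_sum)
  finally show ?thesis .
qed

text \<open>The factors are the 2 of the truncation inequality, the number of coordinates in the
  union bound, and the prefactor of \<open>K_le_H\<close> for a vector of norm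
  \<open>2 * CARD('n) / \<delta>\<close>.\<close>

definition tail_const :: real where
  "tail_const = 2 * real CARD('n) * kappa_const * pmax \<alpha> (2 * real CARD('n))"

lemma tail_const_nonneg [simp]: "0 \<le> tail_const"
  by (simp add: tail_const_def)

text \<open>If the norm is at least \<delta>, some coordinate has modulus at least \<delta> divided
  by the dimension. Multiplied by \<open>2 * ?N / \<delta>\<close>, it reaches the level 2 of the
  truncation inequality.\<close>

lemma SI_tail:
  assumes F: "sbi F" and \<delta>: "0 < \<delta>"
  shows "emeasure P {\<omega> \<in> space P. \<delta> \<le> norm (SI F \<omega>)} \<le> ennreal tail_const * H F \<delta>"
proof -
  note [measurable] = SI_measurable[OF F]
  let ?N = "real CARD('n)"
  let ?B = "ennreal (kappa_const * pmax \<alpha> (2 * ?N)) * H F \<delta>"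
  have N: "0 < ?N" by simp
  let ?S = "\<lambda>i. {\<omega> \<in> space P. 2 \<le> \<bar>((2 * ?N / \<delta>) *\<^sub>R axis i 1) \<bullet> SI F \<omega>\<bar>}"
  have "emeasure P (?S i) \<le> 2 * ?B" for i
  proof (rule P.prob_abs_ge_2_le)
    fix t :: real assume t: "0 \<le> t" "t \<le> 1"
    let ?u = "(t * (2 * ?N / \<delta>)) *\<^sub>R axis i 1 :: real^'n"
    have "(\<integral>\<^sup>+\<omega>. ennreal (1 - cos (?u \<bullet> SI F \<omega>)) \<partial>P) \<le> K F ?u"
      by (rule nn_integral_cos_SI_le[OF F])
    also have "\<dots> \<le> ennreal (kappa_const * pmax \<alpha> (\<delta> * norm ?u)) * H F \<delta>"
      using F by (intro K_le_H \<delta> sbi_measurable)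
    also have "\<dots> \<le> ?B"
      using t \<delta> alpha by (intro mult_right_mono ennreal_leI mult_left_mono pmax_mono) (auto simp: mult_left_le_one_le)
    finally show "(\<integral>\<^sup>+\<omega>. ennreal (1 - cos (t * (((2 * ?N / \<delta>) *\<^sub>R axis i 1) \<bullet> SI F \<omega>))) \<partial>P) \<le> ?B"
      by (simp add: mult.assoc)
  qed simp
  have sub: "{\<omega> \<in> space P. \<delta> \<le> norm (SI F \<omega>)} \<subseteq> (\<Union>i\<in>UNIV. ?S i)"
  proof (rule ccontr)
    assume "\<not> ?thesis"
    then obtain \<omega> where \<omega>: "\<omega> \<in> space P" "\<delta> \<le> norm (SI F \<omega>)" "\<omega> \<notin> (\<Union>i\<in>UNIV. ?S i)"
      by blast
    have \<omega>3: "\<bar>((2 * ?N / \<delta>) *\<^sub>R axis i 1) \<bullet> SI F \<omega>\<bar> < 2" for i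
    proof -
      have "\<omega> \<notin> ?S i" using \<omega>(3) by blast
      then show ?thesis by (simp only: mem_Collect_eq \<omega>(1) simp_thms not_le)
    qed
    have "\<bar>SI F \<omega> $ i\<bar> < \<delta> / ?N" for i
      using \<omega>3[of i] \<delta> N by (simp add: inner_axis' abs_mult field_simps)
    then have "(\<Sum>i\<in>UNIV. \<bar>SI F \<omega> $ i\<bar>) < (\<Sum>i\<in>(UNIV::'n set). \<delta> / ?N)"
      by (intro sum_strict_mono) auto
    then show False using norm_le_l1_cart[of "SI F \<omega>"] \<omega>(2) by simp
  qed
  have "emeasure P {\<omega> \<in> space P. \<delta> \<le> norm (SI F \<omega>)} \<le> emeasure P (\<Union>i\<in>UNIV. ?S i)"
    using sub by (intro emeasure_mono) auto
  also have "\<dots> \<le> (\<Sum>i\<in>UNIV. emeasure P (?S i))"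
    by (intro emeasure_subadditive_finite) auto
  also have "\<dots> \<le> (\<Sum>i\<in>(UNIV::'n set). 2 * ?B)"
    by (intro sum_mono \<open>\<And>i. emeasure P (?S i) \<le> 2 * ?B\<close>)
  also have "\<dots> = ennreal ?N * (ennreal 2 * ?B)"
    by (simp add: ennreal_of_nat_eq_real_of_nat)
  also have "\<dots> = ennreal (?N * (2 * (kappa_const * pmax \<alpha> (2 * ?N)))) * H F \<delta>"
    by (simp only: ennreal_mult' of_nat_0_le_iff zero_le_numeral mult.assoc)
  also have "?N * (2 * (kappa_const * pmax \<alpha> (2 * ?N))) = tail_const"
    by (simp add: tail_const_def)
  finally show ?thesis .
qed

text \<open>Convergence in probability makes the characteristic functions tend to 1, and the
  logarithm turns this into convergence of each exponent to 0. Finitely many directions control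
  \<open>H\<close>, so convergence for each fixed u is enough.\<close>

lemma SI_tendsto_0_imp_H:
  assumes G: "\<And>n. sbi (G n)" and lim: "tendsto_in_prob P (\<lambda>n. SI (G n)) (\<lambda>_. 0)"
  shows "(\<lambda>n. H (G n) 1) \<longlonglongrightarrow> 0"
proof -
  note [measurable] = SI_measurable[OF G]
  have K0: "(\<lambda>n. K (G n) u) \<longlonglongrightarrow> 0" for u
  proof -
    have "(\<lambda>n. 1 - exp (- enn2real (K (G n) u))) \<longlonglongrightarrow> 0"
      using P.expectation_one_minus_cos_tendsto_0[OF _ lim, of u] by (simp add: integral_cos_SI(1)[OF G])
    then have "(\<lambda>n. exp (- enn2real (K (G n) u))) \<longlonglongrightarrow> 1"
      using tendsto_diff[OF tendsto_const[of "1::real"]] by fastforce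
    then have "(\<lambda>n. - ln (exp (- enn2real (K (G n) u)))) \<longlonglongrightarrow> - ln 1"
      by (intro tendsto_intros) auto
    then have "(\<lambda>n. ennreal (enn2real (K (G n) u))) \<longlonglongrightarrow> ennreal 0"
      by (intro tendsto_ennrealI) simp
    then show ?thesis by (simp add: K_eq[OF G])
  qed
  have lim0: "(\<lambda>n. ennreal h_const * (\<Sum>i\<in>UNIV. K (G n) (axis i 1))) \<longlonglongrightarrow> ennreal h_const * (\<Sum>i\<in>(UNIV::'n set). 0)"
    by (intro ennreal_tendsto_cmult tendsto_sum K0) auto
  show ?thesis
    by (rule tendsto_sandwich[OF _ _ tendsto_const[of 0] lim0[simplified]]) (simp_all add: H_le_sum_K[OF G])
qed

end

section \<open>Modular and quasi-norm\<close>

text \<open>Along a sparse subsequence, by Borel-Cantelli, only finitely many increments exceed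
  (1/2)^k at almost every point, so the increments are summable. This serves both \<nu>, which may
  be infinite, and the probability P.\<close>

lemma cauchy_in_measure_subseq:
  fixes F :: "nat \<Rightarrow> 'a \<Rightarrow> 'b::{banach, second_countable_topology}"
  assumes [measurable]: "\<And>n. F n \<in> borel_measurable M"
    and cauchy: "\<And>e. 0 < e \<Longrightarrow> \<exists>N. \<forall>m\<ge>N. \<forall>n\<ge>N. emeasure M {x \<in> space M. e < norm (F m x - F n x)} \<le> ennreal e"
  obtains r f where "strict_mono r" "f \<in> borel_measurable M" "AE x in M. (\<lambda>k. F (r k) x) \<longlonglongrightarrow> f x"
proof -
  have "\<forall>k::nat. \<exists>N. \<forall>m\<ge>N. \<forall>n\<ge>N. emeasure M {x \<in> space M. (1/2)^k < norm (F m x - F n x)} \<le> ennreal ((1/2)^k)"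
    by (intro allI cauchy) simp
  from choice[OF this] obtain N where N: "\<And>k m n. m \<ge> N k \<Longrightarrow> n \<ge> N k \<Longrightarrow>
      emeasure M {x \<in> space M. (1/2)^k < norm (F m x - F n x)} \<le> ennreal ((1/2)^k)" by blast
  \<comment> \<open>Adding k to the sum of all thresholds up to k makes the index strictly
    increasing, and both \<open>r k\<close> and \<open>r (Suc k)\<close> lie beyond
    \<open>N k\<close>.\<close>
  define r where "r = (\<lambda>k. k + (\<Sum>j\<le>k. N j))"
  have r: "strict_mono r" by (rule strict_mono_Suc_iff[THEN iffD2]) (simp add: r_def)
  have rN: "N k \<le> r k" for k
    unfolding r_def by (intro trans_le_add2 member_le_sum) auto
  have rN': "N k \<le> r (Suc k)" for k
    using rN[of k] strict_monoD[OF r, of k "Suc k"] by simp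
  let ?A = "\<lambda>k. {x \<in> space M. (1/2)^k < norm (F (r (Suc k)) x - F (r k) x)}"
  have A: "emeasure M (?A k) \<le> ennreal ((1/2)^k)" for k by (intro N rN rN')
  have A_fin: "emeasure M (?A k) < \<infinity>" for k using A[of k] by (rule le_less_trans) simp
  have "measure M (?A k) \<le> (1/2)^k" for k
    using A[of k] A_fin[of k] by (simp add: emeasure_eq_ennreal_measure)
  then have "summable (\<lambda>k. measure M (?A k))"
    by (intro summable_comparison_test'[OF summable_geometric[of "1/2::real"]]) auto
  then have "AE x in M. eventually (\<lambda>k. x \<in> space M - ?A k) sequentially"
    using A_fin by (intro borel_cantelli_AE1) auto
  then have conv: "AE x in M. convergent (\<lambda>k. F (r k) x)"
  proof eventually_elim
    case (elim x)
    have "eventually (\<lambda>k. norm (F (r (Suc k)) x - F (r k) x) \<le> (1/2)^k) sequentially"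
      using elim by eventually_elim auto
    then have "summable (\<lambda>k. F (r (Suc k)) x - F (r k) x)"
      by (rule summable_comparison_test_ev) (rule summable_geometric, simp)
    then have "convergent (\<lambda>n. \<Sum>k<n. F (r (Suc k)) x - F (r k) x)"
      by (simp add: summable_iff_convergent)
    then have "convergent (\<lambda>n. (F (r n) x - F (r 0) x) + F (r 0) x)"
      unfolding sum_lessThan_telescope[of "\<lambda>k. F (r k) x"] by (intro convergent_add convergent_const)
    then show ?case by simp
  qed
  show thesis
  proof (rule that[OF r])
    show "(\<lambda>x. lim (\<lambda>k. F (r k) x)) \<in> borel_measurable M" by (rule borel_measurable_lim_metric) auto
    show "AE x in M. (\<lambda>k. F (r k) x) \<longlonglongrightarrow> lim (\<lambda>k. F (r k) x)"
      using conv by eventually_elim (simp add: convergent_LIMSEQ_iff)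
  qed
qed

lemma liminf_le_const:
  fixes X :: "nat \<Rightarrow> ennreal"
  assumes "eventually (\<lambda>n. X n \<le> c) sequentially" shows "liminf X \<le> c"
proof -
  have "liminf X \<le> liminf (\<lambda>_. c)" using assms by (rule Liminf_mono)
  then show ?thesis by (simp add: Liminf_const)
qed

text \<open>Fatou's lemma for indicators. The strict inequality matters: it is an open condition, so
  where it holds for the limit it holds eventually along the subsequence.\<close>

lemma cauchy_in_measure_limit:
  fixes F :: "nat \<Rightarrow> 'a \<Rightarrow> 'b::{banach, second_countable_topology}"
  assumes [measurable]: "\<And>n. F n \<in> borel_measurable M" "f \<in> borel_measurable M"
    and r: "strict_mono r" and lim: "AE x in M. (\<lambda>k. F (r k) x) \<longlonglongrightarrow> f x"
    and N: "\<And>m n. m \<ge> N \<Longrightarrow> n \<ge> N \<Longrightarrow> emeasure M {x \<in> space M. e < norm (F m x - F n x)} \<le> c"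
    and n: "n \<ge> N"
  shows "emeasure M {x \<in> space M. e < norm (F n x - f x)} \<le> c"
proof -
  let ?A = "\<lambda>k. {x \<in> space M. e < norm (F n x - F (r k) x)}"
  have "emeasure M {x \<in> space M. e < norm (F n x - f x)} = (\<integral>\<^sup>+x. indicator {x \<in> space M. e < norm (F n x - f x)} x \<partial>M)"
    by (rule nn_integral_indicator[symmetric]) measurable
  also have "\<dots> \<le> (\<integral>\<^sup>+x. liminf (\<lambda>k. indicator (?A k) x) \<partial>M)"
  proof (rule nn_integral_mono_AE)
    show "AE x in M. indicator {x \<in> space M. e < norm (F n x - f x)} x \<le> (liminf (\<lambda>k. indicator (?A k) x) :: ennreal)"
      using lim
    proof eventually_elim
      case (elim x)
      show ?case
      proof (cases "x \<in> space M \<and> e < norm (F n x - f x)")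
        case True
        have "(\<lambda>k. norm (F n x - F (r k) x)) \<longlonglongrightarrow> norm (F n x - f x)"
          by (intro tendsto_intros elim)
        then have "eventually (\<lambda>k. e < norm (F n x - F (r k) x)) sequentially"
          using True by (intro order_tendstoD) auto
        then have "eventually (\<lambda>k. (1::ennreal) \<le> indicator (?A k) x) sequentially"
          by eventually_elim (use True in auto)
        then have "(1::ennreal) \<le> liminf (\<lambda>k. indicator (?A k) x)" by (rule Liminf_bounded)
        then show ?thesis using True by simp
      next
        case False
        then have "x \<notin> {x \<in> space M. e < norm (F n x - f x)}" by blast
        then have "indicator {x \<in> space M. e < norm (F n x - f x)} x = (0::ennreal)"
          by (rule indicator_simps(2))
        then show ?thesis by (simp only: zero_le)
      qed
    qed
  qed
  also have "\<dots> \<le> liminf (\<lambda>k. \<integral>\<^sup>+x. indicator (?A k) x \<partial>M)" by (rule nn_integral_liminf) measurable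
  also have "\<dots> = liminf (\<lambda>k. emeasure M (?A k))" by simp
  also have "\<dots> \<le> c"
  proof (intro liminf_le_const eventually_sequentiallyI)
    fix k assume "N \<le> k"
    then have "N \<le> r k" using strict_mono_imp_increasing[OF r, of k] by simp
    with n show "emeasure M (?A k) \<le> c" by (intro N)
  qed
  finally show ?thesis .
qed

section \<open>Calculus of the modular \<open>H\<close>\<close>

context tempered_isrm
begin

lemma H_scale:
  assumes [measurable]: "f \<in> borel_measurable \<nu>" and "0 < \<delta>" "0 < \<delta>'"
  shows "H f \<delta> \<le> ennreal (pmax \<alpha> (\<delta>' / \<delta>)) * H f \<delta>'"
proof -
  have "h ((1 / \<delta>) *\<^sub>R f s) \<le> ennreal (pmax \<alpha> (\<delta>' / \<delta>)) * h ((1 / \<delta>') *\<^sub>R f s)" for s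
    using h_scaleR_le[of "\<delta>' / \<delta>" "(1 / \<delta>') *\<^sub>R f s"] assms(2,3) by simp
  then have "H f \<delta> \<le> (\<integral>\<^sup>+s. ennreal (pmax \<alpha> (\<delta>' / \<delta>)) * h ((1 / \<delta>') *\<^sub>R f s) \<partial>\<nu>)"
    unfolding H_fun_def by (intro nn_integral_mono)
  also have "\<dots> = ennreal (pmax \<alpha> (\<delta>' / \<delta>)) * H f \<delta>'"
    unfolding H_fun_def by (rule nn_integral_cmult) measurable
  finally show ?thesis .
qed

lemma H_finite:
  assumes "f \<in> borel_measurable \<nu>" "0 < \<delta>" "0 < \<delta>'" "H f \<delta>' < \<infinity>" shows "H f \<delta> < \<infinity>"
  using assms by (intro le_less_trans[OF H_scale[OF assms(1-3)]]) (simp add: ennreal_mult_less_top)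

lemma H_add:
  assumes [measurable]: "f \<in> borel_measurable \<nu>" "g \<in> borel_measurable \<nu>"
  shows "H (\<lambda>s. f s + g s) \<delta> \<le> 4 * (H f \<delta> + H g \<delta>)"
proof -
  have "H (\<lambda>s. f s + g s) \<delta> \<le> (\<integral>\<^sup>+s. 4 * (h ((1 / \<delta>) *\<^sub>R f s) + h ((1 / \<delta>) *\<^sub>R g s)) \<partial>\<nu>)"
    unfolding H_fun_def by (intro nn_integral_mono) (simp only: scaleR_add_right h_add_le)
  also have "\<dots> = 4 * (H f \<delta> + H g \<delta>)"
    unfolding H_fun_def by (subst nn_integral_cmult, measurable, subst nn_integral_add) auto
  finally show ?thesis .
qed

lemma H_uminus: "H (\<lambda>s. - f s) \<delta> = H f \<delta>"
  by (simp add: H_fun_def)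

lemma H_minus_commute: "H (\<lambda>s. f s - g s) \<delta> = H (\<lambda>s. g s - f s) \<delta>"
  using H_uminus[of "\<lambda>s. f s - g s" \<delta>] by simp

lemma H_diff:
  assumes "f \<in> borel_measurable \<nu>" "g \<in> borel_measurable \<nu>"
  shows "H (\<lambda>s. f s - g s) \<delta> \<le> 4 * (H f \<delta> + H g \<delta>)"
  using H_add[OF assms(1), of "\<lambda>s. - g s" \<delta>] assms(2) by (simp add: H_uminus)

lemma H_triangle:
  assumes "f \<in> borel_measurable \<nu>" "g \<in> borel_measurable \<nu>" "k \<in> borel_measurable \<nu>"
  shows "H (\<lambda>s. f s - k s) \<delta> \<le> 4 * (H (\<lambda>s. f s - g s) \<delta> + H (\<lambda>s. g s - k s) \<delta>)"
  using H_add[of "\<lambda>s. f s - g s" "\<lambda>s. g s - k s" \<delta>] assms by simp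

lemma H_cong_AE: "(AE s in \<nu>. f s = g s) \<Longrightarrow> H f \<delta> = H g \<delta>"
  unfolding H_fun_def by (intro nn_integral_cong_AE) auto

lemma H_fatou:
  assumes [measurable]: "\<And>n. F n \<in> borel_measurable \<nu>"
    and lim: "AE s in \<nu>. (\<lambda>n. F n s) \<longlonglongrightarrow> f s"
  shows "H f \<delta> \<le> liminf (\<lambda>n. H (F n) \<delta>)"
proof -
  have "H f \<delta> \<le> (\<integral>\<^sup>+s. liminf (\<lambda>n. h ((1 / \<delta>) *\<^sub>R F n s)) \<partial>\<nu>)"
    unfolding H_fun_def using lim
    by (intro nn_integral_mono_AE) (auto elim!: eventually_mono intro!: h_le_liminf tendsto_intros)
  also have "\<dots> \<le> liminf (\<lambda>n. H (F n) \<delta>)"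
    unfolding H_fun_def by (rule nn_integral_liminf) measurable
  finally show ?thesis .
qed

text \<open>Chebyshev's inequality, based on \<open>h_ge_norm\<close>. The constant depends on e
  only, so it can be applied to all differences of a sequence at once.\<close>

lemma H_markov:
  assumes "0 < e"
  obtains C where "0 < C" "\<And>f. f \<in> borel_measurable \<nu> \<Longrightarrow>
    emeasure \<nu> {s \<in> space \<nu>. e \<le> norm (f s)} \<le> ennreal C * H f 1"
proof -
  obtain c where c: "0 < c" "\<And>D. ennreal (c * pmin \<alpha> (norm D)) \<le> h D" using h_ge_norm by blast
  have pe: "0 < pmin \<alpha> e" using assms by (rule pmin_pos)
  let ?C = "1 / (c * pmin \<alpha> e)"
  have "emeasure \<nu> {s \<in> space \<nu>. e \<le> norm (f s)} \<le> ennreal ?C * H f 1"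
    if [measurable]: "f \<in> borel_measurable \<nu>" for f
  proof -
    have "emeasure \<nu> {s \<in> space \<nu>. e \<le> norm (f s)} = (\<integral>\<^sup>+s. indicator {s \<in> space \<nu>. e \<le> norm (f s)} s \<partial>\<nu>)"
      by (rule nn_integral_indicator[symmetric]) measurable
    also have "\<dots> \<le> (\<integral>\<^sup>+s. ennreal ?C * h (f s) \<partial>\<nu>)"
    proof (rule nn_integral_mono)
      fix s
      show "indicator {s \<in> space \<nu>. e \<le> norm (f s)} s \<le> ennreal ?C * h (f s)"
      proof (cases "e \<le> norm (f s)")
        case True
        have "1 = ennreal ?C * ennreal (c * pmin \<alpha> e)"
          using c pe by (simp add: ennreal_mult'[symmetric])
        also have "\<dots> \<le> ennreal ?C * ennreal (c * pmin \<alpha> (norm (f s)))"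
          using c(1) True assms alpha by (intro mult_left_mono ennreal_leI pmin_mono) auto
        also have "\<dots> \<le> ennreal ?C * h (f s)" by (intro mult_left_mono c) auto
        finally show ?thesis by (simp add: indicator_def)
      qed (simp add: indicator_def)
    qed
    also have "\<dots> = ennreal ?C * H f 1"
      unfolding H_fun_def by (subst nn_integral_cmult) auto
    finally show ?thesis .
  qed
  with c pe show thesis by (intro that[of ?C]) auto
qed

lemma H_eq_0_iff:
  assumes [measurable]: "f \<in> borel_measurable \<nu>" and "0 < \<delta>"
  shows "H f \<delta> = 0 \<longleftrightarrow> (AE s in \<nu>. f s = 0)"
  unfolding H_fun_def using assms(2)
  by (subst nn_integral_0_iff_AE) (auto simp: h_eq_0_iff)

text \<open>The scale 1 is enough: by \<open>H_scale\<close> any other scale changes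
  \<open>H\<close> by at most a fixed factor.\<close>

definition H_cauchy :: "(nat \<Rightarrow> 's \<Rightarrow> real^'n^'n) \<Rightarrow> bool" where
  "H_cauchy F \<longleftrightarrow> (\<forall>e>0. \<exists>N. \<forall>m\<ge>N. \<forall>n\<ge>N. H (\<lambda>s. F m s - F n s) 1 \<le> ennreal e)"

text \<open>The almost everywhere limit of a subsequence already attracts the whole sequence:
  Fatou's lemma is applied with n fixed, and the Cauchy property bounds the terms uniformly.\<close>

lemma H_cauchy_limit:
  assumes [measurable]: "\<And>n. F n \<in> borel_measurable \<nu>" "f \<in> borel_measurable \<nu>"
    and F: "H_cauchy F" and r: "strict_mono r" and lim: "AE s in \<nu>. (\<lambda>k. F (r k) s) \<longlonglongrightarrow> f s"
  shows "(\<lambda>n. H (\<lambda>s. F n s - f s) 1) \<longlonglongrightarrow> 0"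
proof (rule tendsto_zero_ennreal)
  fix e :: real assume e: "0 < e"
  then obtain N where N: "\<And>m n. m \<ge> N \<Longrightarrow> n \<ge> N \<Longrightarrow> H (\<lambda>s. F m s - F n s) 1 \<le> ennreal (e / 2)"
    using F unfolding H_cauchy_def by (meson half_gt_zero)
  have "H (\<lambda>s. F n s - f s) 1 < ennreal e" if "n \<ge> N" for n
  proof -
    have "H (\<lambda>s. F n s - f s) 1 \<le> liminf (\<lambda>k. H (\<lambda>s. F n s - F (r k) s) 1)"
      using lim by (intro H_fatou) (auto elim!: eventually_mono intro!: tendsto_intros)
    also have "\<dots> \<le> ennreal (e / 2)"
    proof (intro liminf_le_const eventually_sequentiallyI)
      fix k assume "N \<le> k"
      then have "N \<le> r k" using strict_mono_imp_increasing[OF r, of k] by simp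
      with that show "H (\<lambda>s. F n s - F (r k) s) 1 \<le> ennreal (e / 2)" by (intro N)
    qed
    also have "\<dots> < ennreal e" using e by (simp add: ennreal_less_iff)
    finally show ?thesis .
  qed
  then show "eventually (\<lambda>n. H (\<lambda>s. F n s - f s) 1 < ennreal e) sequentially"
    by (auto simp: eventually_sequentially)
qed

lemma H_cauchy_subseq:
  assumes [measurable]: "\<And>n. F n \<in> borel_measurable \<nu>" and F: "H_cauchy F"
  obtains r f where "strict_mono r" "f \<in> borel_measurable \<nu>" "AE s in \<nu>. (\<lambda>k. F (r k) s) \<longlonglongrightarrow> f s"
proof (rule cauchy_in_measure_subseq[of F \<nu>])
  fix e :: real assume e: "0 < e"
  obtain C where C: "0 < C" "\<And>f. f \<in> borel_measurable \<nu> \<Longrightarrow>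
    emeasure \<nu> {s \<in> space \<nu>. e \<le> norm (f s)} \<le> ennreal C * H f 1" using H_markov[OF e] by blast
  obtain N where N: "\<And>m n. m \<ge> N \<Longrightarrow> n \<ge> N \<Longrightarrow> H (\<lambda>s. F m s - F n s) 1 \<le> ennreal (e / C)"
    using F e C(1) unfolding H_cauchy_def by (meson divide_pos_pos)
  have "emeasure \<nu> {s \<in> space \<nu>. e < norm (F m s - F n s)} \<le> ennreal e" if "m \<ge> N" "n \<ge> N" for m n
  proof -
    have "emeasure \<nu> {s \<in> space \<nu>. e < norm (F m s - F n s)} \<le> emeasure \<nu> {s \<in> space \<nu>. e \<le> norm (F m s - F n s)}"
      by (intro emeasure_mono) auto
    also have "\<dots> \<le> ennreal C * H (\<lambda>s. F m s - F n s) 1" by (intro C) auto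
    also have "\<dots> \<le> ennreal C * ennreal (e / C)" by (intro mult_left_mono N that) auto
    also have "\<dots> = ennreal e" using C(1) e by (simp add: ennreal_mult'[symmetric])
    finally show ?thesis .
  qed
  then show "\<exists>N. \<forall>m\<ge>N. \<forall>n\<ge>N. emeasure \<nu> {s \<in> space \<nu>. e < norm (F m s - F n s)} \<le> ennreal e" by blast
qed (use that in auto)

lemma H_convergent_imp_cauchy:
  assumes [measurable]: "\<And>n. F n \<in> borel_measurable \<nu>" "f \<in> borel_measurable \<nu>"
    and lim: "(\<lambda>n. H (\<lambda>s. F n s - f s) 1) \<longlonglongrightarrow> 0"
  shows "H_cauchy F"
  unfolding H_cauchy_def
proof (intro allI impI)
  fix e :: real assume e: "0 < e"
  then have "eventually (\<lambda>n. H (\<lambda>s. F n s - f s) 1 < ennreal (e / 8)) sequentially"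
    using lim by (intro order_tendstoD) auto
  then obtain N where N: "\<And>n. n \<ge> N \<Longrightarrow> H (\<lambda>s. F n s - f s) 1 < ennreal (e / 8)"
    by (auto simp: eventually_sequentially)
  have "H (\<lambda>s. F m s - F n s) 1 \<le> ennreal e" if "m \<ge> N" "n \<ge> N" for m n
  proof -
    have "H (\<lambda>s. F m s - F n s) 1 \<le> 4 * (H (\<lambda>s. F m s - f s) 1 + H (\<lambda>s. f s - F n s) 1)"
      by (rule H_triangle) auto
    also have "\<dots> \<le> 4 * (ennreal (e / 8) + ennreal (e / 8))"
      unfolding H_minus_commute[of f] using N that by (intro mult_left_mono add_mono) (auto simp: less_imp_le)
    also have "\<dots> = ennreal e"
      using e by (simp add: ennreal_plus[symmetric] ennreal_mult'[symmetric] del: ennreal_plus flip: ennreal_numeral)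
    finally show ?thesis .
  qed
  then show "\<exists>N. \<forall>m\<ge>N. \<forall>n\<ge>N. H (\<lambda>s. F m s - F n s) 1 \<le> ennreal e" by blast
qed

section \<open>The quasi-norm\<close>

abbreviation N :: "('s \<Rightarrow> real^'n^'n) \<Rightarrow> real" where "N \<equiv> M_norm \<alpha> R \<nu>"

text \<open>The working form of the space of integrands, identified with it in
  \<open>ISRM_integrable_eq_V\<close>; fixing \<delta> = 1 loses nothing, because finiteness of
  \<open>H\<close> does not depend on \<delta>.\<close>

definition V :: "('s \<Rightarrow> real^'n^'n) set" where "V = {f \<in> borel_measurable \<nu>. H f 1 < \<infinity>}"

lemma V_measurable [measurable_dest]: "f \<in> V \<Longrightarrow> f \<in> borel_measurable \<nu>"
  by (simp add: V_def)

lemma V_H_finite: "f \<in> V \<Longrightarrow> 0 < \<delta> \<Longrightarrow> H f \<delta> < \<infinity>"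
  using H_finite[of f \<delta> 1] by (simp add: V_def)

lemma V_diff: "f \<in> V \<Longrightarrow> g \<in> V \<Longrightarrow> (\<lambda>s. f s - g s) \<in> V"
  unfolding V_def by (auto intro!: le_less_trans[OF H_diff] simp: ennreal_mult_less_top)

lemma V_add: "f \<in> V \<Longrightarrow> g \<in> V \<Longrightarrow> (\<lambda>s. f s + g s) \<in> V"
  unfolding V_def by (auto intro!: le_less_trans[OF H_add] simp: ennreal_mult_less_top)

text \<open>The infimum in \<open>M_norm\<close> is meaningful only over a nonempty set. For large
  \<delta> the scaling factor \<open>pmax \<alpha> (1 / \<delta>)\<close> is as small as desired;
  the bound 1 / (C + 1) also covers C = 0.\<close>

lemma N_set_nonempty:
  assumes f: "f \<in> V" shows "{\<delta>. \<delta> > 0 \<and> H f \<delta> \<le> 1} \<noteq> {}"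
proof -
  obtain C where C: "H f 1 = ennreal C" "0 \<le> C"
    using f by (cases "H f 1") (auto simp: V_def)
  obtain d where d: "0 < d" "pmax \<alpha> d < 1 / (C + 1)"
    using pmax_small[OF alpha(1), of "1 / (C+1)"] C by auto
  have "H f (1 / d) \<le> ennreal (pmax \<alpha> d * C)"
    using H_scale[OF V_measurable[OF f], of "1/d" 1] d C by (simp add: ennreal_mult')
  also have "pmax \<alpha> d * C \<le> 1 / (C + 1) * C" using d C by (intro mult_right_mono) auto
  also have "\<dots> \<le> 1" using C by simp
  finally have "H f (1 / d) \<le> 1" by (simp add: ennreal_leI)
  then show ?thesis using d by (auto intro!: exI[of _ "1 / d"])
qed

lemma N_bdd_below: "bdd_below {\<delta>. \<delta> > 0 \<and> H f \<delta> \<le> 1}"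
  by (intro bdd_belowI[of _ 0]) auto

lemma N_nonneg: "f \<in> V \<Longrightarrow> 0 \<le> N f"
  unfolding M_norm_def by (intro cInf_greatest N_set_nonempty) auto

lemma N_le: "0 < \<delta> \<Longrightarrow> H f \<delta> \<le> 1 \<Longrightarrow> N f \<le> \<delta>"
  unfolding M_norm_def by (intro cInf_lower N_bdd_below) auto

lemma H_le_1:
  assumes f: "f \<in> V" and "N f < \<delta>" shows "H f \<delta> \<le> 1"
proof -
  obtain \<delta>' where \<delta>': "0 < \<delta>'" "H f \<delta>' \<le> 1" "\<delta>' < \<delta>"
    using assms(2) cInf_lessD[OF N_set_nonempty[OF f]] unfolding M_norm_def by auto
  have "pmax \<alpha> (\<delta>' / \<delta>) \<le> pmax \<alpha> 1" using \<delta>' alpha by (intro pmax_mono) auto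
  then have "ennreal (pmax \<alpha> (\<delta>' / \<delta>)) * H f \<delta>' \<le> 1 * 1"
    using \<delta>'(2) by (intro mult_mono) auto
  with H_scale[OF V_measurable[OF f], of \<delta> \<delta>'] \<delta>' show ?thesis by simp
qed

text \<open>At any scale above the quasi-norm \<open>H\<close> is at most 1, and one rescaling leads
  to \<delta>. Letting that scale decrease to the quasi-norm, instead of using the infimum itself,
  also covers the value 0.\<close>

lemma H_le_N:
  assumes f: "f \<in> V" and \<delta>: "0 < \<delta>" shows "H f \<delta> \<le> ennreal (pmax \<alpha> (N f / \<delta>))"
proof -
  let ?t = "\<lambda>k. N f + inverse (real (Suc k))"
  have le: "H f \<delta> \<le> ennreal (pmax \<alpha> (?t k / \<delta>))" for k
  proof -
    have t: "N f < ?t k" "0 < ?t k" using N_nonneg[OF f] by (auto intro: add_nonneg_pos)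
    have "H f \<delta> \<le> ennreal (pmax \<alpha> (?t k / \<delta>)) * H f (?t k)"
      using t \<delta> f by (intro H_scale V_measurable) auto
    also have "\<dots> \<le> ennreal (pmax \<alpha> (?t k / \<delta>)) * 1"
      using t f by (intro mult_left_mono H_le_1) auto
    finally show ?thesis by simp
  qed
  have lim: "(\<lambda>k. ennreal (pmax \<alpha> (?t k / \<delta>))) \<longlonglongrightarrow> ennreal (pmax \<alpha> ((N f + 0) / \<delta>))"
    using \<delta> N_nonneg[OF f]
    by (intro tendsto_ennrealI tendsto_pmax alpha tendsto_intros LIMSEQ_inverse_real_of_nat) auto
  have "H f \<delta> \<le> ennreal (pmax \<alpha> ((N f + 0) / \<delta>))"
    by (rule LIMSEQ_le_const[OF lim]) (use le in blast)
  then show ?thesis by simp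
qed

text \<open>At a positive scale t below the quasi-norm \<open>H\<close> exceeds 1. Multiplying the
  scaling inequality between t and \<delta> by \<open>pmin \<alpha> (t / \<delta>)\<close> cancels
  its factor exactly, by \<open>pmin_inverse\<close>.\<close>

lemma N_le_H:
  assumes f: "f \<in> V" and \<delta>: "0 < \<delta>" shows "ennreal (pmin \<alpha> (N f / \<delta>)) \<le> H f \<delta>"
proof (cases "N f = 0")
  case False
  then have N0: "0 < N f" using N_nonneg[OF f] by simp
  \<comment> \<open>The double successor keeps the factor at least 1/2, so the scale is positive
    from k = 0 on.\<close>
  let ?t = "\<lambda>k. N f * (1 - inverse (real (Suc (Suc k))))"
  have le: "ennreal (pmin \<alpha> (?t k / \<delta>)) \<le> H f \<delta>" for k
  proof -
    have "inverse (real (Suc (Suc k))) < 1" by (simp add: inverse_less_1_iff)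
    then have t: "0 < ?t k" using N0 by simp
    have "?t k < N f * 1" using N0 by (intro mult_strict_left_mono) auto
    then have "\<not> H f (?t k) \<le> 1" using N_le[OF t, of f] by auto
    then have "ennreal (pmin \<alpha> (?t k / \<delta>)) * 1 \<le> ennreal (pmin \<alpha> (?t k / \<delta>)) * H f (?t k)"
      by (intro mult_left_mono) auto
    also have "\<dots> \<le> ennreal (pmin \<alpha> (?t k / \<delta>)) * (ennreal (pmax \<alpha> (\<delta> / ?t k)) * H f \<delta>)"
      using f t \<delta> by (intro mult_left_mono H_scale V_measurable) auto
    also have "\<dots> = ennreal (pmax \<alpha> (1 / (?t k / \<delta>)) * pmin \<alpha> (?t k / \<delta>)) * H f \<delta>"
      by (simp add: ennreal_mult' mult_ac)
    also have "\<dots> = H f \<delta>" using t \<delta> by (subst pmin_inverse) auto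
    finally show ?thesis by simp
  qed
  have lim: "(\<lambda>k. ennreal (pmin \<alpha> (?t k / \<delta>))) \<longlonglongrightarrow> ennreal (pmin \<alpha> (N f * (1 - 0) / \<delta>))"
  proof (intro tendsto_ennrealI tendsto_pmin alpha)
    show "(\<lambda>k. ?t k / \<delta>) \<longlonglongrightarrow> N f * (1 - 0) / \<delta>"
      using \<delta> by (intro tendsto_intros LIMSEQ_Suc[OF LIMSEQ_inverse_real_of_nat]) auto
    show "eventually (\<lambda>k. 0 \<le> ?t k / \<delta>) sequentially"
      using \<delta> N0 by (intro always_eventually allI divide_nonneg_pos mult_nonneg_nonneg) (auto simp: inverse_le_1_iff)
  qed
  have "ennreal (pmin \<alpha> (N f * (1 - 0) / \<delta>)) \<le> H f \<delta>"
    by (rule LIMSEQ_le_const2[OF lim]) (use le in blast)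
  then show ?thesis by simp
qed simp

lemma N_tendsto_0_iff:
  assumes G: "\<And>n. G n \<in> V"
  shows "(\<lambda>n. N (G n)) \<longlonglongrightarrow> 0 \<longleftrightarrow> (\<lambda>n. H (G n) 1) \<longlonglongrightarrow> 0"
proof
  assume "(\<lambda>n. N (G n)) \<longlonglongrightarrow> 0"
  then have lim0: "(\<lambda>n. ennreal (pmax \<alpha> (N (G n)))) \<longlonglongrightarrow> ennreal (pmax \<alpha> 0)"
    by (intro tendsto_ennrealI tendsto_pmax alpha) (auto simp: N_nonneg[OF G])
  show "(\<lambda>n. H (G n) 1) \<longlonglongrightarrow> 0"
    by (rule tendsto_sandwich[OF _ _ tendsto_const[of 0] lim0[simplified]])
       (use H_le_N[OF G zero_less_one] in simp_all)
next
  assume H0: "(\<lambda>n. H (G n) 1) \<longlonglongrightarrow> 0"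
  show "(\<lambda>n. N (G n)) \<longlonglongrightarrow> 0"
  proof (rule order_tendstoI)
    fix e :: real assume "0 < e"
    then have e: "0 < e / 2" by simp
    have "(\<lambda>n. ennreal (pmax \<alpha> (1 / (e / 2))) * H (G n) 1) \<longlonglongrightarrow> ennreal (pmax \<alpha> (1 / (e / 2))) * 0"
      by (intro ennreal_tendsto_cmult H0) auto
    then have "eventually (\<lambda>n. ennreal (pmax \<alpha> (1 / (e / 2))) * H (G n) 1 < 1) sequentially"
      by (intro order_tendstoD) auto
    then show "eventually (\<lambda>n. N (G n) < e) sequentially"
    proof eventually_elim
      case (elim n)
      have "H (G n) (e / 2) \<le> 1"
        using H_scale[OF V_measurable[OF G[of n]] e zero_less_one] elim by (meson less_imp_le order_trans)
      from N_le[OF e this] \<open>0 < e\<close> show ?case by simp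
    qed
  next
    fix e :: real assume "e < 0"
    then show "eventually (\<lambda>n. e < N (G n)) sequentially"
      using N_nonneg[OF G] by (intro always_eventually allI) (auto intro: less_le_trans)
  qed
qed

lemma V_scaleR:
  assumes f: "f \<in> V" shows "(\<lambda>s. c *\<^sub>R f s) \<in> V"
proof (cases "c = 0")
  case True
  then show ?thesis by (simp add: V_def H_fun_def)
next
  case False
  have "H (\<lambda>s. c *\<^sub>R f s) 1 \<le> ennreal (pmax \<alpha> \<bar>c\<bar>) * H f 1"
  proof -
    note [measurable] = V_measurable[OF f]
    have "H (\<lambda>s. c *\<^sub>R f s) 1 \<le> (\<integral>\<^sup>+s. ennreal (pmax \<alpha> \<bar>c\<bar>) * h (f s) \<partial>\<nu>)"
      unfolding H_fun_def by (intro nn_integral_mono) (simp add: h_scaleR_le)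
    then show ?thesis unfolding H_fun_def by (subst (asm) nn_integral_cmult) auto
  qed
  also have "\<dots> < \<infinity>" using f by (simp add: V_def ennreal_mult_less_top)
  finally show ?thesis using f by (auto simp: V_def intro: borel_measurable_scaleR)
qed

lemma N_0: "N (\<lambda>_. 0) = 0"
proof -
  have "{\<delta>. \<delta> > 0 \<and> H (\<lambda>_. 0) \<delta> \<le> 1} = {0<..}" by (auto simp: H_fun_def)
  then show ?thesis by (simp add: M_norm_def)
qed

text \<open>Since \<open>h\<close> is even, multiplying the function by c and the scale by the
  modulus of c leaves \<open>H\<close> unchanged. One inequality for all nonzero c is enough:
  applied to 1 / c it gives the other.\<close>

lemma N_scaleR:
  assumes f: "f \<in> V" shows "N (\<lambda>s. c *\<^sub>R f s) = \<bar>c\<bar> * N f"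
proof -
  have le: "N (\<lambda>s. c *\<^sub>R g s) \<le> \<bar>c\<bar> * N g" if g: "g \<in> V" and c: "c \<noteq> 0" for c g
  proof (rule field_le_epsilon)
    fix e :: real assume e: "0 < e"
    define t where "t = N g + e / \<bar>c\<bar>"
    have t: "N g < t" "0 < t" using e c N_nonneg[OF g] by (auto simp: t_def add_nonneg_pos)
    have "H (\<lambda>s. c *\<^sub>R g s) (\<bar>c\<bar> * t) = H g t"
    proof -
      have "(1 / (\<bar>c\<bar> * t)) *\<^sub>R (c *\<^sub>R D) = sgn c *\<^sub>R ((1 / t) *\<^sub>R D)" for D :: "real^'n^'n"
        using c by (simp add: sgn_real_def abs_if)
      moreover have "h (sgn c *\<^sub>R D) = h D" for D
        using c by (cases "c > 0") auto
      ultimately show ?thesis by (simp only: H_fun_def)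
    qed
    then have "N (\<lambda>s. c *\<^sub>R g s) \<le> \<bar>c\<bar> * t"
      using H_le_1[OF g t(1)] t(2) c by (intro N_le) auto
    also have "\<dots> = \<bar>c\<bar> * N g + e" using c by (simp add: t_def field_simps)
    finally show "N (\<lambda>s. c *\<^sub>R g s) \<le> \<bar>c\<bar> * N g + e" .
  qed
  show ?thesis
  proof (cases "c = 0")
    case False
    have "N f \<le> \<bar>1 / c\<bar> * N (\<lambda>s. c *\<^sub>R f s)"
      using le[OF V_scaleR[OF f, of c], of "1 / c"] False by simp
    then have "\<bar>c\<bar> * N f \<le> N (\<lambda>s. c *\<^sub>R f s)"
      using False by (simp add: field_simps)
    with le[OF f False] show ?thesis by simp
  qed (simp add: N_0)
qed

text \<open>The constant is chosen so that \<open>pmax \<alpha> (1 / ?A)\<close> equals 1/8: passing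
  from scale t to \<open>?A * t\<close> wins back exactly the factor 4 * (1 + 1) that
  quasi-subadditivity costs when both summands have \<open>H\<close> at most 1.\<close>

lemma N_add:
  assumes f: "f \<in> V" and g: "g \<in> V"
  shows "N (\<lambda>s. f s + g s) \<le> 8 powr (1 / \<alpha>) * (N f + N g)"
proof -
  let ?A = "8 powr (1 / \<alpha>) :: real"
  have A: "1 \<le> ?A" using alpha by (simp add: ge_one_powr_ge_zero)
  have "pmax \<alpha> (1 / ?A) = 1 / 8"
  proof -
    have "(1 / ?A) powr \<alpha> = 1 / 8" using alpha by (simp add: powr_divide powr_powr)
    moreover have "(1 / ?A)\<^sup>2 \<le> (1 / ?A) powr \<alpha>"
    proof -
      have "(1 / ?A) powr 2 \<le> (1 / ?A) powr \<alpha>" using A alpha by (intro powr_mono') auto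
      then show ?thesis by simp
    qed
    ultimately show ?thesis by (simp add: pmax_def max_def)
  qed
  then have pA: "ennreal (pmax \<alpha> (1 / ?A)) * (4 * (1 + 1)) = 1"
    by (simp flip: ennreal_numeral ennreal_1 add: ennreal_mult'[symmetric] ennreal_plus[symmetric] del: ennreal_plus)
  show ?thesis
  proof (rule field_le_epsilon)
    fix e :: real assume e: "0 < e"
    define t where "t = N f + N g + e / ?A"
    have t: "N f < t" "N g < t" "0 < t"
      using e A N_nonneg[OF f] N_nonneg[OF g] by (auto simp: t_def add_nonneg_pos add_pos_nonneg)
    have "H (\<lambda>s. f s + g s) (?A * t) \<le> ennreal (pmax \<alpha> (t / (?A * t))) * H (\<lambda>s. f s + g s) t"
      using t A V_add[OF f g] by (intro H_scale V_measurable) auto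
    also have "\<dots> \<le> ennreal (pmax \<alpha> (1 / ?A)) * (4 * (H f t + H g t))"
      using t H_add[OF V_measurable[OF f] V_measurable[OF g], of t] by (auto intro: mult_left_mono)
    also have "\<dots> \<le> ennreal (pmax \<alpha> (1 / ?A)) * (4 * (1 + 1))"
      using t H_le_1[OF f] H_le_1[OF g] by (intro mult_left_mono add_mono) auto
    finally have "N (\<lambda>s. f s + g s) \<le> ?A * t"
      unfolding pA using t A by (intro N_le) auto
    also have "\<dots> = ?A * (N f + N g) + e" by (simp add: t_def field_simps)
    finally show "N (\<lambda>s. f s + g s) \<le> ?A * (N f + N g) + e" .
  qed
qed

lemma N_eq_0_iff: 
  assumes f: "f \<in> V" shows "N f = 0 \<longleftrightarrow> (AE s in \<nu>. f s = 0)"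
proof
  assume "N f = 0"
  then show "AE s in \<nu>. f s = 0"
    using H_le_N[OF f, of 1] H_eq_0_iff[OF V_measurable[OF f], of 1] by simp
next
  assume "AE s in \<nu>. f s = 0"
  then have "H f 1 = 0" using H_eq_0_iff[OF V_measurable[OF f], of 1] by simp
  then have "pmin \<alpha> (N f) \<le> 0" using N_le_H[OF f, of 1] by (simp add: ennreal_eq_0_iff)
  then show "N f = 0" using pmin_pos[of "N f" \<alpha>] N_nonneg[OF f] by force
qed

lemma quasi_norm_N: "quasi_norm_AE \<nu> V N"
  unfolding quasi_norm_AE_def
proof (intro conjI allI ballI impI)
  show "V \<subseteq> borel_measurable \<nu>" by (auto simp: V_def)
  show "(\<lambda>_. 0) \<in> V" by (simp add: V_def H_fun_def)
  fix f assume f: "f \<in> V"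
  show "0 \<le> N f" using f by (rule N_nonneg)
  show "N f = 0 \<longleftrightarrow> (AE s in \<nu>. f s = 0)" using f by (rule N_eq_0_iff)
  fix g assume "g \<in> borel_measurable \<nu>" "AE s in \<nu>. f s = g s"
  then show "g \<in> V" "N g = N f"
    using f H_cong_AE[of f g] by (auto simp: V_def M_norm_def)
next
  show "\<exists>A\<ge>1. \<forall>f\<in>V. \<forall>g\<in>V. N (\<lambda>s. f s + g s) \<le> A * (N f + N g)"
    using N_add alpha by (intro exI[of _ "8 powr (1 / \<alpha>)"]) (simp add: ge_one_powr_ge_zero)
qed (auto intro: V_add V_scaleR simp: N_scaleR)

text \<open>The bound of \<open>H\<close> by the quasi-norm turns a Cauchy sequence into an
  \<open>H\<close>-Cauchy one, whose almost everywhere subsequential limit f is the candidate. It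
  lies in \<open>V\<close> as the difference of \<open>F n\<close> and
  \<open>F n - f\<close>.\<close>

lemma complete_N: "complete_wrt V N"
  unfolding complete_wrt_def
proof (intro allI impI, elim conjE)
  fix F :: "nat \<Rightarrow> 's \<Rightarrow> real^'n^'n"
  assume FV: "\<forall>n. F n \<in> V" and cauchy: "\<forall>\<epsilon>>0. \<exists>n0. \<forall>m\<ge>n0. \<forall>n\<ge>n0. N (\<lambda>s. F m s - F n s) < \<epsilon>"
  have F: "F n \<in> V" for n using FV by simp
  note [measurable] = V_measurable[OF F]
  have HF: "H_cauchy F"
    unfolding H_cauchy_def
  proof (intro allI impI)
    fix e :: real assume "0 < e"
    then obtain d where d: "0 < d" "pmax \<alpha> d < e" using pmax_small[OF alpha(1)] by blast
    then obtain n0 where n0: "\<And>m n. m \<ge> n0 \<Longrightarrow> n \<ge> n0 \<Longrightarrow> N (\<lambda>s. F m s - F n s) < d"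
      using cauchy by blast
    have "H (\<lambda>s. F m s - F n s) 1 \<le> ennreal e" if "m \<ge> n0" "n \<ge> n0" for m n
    proof -
      have D: "(\<lambda>s. F m s - F n s) \<in> V" by (intro V_diff F)
      have "pmax \<alpha> (N (\<lambda>s. F m s - F n s)) \<le> pmax \<alpha> d"
        using n0[OF that] N_nonneg[OF D] alpha by (intro pmax_mono) auto
      then have "ennreal (pmax \<alpha> (N (\<lambda>s. F m s - F n s))) \<le> ennreal e"
        using d(2) by (intro ennreal_leI) simp
      with H_le_N[OF D, of 1] show ?thesis by (simp only: div_by_1) (rule order_trans, auto)
    qed
    then show "\<exists>N. \<forall>m\<ge>N. \<forall>n\<ge>N. H (\<lambda>s. F m s - F n s) 1 \<le> ennreal e" by blast
  qed
  obtain r f where rf: "strict_mono r" "f \<in> borel_measurable \<nu>" "AE s in \<nu>. (\<lambda>k. F (r k) s) \<longlonglongrightarrow> f s"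
    by (rule H_cauchy_subseq[OF _ HF]) auto
  note [measurable] = rf(2)
  have lim: "(\<lambda>n. H (\<lambda>s. F n s - f s) 1) \<longlonglongrightarrow> 0"
    by (rule H_cauchy_limit[OF _ _ HF rf(1) rf(3)]) auto
  then have "eventually (\<lambda>n. H (\<lambda>s. F n s - f s) 1 < 1) sequentially" by (intro order_tendstoD) auto
  then obtain n where n: "H (\<lambda>s. F n s - f s) 1 < 1" by (auto simp: eventually_sequentially)
  then have "(\<lambda>s. F n s - f s) \<in> V" by (auto simp: V_def intro: less_trans)
  from V_diff[OF F[of n] this] have f: "f \<in> V" by simp
  show "\<exists>f\<in>V. (\<lambda>n. N (\<lambda>s. F n s - f s)) \<longlonglongrightarrow> 0"
    using lim f F by (intro bexI[of _ f]) (auto simp: N_tendsto_0_iff V_diff)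
qed

end

section \<open>Integrals of general functions\<close>

lemma tendsto_in_probD:
  assumes "tendsto_in_prob M X Y" "0 < e"
  shows "(\<lambda>n. measure M {\<omega> \<in> space M. e < norm (X n \<omega> - Y \<omega>)}) \<longlonglongrightarrow> 0"
  using assms unfolding tendsto_in_prob_def by blast

lemma tendsto_ge_const:
  fixes X :: "nat \<Rightarrow> ennreal"
  assumes "X \<longlonglongrightarrow> x" "\<And>n. a \<le> X n" shows "a \<le> x"
  using LIMSEQ_le_const[OF assms(1)] assms(2) by blast

text \<open>Z has to agree with the difference only almost surely, because simple integrals are
  additive only up to null sets.\<close>

lemma (in prob_space) tendsto_in_prob_diff:
  fixes X Y :: "nat \<Rightarrow> 'a \<Rightarrow> 'b::euclidean_space"
  assumes [measurable]: "\<And>n. X n \<in> borel_measurable M" "\<And>n. Y n \<in> borel_measurable M"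
      "X' \<in> borel_measurable M" "Y' \<in> borel_measurable M"
    and X: "tendsto_in_prob M X X'" and Y: "tendsto_in_prob M Y Y'"
    and Z: "\<And>n. AE \<omega> in M. Z n \<omega> = X n \<omega> - Y n \<omega>" "\<And>n. Z n \<in> borel_measurable M"
  shows "tendsto_in_prob M Z (\<lambda>\<omega>. X' \<omega> - Y' \<omega>)"
  unfolding tendsto_in_prob_def
proof (intro allI impI)
  fix e :: real assume e: "0 < e"
  note [measurable] = Z(2)
  let ?X = "\<lambda>n. {\<omega> \<in> space M. norm (X n \<omega> - X' \<omega>) > e / 2}"
  let ?Y = "\<lambda>n. {\<omega> \<in> space M. norm (Y n \<omega> - Y' \<omega>) > e / 2}"
  have le: "prob {\<omega> \<in> space M. norm (Z n \<omega> - (X' \<omega> - Y' \<omega>)) > e} \<le> prob (?X n) + prob (?Y n)" for n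
  proof -
    have "prob {\<omega> \<in> space M. norm (Z n \<omega> - (X' \<omega> - Y' \<omega>)) > e} \<le> prob (?X n \<union> ?Y n)"
    proof (rule finite_measure_mono_AE)
      show "AE \<omega> in M. \<omega> \<in> {\<omega> \<in> space M. norm (Z n \<omega> - (X' \<omega> - Y' \<omega>)) > e} \<longrightarrow> \<omega> \<in> ?X n \<union> ?Y n"
        using Z(1)[of n]
      proof eventually_elim
        case (elim \<omega>)
        have "norm (Z n \<omega> - (X' \<omega> - Y' \<omega>)) \<le> norm (X n \<omega> - X' \<omega>) + norm (Y n \<omega> - Y' \<omega>)"
          using norm_triangle_ineq4[of "X n \<omega> - X' \<omega>" "Y n \<omega> - Y' \<omega>"] by (simp add: elim algebra_simps)
        then show ?case by auto
      qed
    qed measurable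
    also have "\<dots> \<le> prob (?X n) + prob (?Y n)" by (rule measure_Un_le) auto
    finally show ?thesis .
  qed
  have "(\<lambda>n. prob (?X n)) \<longlonglongrightarrow> 0" "(\<lambda>n. prob (?Y n)) \<longlonglongrightarrow> 0"
    by (rule tendsto_in_probD[OF X half_gt_zero[OF e]], rule tendsto_in_probD[OF Y half_gt_zero[OF e]])
  then have lim0: "(\<lambda>n. prob (?X n) + prob (?Y n)) \<longlonglongrightarrow> 0" by (auto intro: tendsto_eq_intros)
  show "(\<lambda>n. prob {\<omega> \<in> space M. norm (Z n \<omega> - (X' \<omega> - Y' \<omega>)) > e}) \<longlonglongrightarrow> 0"
    by (rule tendsto_sandwich[OF _ _ tendsto_const lim0]) (intro always_eventually allI le measure_nonneg)+
qed

lemma tendsto_in_prob_compose: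
  assumes "tendsto_in_prob M X X'" "filterlim r sequentially sequentially"
  shows "tendsto_in_prob M (\<lambda>n. X (r n)) X'"
  unfolding tendsto_in_prob_def
proof (intro allI impI)
  fix e :: real assume "0 < e"
  from filterlim_compose[OF tendsto_in_probD[OF assms(1) this] assms(2)]
  show "(\<lambda>n. measure M {\<omega> \<in> space M. e < norm (X (r n) \<omega> - X' \<omega>)}) \<longlonglongrightarrow> 0" .
qed

lemma (in prob_space) tendsto_in_prob_if_cauchy:
  fixes X :: "nat \<Rightarrow> 'a \<Rightarrow> 'b::euclidean_space"
  assumes [measurable]: "\<And>n. X n \<in> borel_measurable M"
    and cauchy: "\<And>e. 0 < e \<Longrightarrow> \<exists>N. \<forall>m\<ge>N. \<forall>n\<ge>N. emeasure M {x \<in> space M. e < norm (X m x - X n x)} \<le> ennreal e"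
  obtains Y where "Y \<in> borel_measurable M" "tendsto_in_prob M X Y"
proof -
  obtain r Y where rY: "strict_mono r" "Y \<in> borel_measurable M" "AE x in M. (\<lambda>k. X (r k) x) \<longlonglongrightarrow> Y x"
    by (rule cauchy_in_measure_subseq[of X M]) (use cauchy in auto)
  note [measurable] = rY(2)
  have "tendsto_in_prob M X Y"
    unfolding tendsto_in_prob_def
  proof (intro allI impI LIMSEQ_I)
    fix \<epsilon> e :: real assume pos: "0 < \<epsilon>" "0 < e"
    \<comment> \<open>One number serves as threshold and as bound for the probability; halving e
      makes the final inequality strict.\<close>
    define d where "d = min \<epsilon> (e / 2)"
    have d: "0 < d" "d \<le> \<epsilon>" "d < e" using pos by (auto simp: d_def)
    obtain N where N: "\<And>m n. m \<ge> N \<Longrightarrow> n \<ge> N \<Longrightarrow> emeasure M {x \<in> space M. d < norm (X m x - X n x)} \<le> ennreal d"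
      using cauchy[OF d(1)] by blast
    have "prob {x \<in> space M. norm (X n x - Y x) > \<epsilon>} < e" if "n \<ge> N" for n
    proof -
      have "prob {x \<in> space M. norm (X n x - Y x) > \<epsilon>} \<le> prob {x \<in> space M. norm (X n x - Y x) > d}"
        using d by (intro finite_measure_mono) auto
      also have "emeasure M {x \<in> space M. d < norm (X n x - Y x)} \<le> ennreal d"
        by (rule cauchy_in_measure_limit[OF _ _ rY(1,3) N that]) auto
      then have "prob {x \<in> space M. norm (X n x - Y x) > d} \<le> d"
        using d by (simp add: emeasure_eq_measure)
      finally show ?thesis using d by simp
    qed
    then show "\<exists>no. \<forall>n\<ge>no. norm (prob {x \<in> space M. norm (X n x - Y x) > \<epsilon>} - 0) < e" by auto
  qed
  with rY(2) show thesis by (rule that)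
qed

lemma ennreal_tendsto_0_imp_le:
  fixes X :: "nat \<Rightarrow> ennreal"
  assumes "X \<longlonglongrightarrow> 0" "0 < e" obtains n where "X n \<le> ennreal e"
proof -
  have "eventually (\<lambda>n. X n < ennreal e) sequentially" using assms by (intro order_tendstoD) auto
  then obtain n where "X n < ennreal e" by (auto simp: eventually_sequentially)
  then show thesis by (intro that[of n]) simp
qed

section \<open>Density of simple functions and extension of the integral\<close>

context tempered_isrm
begin

text \<open>Simple approximations of norm at most twice that of g differ from g by at most 3 B, so
  \<open>h\<close> of the difference is dominated by a constant on the support of g, which has
  finite measure. The differences tend to the zero matrix, where \<open>h_le_norm\<close> controls
  \<open>h\<close>.\<close>

lemma bounded_approximation:
  assumes [measurable]: "g \<in> borel_measurable \<nu>"
    and bnd: "\<And>s. s \<in> space \<nu> \<Longrightarrow> norm (g s) \<le> B"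
    and supp: "emeasure \<nu> {s \<in> space \<nu>. g s \<noteq> 0} < \<infinity>"
    and e: "0 < e"
  obtains G where "sbi G" "H (\<lambda>s. G s - g s) 1 \<le> ennreal e"
proof -
  obtain F where F: "\<And>i. simple_function \<nu> (F i)" "\<And>s. s \<in> space \<nu> \<Longrightarrow> (\<lambda>i. F i s) \<longlonglongrightarrow> g s"
      "\<And>i s. s \<in> space \<nu> \<Longrightarrow> norm (F i s) \<le> 2 * norm (g s)"
    using borel_measurable_implies_sequence_metric[OF assms(1), of 0] unfolding norm_conv_dist by metis
  have [measurable]: "F i \<in> borel_measurable \<nu>" for i using F(1) by (rule borel_measurable_simple_function)
  have F0: "F i s = 0" if "s \<in> space \<nu>" "g s = 0" for i s using F(3)[OF that(1), of i] that(2) by simp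
  have sbi: "sbi (F i)" for i
  proof (intro Bochner_Integration.simple_bochner_integrable.intros F)
    have "emeasure \<nu> {s \<in> space \<nu>. F i s \<noteq> 0} \<le> emeasure \<nu> {s \<in> space \<nu>. g s \<noteq> 0}"
      using F0 by (intro emeasure_mono) auto
    with supp show "emeasure \<nu> {s \<in> space \<nu>. F i s \<noteq> 0} \<noteq> \<infinity>" by (auto simp: top_unique)
  qed
  let ?S = "{s \<in> space \<nu>. g s \<noteq> 0}"
  let ?w = "\<lambda>s. ennreal (pmax \<alpha> (3 * B)) * h (mat 1) * indicator ?S s"
  have "(\<lambda>i. \<integral>\<^sup>+s. h (F i s - g s) \<partial>\<nu>) \<longlonglongrightarrow> (\<integral>\<^sup>+s. 0 \<partial>\<nu>)"
  proof (rule nn_integral_dominated_convergence)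
    show "(\<integral>\<^sup>+s. ?w s \<partial>\<nu>) < \<infinity>"
      using supp h_finite[of "mat 1"] by (subst nn_integral_cmult_indicator) (auto simp: ennreal_mult_less_top)
    show "AE s in \<nu>. h (F i s - g s) \<le> ?w s" for i
    proof (rule AE_I2)
      fix s assume s: "s \<in> space \<nu>"
      show "h (F i s - g s) \<le> ?w s"
      proof (cases "g s = 0")
        case False
        have "norm (F i s - g s) \<le> 3 * B"
          using norm_triangle_ineq4[of "F i s" "g s"] F(3)[OF s, of i] bnd[OF s] by linarith
        then have "ennreal (pmax \<alpha> (norm (F i s - g s))) * h (mat 1) \<le> ennreal (pmax \<alpha> (3 * B)) * h (mat 1)"
          using alpha by (intro mult_right_mono ennreal_leI pmax_mono) auto
        with h_le_norm[of "F i s - g s"] show ?thesis using s False by (auto intro: order_trans)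
      qed (simp add: F0[OF s])
    qed
    show "AE s in \<nu>. (\<lambda>i. h (F i s - g s)) \<longlonglongrightarrow> 0"
    proof (rule AE_I2)
      fix s assume s: "s \<in> space \<nu>"
      have "(\<lambda>i. norm (F i s - g s)) \<longlonglongrightarrow> norm (g s - g s)" by (intro tendsto_intros F s)
      then have "(\<lambda>i. ennreal (pmax \<alpha> (norm (F i s - g s)))) \<longlonglongrightarrow> ennreal (pmax \<alpha> 0)"
        by (intro tendsto_ennrealI tendsto_pmax alpha) auto
      then have "(\<lambda>i. h (mat 1) * ennreal (pmax \<alpha> (norm (F i s - g s)))) \<longlonglongrightarrow> h (mat 1) * ennreal (pmax \<alpha> 0)"
        using h_finite[of "mat 1"] by (intro ennreal_tendsto_cmult) auto
      then have lim0: "(\<lambda>i. ennreal (pmax \<alpha> (norm (F i s - g s))) * h (mat 1)) \<longlonglongrightarrow> 0"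
        by (simp add: mult.commute)
      show "(\<lambda>i. h (F i s - g s)) \<longlonglongrightarrow> 0"
        by (rule tendsto_sandwich[OF _ _ tendsto_const lim0]) (simp_all add: h_le_norm)
    qed
  qed measurable
  then have "(\<lambda>i. H (\<lambda>s. F i s - g s) 1) \<longlonglongrightarrow> 0" by (simp add: H_fun_def)
  from ennreal_tendsto_0_imp_le[OF this e] obtain i where "H (\<lambda>s. F i s - g s) 1 \<le> ennreal e" .
  with sbi show thesis by (rule that)
qed

text \<open>\<open>h\<close> need not be bounded by a multiple of \<open>pmin \<alpha> \<circ> norm\<close>, so a simple approximation dominated by \<open>norm (f s)\<close> need not be
  dominated in \<open>h\<close>; truncating \<open>f\<close> first makes the dominating function bounded with support of finite measure.\<close>

lemma simple_approximation_within:
  assumes f: "f \<in> V" and e: "0 < e"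
  obtains G where "sbi G" "H (\<lambda>s. G s - f s) 1 \<le> ennreal e"
proof -
  note [measurable] = V_measurable[OF f]
  let ?A = "\<lambda>n::nat. {s \<in> space \<nu>. inverse (real (Suc n)) \<le> norm (f s) \<and> norm (f s) \<le> real n}"
  let ?g = "\<lambda>n s. indicator (?A n) s *\<^sub>R f s"
  have "(\<lambda>n. \<integral>\<^sup>+s. h (?g n s - f s) \<partial>\<nu>) \<longlonglongrightarrow> (\<integral>\<^sup>+s. 0 \<partial>\<nu>)"
  proof (rule nn_integral_dominated_convergence)
    show "(\<integral>\<^sup>+s. h (f s) \<partial>\<nu>) < \<infinity>" using f by (simp add: V_def H_fun_def)
    show "AE s in \<nu>. h (?g n s - f s) \<le> h (f s)" for n
      by (rule AE_I2) (auto simp: indicator_def)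
    show "AE s in \<nu>. (\<lambda>n. h (?g n s - f s)) \<longlonglongrightarrow> 0"
    proof (rule AE_I2)
      fix s assume s: "s \<in> space \<nu>"
      have "eventually (\<lambda>n. ?g n s - f s = 0) sequentially"
      proof (cases "f s = 0")
        case False
        then have "eventually (\<lambda>n. inverse (real (Suc n)) < norm (f s)) sequentially"
          by (intro order_tendstoD[OF LIMSEQ_inverse_real_of_nat]) auto
        moreover have "eventually (\<lambda>n. norm (f s) \<le> real n) sequentially"
          using eventually_ge_at_top[of "nat \<lceil>norm (f s)\<rceil>"] by eventually_elim linarith
        ultimately show ?thesis by eventually_elim (use s in auto)
      qed simp
      then have "eventually (\<lambda>n. h (?g n s - f s) = 0) sequentially" by eventually_elim simp
      then show "(\<lambda>n. h (?g n s - f s)) \<longlonglongrightarrow> 0" by (rule tendsto_eventually)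
    qed
  qed measurable
  then have lim: "(\<lambda>n. H (\<lambda>s. ?g n s - f s) 1) \<longlonglongrightarrow> 0" by (simp add: H_fun_def)
  obtain n where n: "H (\<lambda>s. ?g n s - f s) 1 \<le> ennreal (e / 8)"
    by (rule ennreal_tendsto_0_imp_le[OF lim, of "e / 8"]) (use e in auto)
  have gm: "?g n \<in> borel_measurable \<nu>" by measurable
  obtain G where G: "sbi G" "H (\<lambda>s. G s - ?g n s) 1 \<le> ennreal (e / 8)"
  proof (rule bounded_approximation[OF gm, of "real n" "e / 8"])
    show "norm (?g n s) \<le> real n" if "s \<in> space \<nu>" for s by (auto simp: indicator_def)
    obtain C where C: "0 < C" "\<And>f. f \<in> borel_measurable \<nu> \<Longrightarrow>
        emeasure \<nu> {s \<in> space \<nu>. inverse (real (Suc n)) \<le> norm (f s)} \<le> ennreal C * H f 1"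
      using H_markov[of "inverse (real (Suc n))"] by auto
    have "emeasure \<nu> {s \<in> space \<nu>. ?g n s \<noteq> 0} \<le> emeasure \<nu> {s \<in> space \<nu>. inverse (real (Suc n)) \<le> norm (f s)}"
      by (intro emeasure_mono) (auto simp: indicator_def)
    also have "\<dots> \<le> ennreal C * H f 1" by (intro C) measurable
    also have "\<dots> < \<infinity>" using f by (simp add: V_def ennreal_mult_less_top)
    finally show "emeasure \<nu> {s \<in> space \<nu>. ?g n s \<noteq> 0} < \<infinity>" .
  qed (use e in auto)
  have "H (\<lambda>s. G s - f s) 1 \<le> 4 * (H (\<lambda>s. G s - ?g n s) 1 + H (\<lambda>s. ?g n s - f s) 1)"
    using G(1) by (intro H_triangle gm) auto
  also have "\<dots> \<le> 4 * (ennreal (e / 8) + ennreal (e / 8))"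
    by (intro mult_left_mono add_mono G n) auto
  also have "\<dots> = ennreal e"
    using e by (simp add: ennreal_plus[symmetric] ennreal_mult'[symmetric] del: ennreal_plus flip: ennreal_numeral)
  finally show thesis using G(1) by (intro that)
qed

text \<open>Approximation in \<open>H\<close> is upgraded to almost everywhere convergence. A
  subsequence converges almost everywhere to some g, and \<open>H\<close> of f - g vanishes, so g
  agrees with f almost everywhere.\<close>

lemma simple_approximation:
  assumes f: "f \<in> V"
  obtains F where "\<And>n. sbi (F n)" "(\<lambda>n. H (\<lambda>s. F n s - f s) 1) \<longlonglongrightarrow> 0" "AE s in \<nu>. (\<lambda>n. F n s) \<longlonglongrightarrow> f s"
proof -
  note [measurable] = V_measurable[OF f]
  have "\<forall>n. \<exists>G. sbi G \<and> H (\<lambda>s. G s - f s) 1 \<le> ennreal (inverse (real (Suc n)))"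
  proof
    fix n
    obtain G where "sbi G" "H (\<lambda>s. G s - f s) 1 \<le> ennreal (inverse (real (Suc n)))"
      by (rule simple_approximation_within[OF f, of "inverse (real (Suc n))"]) auto
    then show "\<exists>G. sbi G \<and> H (\<lambda>s. G s - f s) 1 \<le> ennreal (inverse (real (Suc n)))" by blast
  qed
  then obtain G where G: "\<And>n. sbi (G n)" "\<And>n. H (\<lambda>s. G n s - f s) 1 \<le> ennreal (inverse (real (Suc n)))"
    by metis
  note [measurable] = sbi_measurable[OF G(1)]
  have lim: "(\<lambda>n. H (\<lambda>s. G n s - f s) 1) \<longlonglongrightarrow> 0"
    by (rule tendsto_sandwich[OF _ _ tendsto_const tendsto_ennrealI[OF LIMSEQ_inverse_real_of_nat, simplified ennreal_0]])
       (intro always_eventually allI zero_le G)+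
  have cauchy: "H_cauchy G" by (rule H_convergent_imp_cauchy[OF _ _ lim]) auto
  obtain r g where rg: "strict_mono r" "g \<in> borel_measurable \<nu>" "AE s in \<nu>. (\<lambda>k. G (r k) s) \<longlonglongrightarrow> g s"
    by (rule H_cauchy_subseq[OF _ cauchy]) auto
  note [measurable] = rg(2)
  have lim': "(\<lambda>n. H (\<lambda>s. G n s - g s) 1) \<longlonglongrightarrow> 0"
    by (rule H_cauchy_limit[OF _ _ cauchy rg(1,3)]) auto
  have "(\<lambda>n. 4 * (H (\<lambda>s. G n s - f s) 1 + H (\<lambda>s. G n s - g s) 1)) \<longlonglongrightarrow> 4 * (0 + 0)"
    by (intro ennreal_tendsto_cmult tendsto_add lim lim') auto
  moreover have "H (\<lambda>s. f s - g s) 1 \<le> 4 * (H (\<lambda>s. G n s - f s) 1 + H (\<lambda>s. G n s - g s) 1)" for n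
    using H_triangle[of f "G n" g 1] by (simp add: H_minus_commute[of f "G n"])
  ultimately have "H (\<lambda>s. f s - g s) 1 \<le> 4 * (0 + 0)" by (rule tendsto_ge_const)
  then have "AE s in \<nu>. f s - g s = 0" using H_eq_0_iff[of "\<lambda>s. f s - g s" 1] by simp
  with rg(3) have "AE s in \<nu>. (\<lambda>k. G (r k) s) \<longlonglongrightarrow> f s" by eventually_elim simp
  moreover have "(\<lambda>k. H (\<lambda>s. G (r k) s - f s) 1) \<longlonglongrightarrow> 0"
    using LIMSEQ_subseq_LIMSEQ[OF lim rg(1)] by (simp add: o_def)
  ultimately show thesis using G(1) by (intro that[of "\<lambda>k. G (r k)"]) auto
qed

text \<open>Approximation in \<open>H\<close> replaces almost everywhere convergence of the simple functions: this notion
  is stable under differences without checking all restrictions \<open>indicator A\<close>.\<close>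

definition H_integral :: "('s \<Rightarrow> real^'n^'n) \<Rightarrow> ('w \<Rightarrow> real^'n) \<Rightarrow> bool" where
  "H_integral f X \<longleftrightarrow> f \<in> borel_measurable \<nu> \<and> X \<in> borel_measurable P \<and>
     (\<exists>F. (\<forall>n. sbi (F n)) \<and> (\<lambda>n. H (\<lambda>s. F n s - f s) 1) \<longlonglongrightarrow> 0 \<and> tendsto_in_prob P (\<lambda>n. SI (F n)) X)"

text \<open>Otherwise there are indices beyond every N whose differences stay away from 0 in
  \<open>H\<close>, while the corresponding simple integrals differ by a sequence tending to 0 in
  probability, against \<open>SI_tendsto_0_imp_H\<close>.\<close>

lemma SI_cauchy_imp_H_cauchy:
  assumes F: "\<And>n. sbi (F n)" and [measurable]: "X \<in> borel_measurable P"
    and lim: "tendsto_in_prob P (\<lambda>n. SI (F n)) X"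
  shows "H_cauchy F"
proof (rule ccontr)
  assume "\<not> H_cauchy F"
  then obtain e where e: "0 < e" "\<forall>N. \<exists>m n. m \<ge> N \<and> n \<ge> N \<and> \<not> H (\<lambda>s. F m s - F n s) 1 \<le> ennreal e"
    unfolding H_cauchy_def by blast
  from e(2) obtain m n where mn: "\<And>N. m N \<ge> N" "\<And>N. n N \<ge> N" "\<And>N. \<not> H (\<lambda>s. F (m N) s - F (n N) s) 1 \<le> ennreal e"
    by metis
  have fl: "filterlim m sequentially sequentially" "filterlim n sequentially sequentially"
    by (rule filterlim_at_top_mono[OF filterlim_ident], simp add: mn)+
  have "tendsto_in_prob P (\<lambda>N. SI (\<lambda>s. F (m N) s - F (n N) s)) (\<lambda>\<omega>. X \<omega> - X \<omega>)"
    by (rule P.tendsto_in_prob_diff[OF _ _ _ _ tendsto_in_prob_compose[OF lim fl(1)] tendsto_in_prob_compose[OF lim fl(2)]])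
       (auto intro: SI_measurable SI_diff sbi_diff F)
  then have "(\<lambda>N. H (\<lambda>s. F (m N) s - F (n N) s) 1) \<longlonglongrightarrow> 0"
    by (intro SI_tendsto_0_imp_H sbi_diff F) simp
  from ennreal_tendsto_0_imp_le[OF this e(1)] mn(3) show False by blast
qed

lemma has_ISRM_imp_H_integral:
  assumes "has_ISRM_integral P \<nu> M f X"
  shows "H_integral f X" "f \<in> V"
proof -
  from assms obtain F where [measurable]: "f \<in> borel_measurable \<nu>" "X \<in> borel_measurable P"
    and F: "\<And>n. sbi (F n)" "AE s in \<nu>. (\<lambda>n. F n s) \<longlonglongrightarrow> f s" "tendsto_in_prob P (\<lambda>n. SI (F n)) X"
    unfolding has_ISRM_integral_def by blast
  note [measurable] = sbi_measurable[OF F(1)]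
  have cauchy: "H_cauchy F" by (rule SI_cauchy_imp_H_cauchy[OF F(1) _ F(3)]) measurable
  have lim: "(\<lambda>n. H (\<lambda>s. F n s - f s) 1) \<longlonglongrightarrow> 0"
    by (rule H_cauchy_limit[OF _ _ cauchy, of f id]) (use F(2) in \<open>auto simp: strict_mono_def\<close>)
  then show "H_integral f X" unfolding H_integral_def using F by auto
  obtain n where n: "H (\<lambda>s. F n s - f s) 1 \<le> ennreal 1"
    by (rule ennreal_tendsto_0_imp_le[OF lim zero_less_one])
  have "F n \<in> V"
    using K_eq[OF F(1)] by (auto simp: V_def ennreal_mult_less_top intro!: le_less_trans[OF H_le_sum_K[OF F(1)]])
  moreover have "(\<lambda>s. F n s - f s) \<in> V" using n by (auto simp: V_def intro: le_less_trans)
  ultimately show "f \<in> V" using V_diff[of "F n" "\<lambda>s. F n s - f s"] by simp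
qed

text \<open>This takes the role of linearity of the integral: X and Y are arbitrary versions, so the
  version chosen for f - g does not enter.\<close>

lemma H_integral_diff:
  assumes "H_integral f X" "H_integral g Y"
  shows "H_integral (\<lambda>s. f s - g s) (\<lambda>\<omega>. X \<omega> - Y \<omega>)"
proof -
  from assms obtain F G where [measurable]: "f \<in> borel_measurable \<nu>" "X \<in> borel_measurable P"
      "g \<in> borel_measurable \<nu>" "Y \<in> borel_measurable P"
    and F: "\<And>n. sbi (F n)" "(\<lambda>n. H (\<lambda>s. F n s - f s) 1) \<longlonglongrightarrow> 0" "tendsto_in_prob P (\<lambda>n. SI (F n)) X"
    and G: "\<And>n. sbi (G n)" "(\<lambda>n. H (\<lambda>s. G n s - g s) 1) \<longlonglongrightarrow> 0" "tendsto_in_prob P (\<lambda>n. SI (G n)) Y"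
    unfolding H_integral_def by blast
  note [measurable] = sbi_measurable[OF F(1)] sbi_measurable[OF G(1)]
  have "tendsto_in_prob P (\<lambda>n. SI (\<lambda>s. F n s - G n s)) (\<lambda>\<omega>. X \<omega> - Y \<omega>)"
    by (rule P.tendsto_in_prob_diff[OF _ _ _ _ F(3) G(3)]) (auto intro: SI_measurable SI_diff sbi_diff F G)
  moreover have "(\<lambda>n. H (\<lambda>s. (F n s - G n s) - (f s - g s)) 1) \<longlonglongrightarrow> 0"
  proof -
    have "(\<lambda>n. 4 * (H (\<lambda>s. F n s - f s) 1 + H (\<lambda>s. G n s - g s) 1)) \<longlonglongrightarrow> 4 * (0 + 0)"
      by (intro ennreal_tendsto_cmult tendsto_add F G) auto
    then have lim0: "(\<lambda>n. 4 * (H (\<lambda>s. F n s - f s) 1 + H (\<lambda>s. G n s - g s) 1)) \<longlonglongrightarrow> 0" by simp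
    have eq: "(F n s - G n s) - (f s - g s) = (F n s - f s) - (G n s - g s)" for n s by simp
    have "H (\<lambda>s. (F n s - f s) - (G n s - g s)) 1 \<le> 4 * (H (\<lambda>s. F n s - f s) 1 + H (\<lambda>s. G n s - g s) 1)" for n
      by (rule H_diff) auto
    then show ?thesis
      unfolding eq by (intro tendsto_sandwich[OF always_eventually always_eventually tendsto_const lim0] allI zero_le)
  qed
  ultimately show ?thesis unfolding H_integral_def using F G by (auto intro!: exI[of _ "\<lambda>n s. F n s - G n s"] sbi_diff)
qed

text \<open>The event is split between a simple integral at level \<delta>/2 and an approximation
  error that vanishes in the limit. Of the 16, one factor 4 comes from quasi-subadditivity and the
  other from halving the scale.\<close>

lemma H_integral_tail:
  assumes fX: "H_integral f X" and \<delta>: "0 < \<delta>"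
  shows "emeasure P {\<omega> \<in> space P. \<delta> \<le> norm (X \<omega>)} \<le> ennreal (16 * tail_const) * H f \<delta>"
proof -
  from fX obtain F where [measurable]: "f \<in> borel_measurable \<nu>" "X \<in> borel_measurable P"
    and F: "\<And>n. sbi (F n)" "(\<lambda>n. H (\<lambda>s. F n s - f s) 1) \<longlonglongrightarrow> 0" "tendsto_in_prob P (\<lambda>n. SI (F n)) X"
    unfolding H_integral_def by blast
  note [measurable] = sbi_measurable[OF F(1)] SI_measurable[OF F(1)]
  let ?a = "\<lambda>n. H (\<lambda>s. F n s - f s) 1"
  let ?p = "\<lambda>n. measure P {\<omega> \<in> space P. norm (SI (F n) \<omega> - X \<omega>) > \<delta> / 4}"
  let ?b = "\<lambda>n. ennreal tail_const * (4 * (ennreal (pmax \<alpha> (2 / \<delta>)) * ?a n + 4 * H f \<delta>)) + ennreal (?p n)"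
  have le: "emeasure P {\<omega> \<in> space P. \<delta> \<le> norm (X \<omega>)} \<le> ?b n" for n
  proof -
    let ?S = "{\<omega> \<in> space P. \<delta> / 2 \<le> norm (SI (F n) \<omega>)}" and ?T = "{\<omega> \<in> space P. norm (SI (F n) \<omega> - X \<omega>) > \<delta> / 4}"
    have "{\<omega> \<in> space P. \<delta> \<le> norm (X \<omega>)} \<subseteq> ?S \<union> ?T"
    proof
      fix \<omega> assume \<omega>: "\<omega> \<in> {\<omega> \<in> space P. \<delta> \<le> norm (X \<omega>)}"
      have "norm (X \<omega>) \<le> norm (SI (F n) \<omega>) + norm (SI (F n) \<omega> - X \<omega>)"
        using norm_triangle_ineq4[of "SI (F n) \<omega>" "SI (F n) \<omega> - X \<omega>"] by simp
      with \<omega> \<delta> show "\<omega> \<in> ?S \<union> ?T" by auto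
    qed
    then have "emeasure P {\<omega> \<in> space P. \<delta> \<le> norm (X \<omega>)} \<le> emeasure P (?S \<union> ?T)" by (intro emeasure_mono) auto
    also have "\<dots> \<le> emeasure P ?S + emeasure P ?T" by (intro emeasure_subadditive) auto
    also have "\<dots> \<le> ennreal tail_const * H (F n) (\<delta> / 2) + ennreal (?p n)"
      using \<delta> by (intro add_mono SI_tail F) (auto simp: P.emeasure_eq_measure)
    also have "\<dots> \<le> ?b n"
    proof (intro add_mono mult_left_mono)
      have "H (F n) (\<delta> / 2) \<le> 4 * (H (\<lambda>s. F n s - f s) (\<delta> / 2) + H f (\<delta> / 2))"
        using H_add[of "\<lambda>s. F n s - f s" f "\<delta> / 2"] by simp
      also have "\<dots> \<le> 4 * (ennreal (pmax \<alpha> (1 / (\<delta> / 2))) * ?a n + ennreal (pmax \<alpha> (\<delta> / (\<delta> / 2))) * H f \<delta>)"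
        using \<delta> by (intro mult_left_mono add_mono H_scale) auto
      also have "\<dots> = 4 * (ennreal (pmax \<alpha> (2 / \<delta>)) * ?a n + 4 * H f \<delta>)"
        using \<delta> alpha by (simp add: pmax_2)
      finally show "H (F n) (\<delta> / 2) \<le> 4 * (ennreal (pmax \<alpha> (2 / \<delta>)) * ?a n + 4 * H f \<delta>)" .
    qed auto
    finally show ?thesis .
  qed
  have "?b \<longlonglongrightarrow> ennreal tail_const * (4 * (ennreal (pmax \<alpha> (2 / \<delta>)) * 0 + 4 * H f \<delta>)) + ennreal 0"
    by (intro tendsto_add ennreal_tendsto_cmult F(2) tendsto_const tendsto_ennrealI tendsto_in_probD[OF F(3)])
       (use \<delta> in auto)
  then have "emeasure P {\<omega> \<in> space P. \<delta> \<le> norm (X \<omega>)} \<le>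
      ennreal tail_const * (4 * (ennreal (pmax \<alpha> (2 / \<delta>)) * 0 + 4 * H f \<delta>)) + ennreal 0"
    using le by (rule tendsto_ge_const)
  also have "\<dots> = (ennreal tail_const * 16) * H f \<delta>" by (simp add: mult.assoc)
  also have "\<dots> \<le> ennreal (16 * tail_const) * H f \<delta>"
    by (intro mult_right_mono) (auto simp: ennreal_mult'[symmetric] simp flip: ennreal_numeral intro!: ennreal_leI)
  finally show ?thesis .
qed

text \<open>A diagonal argument: \<open>G n\<close> is replaced by a simple function that is
  1/(n+1)-close in \<open>H\<close> and whose integral is 1/(n+1)-close in probability. The simple
  case applies to these, and quasi-subadditivity returns to \<open>G n\<close>.\<close>

lemma H_integral_tendsto_0_imp_H:
  assumes GY: "\<And>n. H_integral (G n) (Y n)" and lim: "tendsto_in_prob P Y (\<lambda>_. 0)"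
  shows "(\<lambda>n. H (G n) 1) \<longlonglongrightarrow> 0"
proof -
  have [measurable]: "G n \<in> borel_measurable \<nu>" "Y n \<in> borel_measurable P" for n
    using GY by (auto simp: H_integral_def)
  have "\<exists>F. sbi F \<and> H (\<lambda>s. F s - G n s) 1 < ennreal (inverse (real (Suc n))) \<and>
      measure P {\<omega> \<in> space P. norm (SI F \<omega> - Y n \<omega>) > inverse (real (Suc n))} < inverse (real (Suc n))" for n
  proof -
    let ?e = "inverse (real (Suc n))"
    from GY[of n] obtain F where F: "\<And>k. sbi (F k)" "(\<lambda>k. H (\<lambda>s. F k s - G n s) 1) \<longlonglongrightarrow> 0"
        "tendsto_in_prob P (\<lambda>k. SI (F k)) (Y n)"
      unfolding H_integral_def by blast
    have "eventually (\<lambda>k. H (\<lambda>s. F k s - G n s) 1 < ennreal ?e) sequentially"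
      by (intro order_tendstoD[OF F(2)]) simp
    moreover have "eventually (\<lambda>k. measure P {\<omega> \<in> space P. norm (SI (F k) \<omega> - Y n \<omega>) > ?e} < ?e) sequentially"
      by (rule order_tendstoD(2)[OF tendsto_in_probD[OF F(3)]]) auto
    ultimately have "eventually (\<lambda>k. H (\<lambda>s. F k s - G n s) 1 < ennreal ?e \<and>
      measure P {\<omega> \<in> space P. norm (SI (F k) \<omega> - Y n \<omega>) > ?e} < ?e) sequentially" by (rule eventually_conj)
    then obtain k where "H (\<lambda>s. F k s - G n s) 1 < ennreal ?e \<and>
      measure P {\<omega> \<in> space P. norm (SI (F k) \<omega> - Y n \<omega>) > ?e} < ?e" by (auto simp: eventually_sequentially)
    with F(1) show ?thesis by blast
  qed
  then have "\<forall>n. \<exists>F. sbi F \<and> H (\<lambda>s. F s - G n s) 1 < ennreal (inverse (real (Suc n))) \<and>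
      measure P {\<omega> \<in> space P. norm (SI F \<omega> - Y n \<omega>) > inverse (real (Suc n))} < inverse (real (Suc n))" ..
  from choice[OF this] obtain F where F: "\<And>n. sbi (F n)" "\<And>n. H (\<lambda>s. F n s - G n s) 1 < ennreal (inverse (real (Suc n)))"
      "\<And>n. measure P {\<omega> \<in> space P. norm (SI (F n) \<omega> - Y n \<omega>) > inverse (real (Suc n))} < inverse (real (Suc n))"
    by blast
  note [measurable] = sbi_measurable[OF F(1)] SI_measurable[OF F(1)]
  have dlim: "tendsto_in_prob P (\<lambda>n \<omega>. SI (F n) \<omega> - Y n \<omega>) (\<lambda>_. 0)"
    unfolding tendsto_in_prob_def
  proof (intro allI impI)
    fix e :: real assume e: "0 < e"
    have "eventually (\<lambda>n. inverse (real (Suc n)) < e) sequentially"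
      using e by (intro order_tendstoD[OF LIMSEQ_inverse_real_of_nat]) auto
    then have ev: "eventually (\<lambda>n. measure P {\<omega> \<in> space P. norm (SI (F n) \<omega> - Y n \<omega> - 0) > e} \<le> inverse (real (Suc n))) sequentially"
    proof eventually_elim
      case (elim n)
      have "measure P {\<omega> \<in> space P. norm (SI (F n) \<omega> - Y n \<omega> - 0) > e} \<le>
          measure P {\<omega> \<in> space P. norm (SI (F n) \<omega> - Y n \<omega>) > inverse (real (Suc n))}"
        using elim by (intro P.finite_measure_mono) auto
      with F(3)[of n] show ?case by simp
    qed
    show "(\<lambda>n. measure P {\<omega> \<in> space P. norm (SI (F n) \<omega> - Y n \<omega> - 0) > e}) \<longlonglongrightarrow> 0"
      by (rule tendsto_sandwich[OF _ ev tendsto_const LIMSEQ_inverse_real_of_nat]) simp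
  qed
  have nY: "tendsto_in_prob P (\<lambda>n \<omega>. - Y n \<omega>) (\<lambda>_. 0)" using lim by (simp add: tendsto_in_prob_def)
  have "tendsto_in_prob P (\<lambda>n. SI (F n)) (\<lambda>\<omega>. 0 - 0)"
    by (rule P.tendsto_in_prob_diff[OF _ _ _ _ dlim nY]) auto
  then have "(\<lambda>n. H (F n) 1) \<longlonglongrightarrow> 0" by (intro SI_tendsto_0_imp_H F) simp
  then have "(\<lambda>n. 4 * (ennreal (inverse (real (Suc n))) + H (F n) 1)) \<longlonglongrightarrow> 4 * (ennreal 0 + 0)"
    by (intro ennreal_tendsto_cmult tendsto_add tendsto_ennrealI LIMSEQ_inverse_real_of_nat) auto
  then have lim0: "(\<lambda>n. 4 * (ennreal (inverse (real (Suc n))) + H (F n) 1)) \<longlonglongrightarrow> 0" by simp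
  have "H (G n) 1 \<le> 4 * (ennreal (inverse (real (Suc n))) + H (F n) 1)" for n
  proof -
    have "H (G n) 1 \<le> 4 * (H (\<lambda>s. G n s - F n s) 1 + H (F n) 1)"
      using H_add[of "\<lambda>s. G n s - F n s" "F n" 1] by simp
    also have "\<dots> \<le> 4 * (ennreal (inverse (real (Suc n))) + H (F n) 1)"
      unfolding H_minus_commute[of "G n"] by (intro mult_left_mono add_mono less_imp_le[OF F(2)]) auto
    finally show ?thesis .
  qed
  then show ?thesis
    by (intro tendsto_sandwich[OF always_eventually always_eventually tendsto_const lim0] allI zero_le)
qed

lemma sbi_indicator:
  assumes F: "sbi F" and A: "A \<in> sets \<nu>" shows "sbi (\<lambda>s. indicator A s *\<^sub>R F s)"
proof
  show "simple_function \<nu> (\<lambda>s. indicator A s *\<^sub>R F s)"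
    using A by (intro simple_function_compose2[where h = "(*\<^sub>R)"] simple_function_indicator sbi_simple F)
  have "emeasure \<nu> {y \<in> space \<nu>. indicator A y *\<^sub>R F y \<noteq> 0} \<le> emeasure \<nu> {y \<in> space \<nu>. F y \<noteq> 0}"
    using sbi_measurable[OF F] by (intro emeasure_mono) auto
  then show "emeasure \<nu> {y \<in> space \<nu>. indicator A y *\<^sub>R F y \<noteq> 0} \<noteq> \<infinity>"
    using F by (auto elim!: Bochner_Integration.simple_bochner_integrable.cases simp: top_unique)
qed

lemma SI_converges:
  assumes F: "\<And>n. sbi (F n)" and cauchy: "H_cauchy F"
  obtains X where "X \<in> borel_measurable P" "tendsto_in_prob P (\<lambda>n. SI (F n)) X"
proof (rule P.tendsto_in_prob_if_cauchy[of "\<lambda>n. SI (F n)"])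
  fix e :: real assume e: "0 < e"
  \<comment> \<open>Adding 1 keeps c positive, so that e / c is an admissible tolerance even if the
    tail constant vanishes.\<close>
  define c where "c = tail_const * pmax \<alpha> (1 / e) + 1"
  have c: "0 < c" by (simp add: c_def add_nonneg_pos)
  obtain N where N: "\<And>m n. m \<ge> N \<Longrightarrow> n \<ge> N \<Longrightarrow> H (\<lambda>s. F m s - F n s) 1 \<le> ennreal (e / c)"
    using cauchy e c unfolding H_cauchy_def by (meson divide_pos_pos)
  have "emeasure P {\<omega> \<in> space P. e < norm (SI (F m) \<omega> - SI (F n) \<omega>)} \<le> ennreal e" if "m \<ge> N" "n \<ge> N" for m n
  proof -
    let ?D = "\<lambda>s. F m s - F n s"
    note [measurable] = SI_measurable[OF F] SI_measurable[OF sbi_diff[OF F F]] sbi_measurable[OF F]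
    have "emeasure P {\<omega> \<in> space P. e < norm (SI (F m) \<omega> - SI (F n) \<omega>)} \<le> emeasure P {\<omega> \<in> space P. e \<le> norm (SI ?D \<omega>)}"
      using SI_diff[OF F F, of m n] by (intro emeasure_mono_AE) (auto elim!: eventually_mono)
    also have "\<dots> \<le> ennreal tail_const * H ?D e" by (intro SI_tail sbi_diff F e)
    also have "\<dots> \<le> ennreal tail_const * (ennreal (pmax \<alpha> (1 / e)) * H ?D 1)"
      using e by (intro mult_left_mono H_scale) auto
    also have "\<dots> = ennreal (tail_const * pmax \<alpha> (1 / e)) * H ?D 1" by (simp add: ennreal_mult' mult.assoc)
    also have "\<dots> \<le> ennreal c * ennreal (e / c)"
      by (intro mult_mono N that ennreal_leI) (auto simp: c_def)
    also have "\<dots> = ennreal e" using c e by (simp add: ennreal_mult'[symmetric])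
    finally show ?thesis .
  qed
  then show "\<exists>N. \<forall>m\<ge>N. \<forall>n\<ge>N. emeasure P {\<omega> \<in> space P. e < norm (SI (F m) \<omega> - SI (F n) \<omega>)} \<le> ennreal e"
    by blast
qed (rule SI_measurable[OF F], erule (1) that)

lemma V_imp_integrable:
  assumes f: "f \<in> V" shows "\<exists>X. has_ISRM_integral P \<nu> M f X"
proof -
  note [measurable] = V_measurable[OF f]
  obtain F where F: "\<And>n. sbi (F n)" "(\<lambda>n. H (\<lambda>s. F n s - f s) 1) \<longlonglongrightarrow> 0" "AE s in \<nu>. (\<lambda>n. F n s) \<longlonglongrightarrow> f s"
    using simple_approximation[OF f] by blast
  note [measurable] = sbi_measurable[OF F(1)]
  have cauchy: "H_cauchy F" by (rule H_convergent_imp_cauchy[OF _ _ F(2)]) auto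
  obtain X where X: "X \<in> borel_measurable P" "tendsto_in_prob P (\<lambda>n. SI (F n)) X"
    using SI_converges[OF F(1) cauchy] by blast
  have "\<exists>Y\<in>borel_measurable P. tendsto_in_prob P (\<lambda>n. SI (\<lambda>s. indicator A s *\<^sub>R F n s)) Y" if A: "A \<in> sets \<nu>" for A
  proof -
    \<comment> \<open>Multiplication by an indicator replaces some matrices by 0 and never increases
      \<open>H\<close>, so convergence over A follows from that over the whole space.\<close>
    have "H (\<lambda>s. indicator A s *\<^sub>R F m s - indicator A s *\<^sub>R F n s) 1 \<le> H (\<lambda>s. F m s - F n s) 1" for m n
      unfolding H_fun_def by (intro nn_integral_mono) (auto simp: indicator_def)
    then have "H_cauchy (\<lambda>n s. indicator A s *\<^sub>R F n s)"
      using cauchy unfolding H_cauchy_def by (meson order_trans)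
    from SI_converges[OF sbi_indicator[OF F(1) A] this] show ?thesis by blast
  qed
  then show ?thesis unfolding has_ISRM_integral_def using F X by auto
qed

lemma ISRM_integrable_eq_V: "ISRM_integrable P \<nu> M = V"
  unfolding ISRM_integrable_def by (blast intro: V_imp_integrable dest: has_ISRM_imp_H_integral(2))

text \<open>The estimates hold for every X with \<open>H_integral f X\<close>, hence for whatever
  version the choice operator selects.\<close>

lemma H_integral_ISRM_integral: "f \<in> V \<Longrightarrow> H_integral f (ISRM_integral P \<nu> M f)"
  unfolding ISRM_integral_def by (rule has_ISRM_imp_H_integral(1)[OF someI_ex[OF V_imp_integrable]])

end

section \<open>Moments and the theorem\<close>

text \<open>For x between 2^k b and 2^(k+1) b the summand of index k alone dominates; below b the
  constant does. Tail indicators are used so that integration leads directly to tail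
  probabilities.\<close>

lemma powr_le_dyadic_sum:
  fixes x b p :: real
  assumes "0 < b" "0 \<le> x" "0 < p"
  shows "ennreal (x powr p) \<le> ennreal (b powr p) + (\<Sum>k. ennreal ((2 ^ Suc k * b) powr p) * indicator {y. 2 ^ k * b \<le> y} x)"
proof (cases "x < b")
  case True
  then have "ennreal (x powr p) \<le> ennreal (b powr p)"
    using assms by (intro ennreal_leI powr_mono2) auto
  then show ?thesis by (intro add_increasing2) auto
next
  case False
  have ex: "\<exists>n. x < 2 ^ n * b"
    using real_arch_pow[of 2 "x / b"] assms(1) by (auto simp: field_simps)
  define n where "n = (LEAST n. x < 2 ^ n * b)"
  have n: "x < 2 ^ n * b" unfolding n_def using ex by (rule LeastI_ex)
  have "n \<noteq> 0" using n False by (intro notI) simp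
  then obtain k where k: "n = Suc k" by (cases n) auto
  have "\<not> x < 2 ^ k * b" using not_less_Least[of k "\<lambda>n. x < 2 ^ n * b"] k by (simp add: n_def)
  define g where "g = (\<lambda>k. ennreal ((2 ^ Suc k * b) powr p) * indicator {y. 2 ^ k * b \<le> y} x)"
  have "ennreal (x powr p) \<le> sum g {k}"
    using n k assms \<open>\<not> x < 2 ^ k * b\<close> by (auto simp: g_def intro!: ennreal_leI powr_mono2)
  also have "\<dots> \<le> suminf g"
    by (rule sum_le_suminf) auto
  finally show ?thesis unfolding g_def by (intro add_increasing) auto
qed

context tempered_isrm
begin

text \<open>The dyadic levels are multiples of the quasi-norm and degenerate when it is 0. In that
  case \<open>H\<close> vanishes at every scale, hence so do all tails.\<close>

lemma H_integral_null:
  assumes f: "f \<in> V" and fX: "H_integral f X" and N0: "N f = 0"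
  shows "AE \<omega> in P. X \<omega> = 0"
proof -
  have [measurable]: "X \<in> borel_measurable P" using fX by (simp add: H_integral_def)
  have "AE \<omega> in P. \<not> inverse (real (Suc n)) \<le> norm (X \<omega>)" for n
  proof (rule AE_I[where N = "{\<omega> \<in> space P. inverse (real (Suc n)) \<le> norm (X \<omega>)}"])
    have "H f (inverse (real (Suc n))) = 0"
      using N0 N_eq_0_iff[OF f] H_eq_0_iff[OF V_measurable[OF f], of "inverse (real (Suc n))"] by simp
    then show "emeasure P {\<omega> \<in> space P. inverse (real (Suc n)) \<le> norm (X \<omega>)} = 0"
      using H_integral_tail[OF fX, of "inverse (real (Suc n))"] by simp
  qed auto
  then have "AE \<omega> in P. \<forall>n. \<not> inverse (real (Suc n)) \<le> norm (X \<omega>)" by (simp add: AE_all_countable)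
  then show ?thesis
  proof eventually_elim
    case (elim \<omega>)
    show ?case
    proof (rule ccontr)
      assume "X \<omega> \<noteq> 0"
      then obtain n where "inverse (real (Suc n)) < norm (X \<omega>)"
        using reals_Archimedean[of "norm (X \<omega>)"] by auto
      with elim show False by (auto dest: spec[of _ n])
    qed
  qed
qed

text \<open>With b = \<open>N f\<close>, the tail at level 2^k b is at most a constant times 2^(-
  \<alpha> k). Against weights of order 2^(p k) this leaves a geometric series of ratio
  \<open>2 powr (p - \<alpha>)\<close>, below 1 because p < \<alpha>; its sum gives the
  denominator.\<close>

lemma H_integral_moment:
  assumes p: "0 < p" "p < \<alpha>" and f: "f \<in> V" and fX: "H_integral f X"
  shows "(\<integral>\<^sup>+\<omega>. ennreal (norm (X \<omega>) powr p) \<partial>P) \<le>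
    ennreal ((1 + 16 * tail_const * 2 powr p / (1 - 2 powr (p - \<alpha>))) * N f powr p)"
proof (cases "N f = 0")
  case True
  from H_integral_null[OF f fX this] have "(\<integral>\<^sup>+\<omega>. ennreal (norm (X \<omega>) powr p) \<partial>P) = (\<integral>\<^sup>+\<omega>. 0 \<partial>P)"
    by (intro nn_integral_cong_AE) (auto elim: eventually_mono)
  then show ?thesis by simp
next
  case False
  have [measurable]: "X \<in> borel_measurable P" using fX by (simp add: H_integral_def)
  define b L q where "b = N f" and "L = 16 * tail_const" and "q = 2 powr (p - \<alpha>)"
  have b: "0 < b" using False N_nonneg[OF f] by (simp add: b_def)
  have L: "0 \<le> L" by (simp add: L_def)
  have q: "0 < q" "q < 1" using p powr_less_mono[of "p - \<alpha>" 0 2] by (auto simp: q_def)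
  have dyadic: "ennreal ((2 ^ Suc k * b) powr p) * emeasure P {\<omega> \<in> space P. 2 ^ k * b \<le> norm (X \<omega>)}
      \<le> ennreal (L * 2 powr p * b powr p * q ^ k)" for k
  proof -
    have "emeasure P {\<omega> \<in> space P. 2 ^ k * b \<le> norm (X \<omega>)} \<le> ennreal L * H f (2 ^ k * b)"
      unfolding L_def using b by (intro H_integral_tail[OF fX]) simp
    also have "\<dots> \<le> ennreal L * ennreal (pmax \<alpha> (N f / (2 ^ k * b)))"
      using b by (intro mult_left_mono H_le_N f) auto
    also have "N f / (2 ^ k * b) = 1 / 2 ^ k" using b by (simp add: b_def)
    also have "pmax \<alpha> (1 / 2 ^ k) = (1 / 2 ^ k) powr \<alpha>" using alpha by (intro pmax_le_1) auto
    also have "(1 / 2 ^ k) powr \<alpha> = (2 powr - \<alpha>) ^ k"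
      by (simp add: powr_divide powr_minus_divide power_one_over powr_realpow[symmetric] powr_powr mult.commute)
    finally have "ennreal ((2 ^ Suc k * b) powr p) * emeasure P {\<omega> \<in> space P. 2 ^ k * b \<le> norm (X \<omega>)} \<le>
        ennreal ((2 ^ Suc k * b) powr p) * (ennreal L * ennreal ((2 powr - \<alpha>) ^ k))"
      by (intro mult_left_mono) auto
    also have "\<dots> = ennreal ((2 ^ Suc k * b) powr p * (L * (2 powr - \<alpha>) ^ k))"
      using L by (simp add: ennreal_mult'[symmetric])
    also have "(2 ^ Suc k * b) powr p * (L * (2 powr - \<alpha>) ^ k) =
        L * 2 powr p * b powr p * (2 powr p * 2 powr - \<alpha>) ^ k"
    proof -
      have "(2 ^ Suc k * b) powr p = 2 powr p * (2 powr p) ^ k * b powr p"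
        using b by (simp add: powr_mult powr_realpow[symmetric] powr_powr mult.commute)
      then show ?thesis by (simp add: power_mult_distrib mult_ac)
    qed
    also have "2 powr p * 2 powr - \<alpha> = q" by (simp add: q_def powr_add[symmetric])
    finally show ?thesis .
  qed
  have "(\<integral>\<^sup>+\<omega>. ennreal (norm (X \<omega>) powr p) \<partial>P) \<le> (\<integral>\<^sup>+\<omega>. ennreal (b powr p) +
      (\<Sum>k. ennreal ((2 ^ Suc k * b) powr p) * indicator {y. 2 ^ k * b \<le> y} (norm (X \<omega>))) \<partial>P)"
    using b p by (intro nn_integral_mono powr_le_dyadic_sum) auto
  also have "\<dots> = ennreal (b powr p) +
      (\<Sum>k. ennreal ((2 ^ Suc k * b) powr p) * (\<integral>\<^sup>+\<omega>. indicator {y. 2 ^ k * b \<le> y} (norm (X \<omega>)) \<partial>P))"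
    by (subst nn_integral_add, measurable, subst nn_integral_suminf, measurable, subst nn_integral_cmult)
       (auto simp: P.emeasure_space_1)
  also have "(\<lambda>k. \<integral>\<^sup>+\<omega>. indicator {y. 2 ^ k * b \<le> y} (norm (X \<omega>)) \<partial>P) =
      (\<lambda>k. emeasure P {\<omega> \<in> space P. 2 ^ k * b \<le> norm (X \<omega>)})"
  proof
    fix k
    have "(\<integral>\<^sup>+\<omega>. indicator {y. 2 ^ k * b \<le> y} (norm (X \<omega>)) \<partial>P) =
      (\<integral>\<^sup>+\<omega>. indicator {\<omega> \<in> space P. 2 ^ k * b \<le> norm (X \<omega>)} \<omega> \<partial>P)"
      by (intro nn_integral_cong) (auto simp: indicator_def)
    also have "\<dots> = emeasure P {\<omega> \<in> space P. 2 ^ k * b \<le> norm (X \<omega>)}"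
      by (rule nn_integral_indicator) measurable
    finally show "(\<integral>\<^sup>+\<omega>. indicator {y. 2 ^ k * b \<le> y} (norm (X \<omega>)) \<partial>P) = \<dots>" .
  qed
  also have "ennreal (b powr p) + (\<Sum>k. ennreal ((2 ^ Suc k * b) powr p) * emeasure P {\<omega> \<in> space P. 2 ^ k * b \<le> norm (X \<omega>)})
      \<le> ennreal (b powr p) + (\<Sum>k. ennreal (L * 2 powr p * b powr p * q ^ k))"
    by (intro add_mono suminf_le dyadic) auto
  also have "(\<Sum>k. ennreal (L * 2 powr p * b powr p * q ^ k)) = ennreal (L * 2 powr p * b powr p * (1 / (1 - q)))"
    using L q by (subst suminf_ennreal2) (auto simp: suminf_mult suminf_geometric intro!: summable_mult summable_geometric)
  also have "ennreal (b powr p) + \<dots> = ennreal ((1 + L * 2 powr p / (1 - q)) * b powr p)"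
    using L q by (subst ennreal_plus[symmetric]) (auto simp: field_simps)
  finally show ?thesis by (simp add: b_def L_def q_def)
qed

text \<open>Both sides are reduced to \<open>H\<close> of the differences at scale 1. One direction
  is the diagonal argument; the other is the tail bound at level e, rescaled from e to 1.\<close>

lemma tendsto_in_prob_iff_N:
  assumes F: "\<And>n. F n \<in> V" and f: "f \<in> V"
  shows "tendsto_in_prob P (\<lambda>n. ISRM_integral P \<nu> M (F n)) (ISRM_integral P \<nu> M f) \<longleftrightarrow>
    (\<lambda>n. N (\<lambda>s. F n s - f s)) \<longlonglongrightarrow> 0"
proof -
  let ?Y = "\<lambda>n \<omega>. ISRM_integral P \<nu> M (F n) \<omega> - ISRM_integral P \<nu> M f \<omega>"
  have Y: "H_integral (\<lambda>s. F n s - f s) (?Y n)" for n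
    by (intro H_integral_diff H_integral_ISRM_integral F f)
  have [measurable]: "?Y n \<in> borel_measurable P" for n using Y[of n] by (simp add: H_integral_def)
  have D: "(\<lambda>s. F n s - f s) \<in> V" for n by (intro V_diff F f)
  have eq: "tendsto_in_prob P (\<lambda>n. ISRM_integral P \<nu> M (F n)) (ISRM_integral P \<nu> M f) \<longleftrightarrow> tendsto_in_prob P ?Y (\<lambda>_. 0)"
    by (simp add: tendsto_in_prob_def)
  show ?thesis unfolding eq N_tendsto_0_iff[OF D]
  proof
    assume "tendsto_in_prob P ?Y (\<lambda>_. 0)"
    then show "(\<lambda>n. H (\<lambda>s. F n s - f s) 1) \<longlonglongrightarrow> 0" by (rule H_integral_tendsto_0_imp_H[OF Y])
  next
    assume lim: "(\<lambda>n. H (\<lambda>s. F n s - f s) 1) \<longlonglongrightarrow> 0"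
    show "tendsto_in_prob P ?Y (\<lambda>_. 0)"
      unfolding tendsto_in_prob_def
    proof (intro allI impI)
      fix e :: real assume e: "0 < e"
      let ?c = "ennreal (16 * tail_const) * ennreal (pmax \<alpha> (1 / e))"
      have "(\<lambda>n. ?c * H (\<lambda>s. F n s - f s) 1) \<longlonglongrightarrow> ?c * 0"
        by (intro ennreal_tendsto_cmult lim) (simp add: ennreal_mult_less_top)
      then have lim0: "(\<lambda>n. ?c * H (\<lambda>s. F n s - f s) 1) \<longlonglongrightarrow> 0" by simp
      have le: "emeasure P {\<omega> \<in> space P. norm (?Y n \<omega> - 0) > e} \<le> ?c * H (\<lambda>s. F n s - f s) 1" for n
      proof -
        have "emeasure P {\<omega> \<in> space P. norm (?Y n \<omega> - 0) > e} \<le> emeasure P {\<omega> \<in> space P. e \<le> norm (?Y n \<omega>)}"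
          by (intro emeasure_mono) auto
        also have "\<dots> \<le> ennreal (16 * tail_const) * H (\<lambda>s. F n s - f s) e"
          by (rule H_integral_tail[OF Y e])
        also have "\<dots> \<le> ennreal (16 * tail_const) * (ennreal (pmax \<alpha> (1 / e)) * H (\<lambda>s. F n s - f s) 1)"
          using e by (intro mult_left_mono H_scale V_measurable[OF D]) auto
        finally show ?thesis by (simp add: mult.assoc)
      qed
      have "(\<lambda>n. emeasure P {\<omega> \<in> space P. norm (?Y n \<omega> - 0) > e}) \<longlonglongrightarrow> 0"
        by (rule tendsto_sandwich[OF _ _ tendsto_const lim0]) (intro always_eventually allI le zero_le)+
      then have "(\<lambda>n. ennreal (measure P {\<omega> \<in> space P. norm (?Y n \<omega> - 0) > e})) \<longlonglongrightarrow> ennreal 0"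
        by (simp add: P.emeasure_eq_measure)
      then show "(\<lambda>n. measure P {\<omega> \<in> space P. norm (?Y n \<omega> - 0) > e}) \<longlonglongrightarrow> 0"
        by (rule tendsto_ennrealD) auto
    qed
  qed
qed

lemma V_eq_all: "V = {f \<in> borel_measurable \<nu>. \<forall>\<delta>>0. H f \<delta> < \<infinity>}"
  using V_H_finite by (auto simp: V_def)

lemma V_eq_ex: "V = {f \<in> borel_measurable \<nu>. \<exists>\<delta>>0. H f \<delta> < \<infinity>}"
  unfolding V_def by (blast intro: H_finite zero_less_one)

end

theorem theorem2p9:
  fixes \<alpha> :: real and a :: "real^'n" and \<mu> \<phi> R :: "(real^'n) measure"
    and \<nu> :: "'s measure" and P :: "'w measure" and M :: "'s set \<Rightarrow> 'w \<Rightarrow> real^'n"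
  assumes "0 < \<alpha>" and "\<alpha> < 2"
    and "proper_tempered_stable \<alpha> \<mu> a \<phi>"
    and "full_law \<mu>"
    and "symmetric_law \<mu>"
    and "rosinski_measure \<alpha> \<phi> R"
    and "sigma_finite_measure \<nu>"
    and "ISRM_generated_by P \<nu> M a \<phi>"
  shows
    "(ISRM_integrable P \<nu> M = {f \<in> borel_measurable \<nu>. \<forall>\<delta>>0. H_fun \<alpha> R \<nu> f \<delta> < \<infinity>} \<and>
      ISRM_integrable P \<nu> M = {f \<in> borel_measurable \<nu>. \<exists>\<delta>>0. H_fun \<alpha> R \<nu> f \<delta> < \<infinity>}) \<and>

     ((\<forall>f\<in>ISRM_integrable P \<nu> M. {\<delta>. \<delta> > 0 \<and> H_fun \<alpha> R \<nu> f \<delta> \<le> 1} \<noteq> {}) \<and>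
      quasi_norm_AE \<nu> (ISRM_integrable P \<nu> M) (M_norm \<alpha> R \<nu>) \<and>
      (\<forall>f\<in>ISRM_integrable P \<nu> M. \<forall>\<delta>>0.
         ennreal (min ((M_norm \<alpha> R \<nu> f / \<delta>) powr \<alpha>) ((M_norm \<alpha> R \<nu> f / \<delta>)\<^sup>2)) \<le> H_fun \<alpha> R \<nu> f \<delta> \<and>
         H_fun \<alpha> R \<nu> f \<delta> \<le> ennreal (max ((M_norm \<alpha> R \<nu> f / \<delta>) powr \<alpha>) ((M_norm \<alpha> R \<nu> f / \<delta>)\<^sup>2)))) \<and>

     ((\<exists>L\<^sub>1\<ge>1. \<forall>f\<in>ISRM_integrable P \<nu> M. \<forall>\<delta>>0.
         emeasure P {\<omega> \<in> space P. norm (ISRM_integral P \<nu> M f \<omega>) \<ge> \<delta>} \<le> ennreal L\<^sub>1 * H_fun \<alpha> R \<nu> f \<delta>) \<and>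
      (\<forall>p. 0 < p \<and> p < \<alpha> \<longrightarrow>
         (\<exists>L\<^sub>2>0. \<forall>f\<in>ISRM_integrable P \<nu> M.
            (\<integral>\<^sup>+\<omega>. ennreal (norm (ISRM_integral P \<nu> M f \<omega>) powr p) \<partial>P) \<le> ennreal (L\<^sub>2 * M_norm \<alpha> R \<nu> f powr p)))) \<and>

     (complete_wrt (ISRM_integrable P \<nu> M) (M_norm \<alpha> R \<nu>) \<and>
      (\<forall>F f. (\<forall>n::nat. F n \<in> ISRM_integrable P \<nu> M) \<and> f \<in> ISRM_integrable P \<nu> M \<longrightarrow>
         (tendsto_in_prob P (\<lambda>n. ISRM_integral P \<nu> M (F n)) (ISRM_integral P \<nu> M f) \<longleftrightarrow>
          (\<lambda>n. M_norm \<alpha> R \<nu> (\<lambda>s. F n s - f s)) \<longlonglongrightarrow> 0)))"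
proof -
  have law: "id_law \<mu> a \<phi>"
    using assms(3) by (auto simp: proper_tempered_stable_def tempered_stable_def)
  then have "levy_measure \<phi>" by (simp add: id_law_def)
  then interpret tempered_isrm \<alpha> \<phi> R a \<mu> \<nu> P M
    using assms law by unfold_locales
  show ?thesis
    unfolding ISRM_integrable_eq_V pmin_def[symmetric] pmax_def[symmetric]
  proof (intro conjI ballI allI impI)
    show "V = {f \<in> borel_measurable \<nu>. \<forall>\<delta>>0. H f \<delta> < \<infinity>}" by (rule V_eq_all)
    show "V = {f \<in> borel_measurable \<nu>. \<exists>\<delta>>0. H f \<delta> < \<infinity>}" by (rule V_eq_ex)
    show "quasi_norm_AE \<nu> V N" by (rule quasi_norm_N)
    show "complete_wrt V N" by (rule complete_N)
    show "{\<delta>. \<delta> > 0 \<and> H f \<delta> \<le> 1} \<noteq> {}" if "f \<in> V" for f using that by (rule N_set_nonempty)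
    show "ennreal (pmin \<alpha> (N f / \<delta>)) \<le> H f \<delta>" "H f \<delta> \<le> ennreal (pmax \<alpha> (N f / \<delta>))"
      if "f \<in> V" "0 < \<delta>" for f \<delta> using that by (auto intro: N_le_H H_le_N)
    show "\<exists>L\<^sub>1\<ge>1. \<forall>f\<in>V. \<forall>\<delta>>0.
        emeasure P {\<omega> \<in> space P. \<delta> \<le> norm (ISRM_integral P \<nu> M f \<omega>)} \<le> ennreal L\<^sub>1 * H f \<delta>"
    \<comment> \<open>The maximum secures a constant of at least 1.\<close>
    proof (intro exI[of _ "max 1 (16 * tail_const)"] conjI ballI allI impI)
      fix f and \<delta> :: real assume "f \<in> V" "0 < \<delta>"
      then have "emeasure P {\<omega> \<in> space P. \<delta> \<le> norm (ISRM_integral P \<nu> M f \<omega>)} \<le> ennreal (16 * tail_const) * H f \<delta>"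
        by (intro H_integral_tail H_integral_ISRM_integral)
      also have "\<dots> \<le> ennreal (max 1 (16 * tail_const)) * H f \<delta>"
        by (intro mult_right_mono ennreal_leI) auto
      finally show "emeasure P {\<omega> \<in> space P. \<delta> \<le> norm (ISRM_integral P \<nu> M f \<omega>)} \<le> \<dots>" .
    qed simp
    show "\<exists>L\<^sub>2>0. \<forall>f\<in>V. (\<integral>\<^sup>+\<omega>. ennreal (norm (ISRM_integral P \<nu> M f \<omega>) powr p) \<partial>P) \<le> ennreal (L\<^sub>2 * N f powr p)"
      if p: "0 < p \<and> p < \<alpha>" for p
    proof (intro exI[of _ "1 + 16 * tail_const * 2 powr p / (1 - 2 powr (p - \<alpha>))"] conjI ballI)
      have "2 powr (p - \<alpha>) < 2 powr 0" using p by (intro powr_less_mono) auto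
      then show "0 < 1 + 16 * tail_const * 2 powr p / (1 - 2 powr (p - \<alpha>))"
        by (intro add_pos_nonneg divide_nonneg_nonneg) auto
    qed (use p in \<open>auto intro: H_integral_moment H_integral_ISRM_integral\<close>)
    show "tendsto_in_prob P (\<lambda>n. ISRM_integral P \<nu> M (F n)) (ISRM_integral P \<nu> M f) \<longleftrightarrow>
        (\<lambda>n. N (\<lambda>s. F n s - f s)) \<longlonglongrightarrow> 0"
      if "(\<forall>n. F n \<in> V) \<and> f \<in> V" for F f
      using that by (intro tendsto_in_prob_iff_N) auto
  qed
qed

end
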